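(* Let $R$ be an almost local-global semihereditary ring. Then $R$ has the stacked bases property.
   Context: All rings are commutative with identity. A ring is semihereditary if every finitely generated ideal is projective. An ideal $I$ of $R$ is faithful if its annihilator $(0:I)$ is $0$; an ideal is invertible if it is invertible as a fractional ideal in the total ring of fractions of $R$. A ring $R$ is local-global if each polynomial $f$ over $R$ in finitely many indeterminates which admits unit values locally (i.e. for every maximal ideal $P$, $f$ takes a unit value over $R_P$) admits unit values over $R$. A ring $R$ is almost local-global if for every faithful principal ideal $I$ of $R$, the ring $R/I$ is local-global. A semihereditary ring $R$ has the stacked bases property if for each finitely presented $R$-module $M$ and each presentation $0\to H\to F\to M\to 0$ with $F$ a finitely generated free module (regard $H$ as a submodule of $F$), there exist finitely generated ideals $J_1,\dots,J_n$ of $R$ and invertible ideals $I_1\supseteq\dots\supseteq I_m$ of $R$, with $m\le n$, and an isomorphism $F\cong J_1\oplus\dots\oplus J_n$ which maps $H$ onto $I_1J_1\oplus\dots\oplus I_mJ_m$. *)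

theory Defs
  imports "HOL-Algebra.Ideal_Product" "HOL-Algebra.QuotRing" "HOL-Algebra.Module"
    "HOL-Algebra.Indexed_Polynomials"
begin

section \<open>Rings of fractions\<close>

definition frac_rel :: "('a, 'b) ring_scheme \<Rightarrow> 'a set \<Rightarrow> (('a \<times> 'a) \<times> ('a \<times> 'a)) set"
  where "frac_rel R S = {((a, s), (b, t)). a \<in> carrier R \<and> s \<in> S \<and> b \<in> carrier R \<and> t \<in> S \<and>
    (\<exists>u\<in>S. u \<otimes>\<^bsub>R\<^esub> (a \<otimes>\<^bsub>R\<^esub> t) = u \<otimes>\<^bsub>R\<^esub> (b \<otimes>\<^bsub>R\<^esub> s))}"

definition fraction :: "('a, 'b) ring_scheme \<Rightarrow> 'a set \<Rightarrow> 'a \<Rightarrow> 'a \<Rightarrow> ('a \<times> 'a) set"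
  where "fraction R S a s = frac_rel R S `` {(a, s)}"

text \<open>As for \<^const>\<open>FactRing\<close>, the operations are unions over all representatives; for a
  multiplicative set \<open>S\<close> of a commutative ring all members of such a union coincide.\<close>

definition localization :: "('a, 'b) ring_scheme \<Rightarrow> 'a set \<Rightarrow> ('a \<times> 'a) set ring"
  where "localization R S =
    \<lparr>carrier = (carrier R \<times> S) // frac_rel R S,
     monoid.mult = (\<lambda>A B. \<Union>(a, s)\<in>A. \<Union>(b, t)\<in>B. fraction R S (a \<otimes>\<^bsub>R\<^esub> b) (s \<otimes>\<^bsub>R\<^esub> t)),
     one = fraction R S \<one>\<^bsub>R\<^esub> \<one>\<^bsub>R\<^esub>,
     zero = fraction R S \<zero>\<^bsub>R\<^esub> \<one>\<^bsub>R\<^esub>,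
     add = (\<lambda>A B. \<Union>(a, s)\<in>A. \<Union>(b, t)\<in>B.
              fraction R S (a \<otimes>\<^bsub>R\<^esub> t \<oplus>\<^bsub>R\<^esub> b \<otimes>\<^bsub>R\<^esub> s) (s \<otimes>\<^bsub>R\<^esub> t))\<rparr>"

definition localize :: "('a, 'b) ring_scheme \<Rightarrow> 'a set \<Rightarrow> 'a \<Rightarrow> ('a \<times> 'a) set"
  where "localize R S a = fraction R S a \<one>\<^bsub>R\<^esub>"

definition regular_elements :: "('a, 'b) ring_scheme \<Rightarrow> 'a set"
  where "regular_elements R =
    {s \<in> carrier R. \<forall>x\<in>carrier R. s \<otimes>\<^bsub>R\<^esub> x = \<zero>\<^bsub>R\<^esub> \<longrightarrow> x = \<zero>\<^bsub>R\<^esub>}"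

abbreviation total_fraction_ring :: "('a, 'b) ring_scheme \<Rightarrow> ('a \<times> 'a) set ring"
  where "total_fraction_ring R \<equiv> localization R (regular_elements R)"

abbreviation to_total_fraction_ring :: "('a, 'b) ring_scheme \<Rightarrow> 'a \<Rightarrow> ('a \<times> 'a) set"
  where "to_total_fraction_ring R \<equiv> localize R (regular_elements R)"


section \<open>Ideals\<close>

definition annihilator :: "('a, 'b) ring_scheme \<Rightarrow> 'a set \<Rightarrow> 'a set"
  where "annihilator R I = {r \<in> carrier R. \<forall>x\<in>I. r \<otimes>\<^bsub>R\<^esub> x = \<zero>\<^bsub>R\<^esub>}"

definition faithful_ideal :: "('a, 'b) ring_scheme \<Rightarrow> 'a set \<Rightarrow> bool"
  where "faithful_ideal R I \<longleftrightarrow> ideal I R \<and> annihilator R I = {\<zero>\<^bsub>R\<^esub>}"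

definition fg_ideal :: "('a, 'b) ring_scheme \<Rightarrow> 'a set \<Rightarrow> bool"
  where "fg_ideal R I \<longleftrightarrow> (\<exists>B. finite B \<and> B \<subseteq> carrier R \<and> I = Idl\<^bsub>R\<^esub> B)"

definition fractional_ideal :: "('a, 'b) ring_scheme \<Rightarrow> ('a \<times> 'a) set set \<Rightarrow> bool"
  where "fractional_ideal R K \<longleftrightarrow>
    additive_subgroup K (total_fraction_ring R) \<and>
    (\<forall>r\<in>carrier R. \<forall>x\<in>K. to_total_fraction_ring R r \<otimes>\<^bsub>total_fraction_ring R\<^esub> x \<in> K) \<and>
    (\<exists>d\<in>regular_elements R. \<forall>x\<in>K.
       to_total_fraction_ring R d \<otimes>\<^bsub>total_fraction_ring R\<^esub> x \<in> to_total_fraction_ring R ` carrier R)"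

text \<open>The product of two fractional ideals consists of the finite sums of products, which is what
  \<^const>\<open>ideal_prod\<close>, taken in the total ring of fractions, describes for arbitrary subgroups.\<close>

definition invertible_ideal :: "('a, 'b) ring_scheme \<Rightarrow> 'a set \<Rightarrow> bool"
  where "invertible_ideal R I \<longleftrightarrow> ideal I R \<and>
    (\<exists>K. fractional_ideal R K \<and>
       (to_total_fraction_ring R ` I) \<cdot>\<^bsub>total_fraction_ring R\<^esub> K = to_total_fraction_ring R ` carrier R)"


section \<open>Modules\<close>

text \<open>The predicate \<^const>\<open>module\<close> ignores the fields \<^const>\<open>monoid.mult\<close> and \<^const>\<open>monoid.one\<close> of a module
  record.\<close>

definition module_hom ::
    "('a, 'b) ring_scheme \<Rightarrow> ('a, 'm, 'c) module_scheme \<Rightarrow> ('a, 'n, 'd) module_scheme \<Rightarrow> ('m \<Rightarrow> 'n) set"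
  where "module_hom R M N = {f \<in> carrier M \<rightarrow> carrier N.
    (\<forall>x\<in>carrier M. \<forall>y\<in>carrier M. f (x \<oplus>\<^bsub>M\<^esub> y) = f x \<oplus>\<^bsub>N\<^esub> f y) \<and>
    (\<forall>r\<in>carrier R. \<forall>x\<in>carrier M. f (r \<odot>\<^bsub>M\<^esub> x) = r \<odot>\<^bsub>N\<^esub> f x)}"

definition module_iso ::
    "('a, 'b) ring_scheme \<Rightarrow> ('a, 'm, 'c) module_scheme \<Rightarrow> ('a, 'n, 'd) module_scheme \<Rightarrow> ('m \<Rightarrow> 'n) set"
  where "module_iso R M N = {f \<in> module_hom R M N. bij_betw f (carrier M) (carrier N)}"

definition ideal_module :: "('a, 'b) ring_scheme \<Rightarrow> 'a set \<Rightarrow> ('a, 'a) module"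
  where "ideal_module R I =
    \<lparr>carrier = I, monoid.mult = monoid.mult R, one = one R, zero = zero R, add = add R, smult = monoid.mult R\<rparr>"

text \<open>External direct sum of a family of ideals. Its elements are functions that vanish outside the
  index set, so that the direct sum of a family \<open>J'\<close> over \<open>U' \<subseteq> U\<close> with \<open>J' x \<subseteq> J x\<close>
  is literally a subset of the direct sum of \<open>J\<close> over \<open>U\<close>.\<close>

definition ideal_dsum :: "('a, 'b) ring_scheme \<Rightarrow> 'x set \<Rightarrow> ('x \<Rightarrow> 'a set) \<Rightarrow> ('a, 'x \<Rightarrow> 'a) module"
  where "ideal_dsum R U J =
    \<lparr>carrier = {f. (\<forall>x\<in>U. f x \<in> J x) \<and> (\<forall>x. x \<notin> U \<longrightarrow> f x = \<zero>\<^bsub>R\<^esub>) \<and> finite {x. f x \<noteq> \<zero>\<^bsub>R\<^esub>}},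
     monoid.mult = (\<lambda>f g x. f x \<otimes>\<^bsub>R\<^esub> g x),
     one = (\<lambda>x. if x \<in> U then \<one>\<^bsub>R\<^esub> else \<zero>\<^bsub>R\<^esub>),
     zero = (\<lambda>x. \<zero>\<^bsub>R\<^esub>),
     add = (\<lambda>f g x. f x \<oplus>\<^bsub>R\<^esub> g x),
     smult = (\<lambda>r f x. r \<otimes>\<^bsub>R\<^esub> f x)\<rparr>"

abbreviation free_module :: "('a, 'b) ring_scheme \<Rightarrow> 'x set \<Rightarrow> ('a, 'x \<Rightarrow> 'a) module"
  where "free_module R U \<equiv> ideal_dsum R U (\<lambda>_. carrier R)"

text \<open>A module is projective if it is isomorphic to a direct summand of a free module. It is no
  restriction to take the basis \<open>U\<close> in the element type of \<open>P\<close>: every module \<open>P\<close> is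
  a quotient of the free module on its own carrier.\<close>

definition projective_module :: "('a, 'b) ring_scheme \<Rightarrow> ('a, 'p, 'c) module_scheme \<Rightarrow> bool"
  where "projective_module R P \<longleftrightarrow> module R P \<and>
    (\<exists>(U :: 'p set) A B.
       submodule A R (free_module R U) \<and> submodule B R (free_module R U) \<and>
       A \<inter> B = {\<zero>\<^bsub>free_module R U\<^esub>} \<and> A <+>\<^bsub>free_module R U\<^esub> B = carrier (free_module R U) \<and>
       module_iso R P (free_module R U\<lparr>carrier := A\<rparr>) \<noteq> {})"

definition finite_free_module :: "('a, 'b) ring_scheme \<Rightarrow> ('a, 'm, 'c) module_scheme \<Rightarrow> bool"
  where "finite_free_module R F \<longleftrightarrow> module R F \<and>
    (\<exists>n::nat. module_iso R (free_module R {..<n}) F \<noteq> {})"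

definition fg_submodule ::
    "('a, 'b) ring_scheme \<Rightarrow> ('a, 'm, 'c) module_scheme \<Rightarrow> 'm set \<Rightarrow> bool"
  where "fg_submodule R M N \<longleftrightarrow>
    (\<exists>B. finite B \<and> B \<subseteq> carrier M \<and> N = \<Inter>{K. submodule K R M \<and> B \<subseteq> K})"

definition finitely_presented :: "('a, 'b) ring_scheme \<Rightarrow> ('a, 'm, 'c) module_scheme \<Rightarrow> bool"
  where "finitely_presented R M \<longleftrightarrow> module R M \<and>
    (\<exists>(n::nat) p. p \<in> module_hom R (free_module R {..<n}) M \<and>
       p ` carrier (free_module R {..<n}) = carrier M \<and>
       fg_submodule R (free_module R {..<n}) (a_kernel (free_module R {..<n}) M p))"


section \<open>Classes of rings\<close>

definition semihereditary :: "('a, 'b) ring_scheme \<Rightarrow> bool"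
  where "semihereditary R \<longleftrightarrow> (\<forall>I. fg_ideal R I \<longrightarrow> projective_module R (ideal_module R I))"

definition indexed_peval :: "('a, 'b) ring_scheme \<Rightarrow> ('c multiset \<Rightarrow> 'a) \<Rightarrow> ('c \<Rightarrow> 'a) \<Rightarrow> 'a"
  where "indexed_peval R f x =
    (\<Oplus>\<^bsub>R\<^esub>m\<in>{m. f m \<noteq> \<zero>\<^bsub>R\<^esub>}. f m \<otimes>\<^bsub>R\<^esub> (\<Otimes>\<^bsub>R\<^esub>i\<in>set_mset m. x i [^]\<^bsub>R\<^esub> count m i))"

definition admits_unit_values :: "('a, 'b) ring_scheme \<Rightarrow> nat \<Rightarrow> (nat multiset \<Rightarrow> 'a) \<Rightarrow> bool"
  where "admits_unit_values R n f \<longleftrightarrow>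
    (\<exists>x \<in> {..<n} \<rightarrow> carrier R. indexed_peval R f x \<in> Units R)"

definition local_global :: "('a, 'b) ring_scheme \<Rightarrow> bool"
  where "local_global R \<longleftrightarrow>
    (\<forall>n. \<forall>f \<in> ring.indexed_pset R {..<n} (carrier R).
       (\<forall>P. maximalideal P R \<longrightarrow>
          admits_unit_values (localization R (carrier R - P)) n
            (\<lambda>m. localize R (carrier R - P) (f m))) \<longrightarrow>
       admits_unit_values R n f)"

definition almost_local_global :: "('a, 'b) ring_scheme \<Rightarrow> bool"
  where "almost_local_global R \<longleftrightarrow>
    (\<forall>I. principalideal I R \<and> faithful_ideal R I \<longrightarrow> local_global (R Quot I))"

text \<open>The type arguments are the element types of \<open>F\<close> and \<open>M\<close>; a definition cannot quantify
  over types, so both types have to be left arbitrary to cover all modules.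
  With indices starting at 0, \<open>\<phi>\<close> is the isomorphism from \<open>F\<close> to the direct sum of
  the \<open>J i\<close>, and the sum of the \<open>I i J i\<close> over \<open>i < m\<close> is a subset of that direct
  sum.\<close>

definition stacked_bases_property ::
    "'f itself \<Rightarrow> 'm itself \<Rightarrow> ('a, 'b) ring_scheme \<Rightarrow> bool"
  where "stacked_bases_property _ _ R \<longleftrightarrow>
    (\<forall>(F :: ('a, 'f) module) (M :: ('a, 'm) module) H p.
       finitely_presented R M \<and> finite_free_module R F \<and> submodule H R F \<and>
       p \<in> module_hom R F M \<and> p ` carrier F = carrier M \<and> a_kernel F M p = H \<longrightarrow>
       (\<exists>(n::nat) (m::nat) J I \<phi>. m \<le> n \<and>
          (\<forall>i<n. fg_ideal R (J i)) \<and>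
          (\<forall>i<m. invertible_ideal R (I i)) \<and>
          (\<forall>i j. i \<le> j \<and> j < m \<longrightarrow> I j \<subseteq> I i) \<and>
          \<phi> \<in> module_iso R F (ideal_dsum R {..<n} J) \<and>
          \<phi> ` H = carrier (ideal_dsum R {..<m} (\<lambda>i. I i \<cdot>\<^bsub>R\<^esub> J i))))"

end

theory Submission
  imports Defs
begin

text \<open>Rank-one summands are split off from \<open>F = R\<^sup>N\<close> one after the other. Finitely generated ideals have a dual
  basis; in particular their annihilators are generated by idempotents, so that arguments for
  Pruefer domains carry over, with a support idempotent in place of the alternative zero or nonzero.
  Elimination yields one regular \<open>d\<close> with \<open>d x \<in> H\<close> whenever some regular multiple of \<open>x\<close> is in \<open>H\<close>.
  Let \<open>c\<close> be the content of \<open>H\<close>. Since \<open>R/dR\<close> is local-global, the bilinear polynomial that pairs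
  linear forms with elements of \<open>c\<^sup>-\<^sup>1H\<close> takes a unit value there: some \<open>h \<in> c\<^sup>-\<^sup>1H\<close> is unimodular modulo \<open>d\<close>.
  Let \<open>L\<close> be the purification of \<open>Rh\<close>, a rank-one summand of \<open>F\<close>. If \<open>v\<gamma>(h) + dt = 1\<close>, then every
  \<open>y \<in> L\<close> equals \<open>v\<gamma>(y)h + t(dy) \<in> c\<^sup>-\<^sup>1H\<close>, so \<open>L \<subseteq> c\<^sup>-\<^sup>1H\<close> and \<open>H\<close> is the direct sum of \<open>cL\<close> and its
  intersection with a complement of \<open>L\<close>, whose content is contained in \<open>c\<close>. The process stops after
  \<open>N + 1\<close> steps because \<open>N + 1\<close> vectors in \<open>R\<^sup>N\<close> satisfy a nontrivial relation over \<open>\<epsilon>R\<close> for every idempotent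
  \<open>\<epsilon> \<noteq> 0\<close>. Applied to \<open>F\<close> in place of \<open>H\<close>, the same process splits the remaining complement into ideals.\<close>

section \<open>Linear maps, submodules and vectors\<close>

text \<open>Only the quotients of \<open>R\<close> by regular elements are assumed to be
  local-global, not \<open>R\<close> itself, so a unit value can be achieved only modulo
  \<open>d\<close>. The error \<open>d t\<close> is harmless because \<open>d\<close> carries
  everything proportional to the chosen vector into \<open>H\<close>. This is why a single
  \<open>d\<close> has to serve for the whole torsion of \<open>F/H\<close>, and why it is fixed
  before any splitting.

  The second obstacle is that a content \<open>c\<close> need not be invertible; it may vanish on a
  direct factor of the ring. Division by \<open>c\<close> is therefore done with the homomorphisms
  \<open>f\<close> from \<open>c\<close> to \<open>R\<close>, which act like multiplication by
  elements of an inverse. A dual basis puts the support idempotent into the ideal generated by the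
  values \<open>f a\<close>, which replaces the equation that \<open>c\<close> times its inverse is
  \<open>R\<close>. For the same reason the invertible ideals of the theorem are not the contents:
  on the complementary idempotent \<open>c\<close> is completed by the preceding ideal of the chain.
  The result is faithful, still contained in the preceding ideal, and has the same product with the
  new summand.

  Summands are given by idempotent endomorphisms, so that complements are given by formulas.\<close>

lemma module_homI:
  assumes "\<And>x. x \<in> carrier M \<Longrightarrow> f x \<in> carrier N"
    and "\<And>x y. x \<in> carrier M \<Longrightarrow> y \<in> carrier M \<Longrightarrow> f (x \<oplus>\<^bsub>M\<^esub> y) = f x \<oplus>\<^bsub>N\<^esub> f y"
    and "\<And>r x. r \<in> carrier R \<Longrightarrow> x \<in> carrier M \<Longrightarrow> f (r \<odot>\<^bsub>M\<^esub> x) = r \<odot>\<^bsub>N\<^esub> f x"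
  shows "f \<in> module_hom R M N"
  using assms unfolding module_hom_def by auto

lemma module_hom_closed: "f \<in> module_hom R M N \<Longrightarrow> x \<in> carrier M \<Longrightarrow> f x \<in> carrier N"
  and module_hom_add: "f \<in> module_hom R M N \<Longrightarrow> x \<in> carrier M \<Longrightarrow> y \<in> carrier M \<Longrightarrow> f (x \<oplus>\<^bsub>M\<^esub> y) = f x \<oplus>\<^bsub>N\<^esub> f y"
  and module_hom_smult: "f \<in> module_hom R M N \<Longrightarrow> r \<in> carrier R \<Longrightarrow> x \<in> carrier M \<Longrightarrow> f (r \<odot>\<^bsub>M\<^esub> x) = r \<odot>\<^bsub>N\<^esub> f x"
  unfolding module_hom_def by auto

lemma module_hom_zero:
  assumes "module R M" "module R N" "f \<in> module_hom R M N"
  shows "f \<zero>\<^bsub>M\<^esub> = \<zero>\<^bsub>N\<^esub>"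
proof -
  interpret M: module R M by fact
  interpret N: module R N by fact
  show ?thesis
    using module_hom_smult[OF assms(3), of "\<zero>\<^bsub>R\<^esub>" "\<zero>\<^bsub>M\<^esub>"] module_hom_closed[OF assms(3), of "\<zero>\<^bsub>M\<^esub>"] by simp
qed

lemma module_hom_comp:
  "f \<in> module_hom R L M \<Longrightarrow> g \<in> module_hom R M N \<Longrightarrow> (\<lambda>x. g (f x)) \<in> module_hom R L N"
  unfolding module_hom_def by (auto simp: Pi_iff)

lemma ideal_module_simps [simp]:
  "carrier (ideal_module R I) = I" "add (ideal_module R I) = add R"
  "zero (ideal_module R I) = zero R" "smult (ideal_module R I) = monoid.mult R"
  unfolding ideal_module_def by simp_all

lemma ideal_dsum_simps [simp]:
  "add (ideal_dsum R U J) f g = (\<lambda>x. f x \<oplus>\<^bsub>R\<^esub> g x)"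
  "zero (ideal_dsum R U J) = (\<lambda>x. \<zero>\<^bsub>R\<^esub>)"
  "smult (ideal_dsum R U J) r f = (\<lambda>x. r \<otimes>\<^bsub>R\<^esub> f x)"
  unfolding ideal_dsum_def by simp_all

lemma ideal_dsum_carrier:
  "carrier (ideal_dsum R U J) = {f. (\<forall>x\<in>U. f x \<in> J x) \<and> (\<forall>x. x \<notin> U \<longrightarrow> f x = \<zero>\<^bsub>R\<^esub>) \<and> finite {x. f x \<noteq> \<zero>\<^bsub>R\<^esub>}}"
  unfolding ideal_dsum_def by simp

lemma finite_ideal_dsum_carrier:
  assumes "finite U"
  shows "carrier (ideal_dsum R U J) = {f. (\<forall>x\<in>U. f x \<in> J x) \<and> (\<forall>x. x \<notin> U \<longrightarrow> f x = \<zero>\<^bsub>R\<^esub>)}"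
proof -
  have "finite {x. f x \<noteq> \<zero>\<^bsub>R\<^esub>}" if "\<forall>x. x \<notin> U \<longrightarrow> f x = \<zero>\<^bsub>R\<^esub>" for f :: "'a \<Rightarrow> 'b"
    using assms by (rule rev_finite_subset) (use that in auto)
  then show ?thesis unfolding ideal_dsum_carrier by blast
qed

text \<open>The same intersection as in \<open>fg_submodule\<close>, so that finitely generated
  submodules become spans of finite sets by unfolding. Minimality is immediate in this form, and no
  linear combinations have to be written down.\<close>

definition module_span :: "('a, 'b) ring_scheme \<Rightarrow> ('a, 'm, 'c) module_scheme \<Rightarrow> 'm set \<Rightarrow> 'm set"
  where "module_span R M B = \<Inter>{K. submodule K R M \<and> B \<subseteq> K}"

lemma module_hom_cong:
  assumes "f \<in> module_hom R M N" "\<And>x. x \<in> carrier M \<Longrightarrow> f x = g x"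
    "\<And>x y. x \<in> carrier M \<Longrightarrow> y \<in> carrier M \<Longrightarrow> x \<oplus>\<^bsub>M\<^esub> y \<in> carrier M"
    "\<And>r x. r \<in> carrier R \<Longrightarrow> x \<in> carrier M \<Longrightarrow> r \<odot>\<^bsub>M\<^esub> x \<in> carrier M"
  shows "g \<in> module_hom R M N"
  using assms unfolding module_hom_def by (auto simp: Pi_iff)

context cring
begin

text \<open>Tailored to commutative rings: negatives arise as multiples by
  \<open>\<ominus> \<one>\<close>, and absorption on one side gives the other.\<close>

lemma idealI':
  assumes "I \<subseteq> carrier R" "\<zero> \<in> I" "\<And>a b. a \<in> I \<Longrightarrow> b \<in> I \<Longrightarrow> a \<oplus> b \<in> I"
    "\<And>a r. a \<in> I \<Longrightarrow> r \<in> carrier R \<Longrightarrow> r \<otimes> a \<in> I"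
  shows "ideal I R"
proof (rule idealI)
  show "ring R" by (rule ring_axioms)
  show "subgroup I (add_monoid R)"
  proof (rule add.subgroupI)
    fix a assume a: "a \<in> I"
    then have "\<ominus> a = (\<ominus> \<one>) \<otimes> a" using assms(1) by (simp add: l_minus subset_iff)
    then show "\<ominus> a \<in> I" using assms(4)[OF a, of "\<ominus> \<one>"] by simp
  qed (use assms in auto)
  fix a x assume "a \<in> I" "x \<in> carrier R"
  then show "x \<otimes> a \<in> I" "a \<otimes> x \<in> I" using assms(1) assms(4)[of a x] by (auto simp: m_comm subset_iff)
qed

lemma Idl_subsetI:
  assumes "ideal I R" "S \<subseteq> I"
  shows "Idl S \<subseteq> I"
  by (rule genideal_minimal) fact+

lemma ideal_closed:
  assumes "ideal I R"
  shows "\<zero> \<in> I" "a \<in> I \<Longrightarrow> b \<in> I \<Longrightarrow> a \<oplus> b \<in> I" "a \<in> I \<Longrightarrow> r \<in> carrier R \<Longrightarrow> r \<otimes> a \<in> I"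
    "a \<in> I \<Longrightarrow> r \<in> carrier R \<Longrightarrow> a \<otimes> r \<in> I" "a \<in> I \<Longrightarrow> a \<in> carrier R"
  using assms ideal.I_l_closed ideal.I_r_closed ideal.Icarr
  by (auto simp: additive_subgroup.zero_closed ideal.axioms(1) additive_subgroup.a_closed)

lemma module_ideal_dsum:
  assumes "\<And>x. x \<in> U \<Longrightarrow> ideal (J x) R"
  shows "module R (ideal_dsum R U J)"
proof (rule moduleI)
  let ?M = "ideal_dsum R U J"
  have c: "f x \<in> carrier R" if "f \<in> carrier ?M" for f x
    using that assms ideal_closed(5) by (cases "x \<in> U") (auto simp: ideal_dsum_carrier)
  have add: "(\<lambda>x. f x \<oplus> g x) \<in> carrier ?M" if "f \<in> carrier ?M" "g \<in> carrier ?M" for f g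
  proof -
    have "{x. f x \<oplus> g x \<noteq> \<zero>} \<subseteq> {x. f x \<noteq> \<zero>} \<union> {x. g x \<noteq> \<zero>}" by auto
    then have "finite {x. f x \<oplus> g x \<noteq> \<zero>}"
      using that by (auto simp: ideal_dsum_carrier intro: finite_subset)
    then show ?thesis using that assms by (auto simp: ideal_dsum_carrier ideal_closed)
  qed
  have smult: "(\<lambda>x. r \<otimes> f x) \<in> carrier ?M" if "f \<in> carrier ?M" "r \<in> carrier R" for f r
  proof -
    have "{x. r \<otimes> f x \<noteq> \<zero>} \<subseteq> {x. f x \<noteq> \<zero>}" using that by auto
    then have "finite {x. r \<otimes> f x \<noteq> \<zero>}"
      using that by (auto simp: ideal_dsum_carrier intro: finite_subset)
    then show ?thesis using that assms by (auto simp: ideal_dsum_carrier ideal_closed)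
  qed
  show "cring R" by (rule is_cring)
  show "abelian_group ?M"
  proof (rule abelian_groupI)
    show "\<zero>\<^bsub>?M\<^esub> \<in> carrier ?M" using assms by (auto simp: ideal_dsum_carrier ideal_closed)
    fix f assume f: "f \<in> carrier ?M"
    show "\<exists>y\<in>carrier ?M. y \<oplus>\<^bsub>?M\<^esub> f = \<zero>\<^bsub>?M\<^esub>"
    proof (rule bexI)
      show "(\<lambda>x. (\<ominus> \<one>) \<otimes> f x) \<in> carrier ?M" using f by (rule smult) simp
      show "(\<lambda>x. (\<ominus> \<one>) \<otimes> f x) \<oplus>\<^bsub>?M\<^esub> f = \<zero>\<^bsub>?M\<^esub>" using c[OF f] by (simp add: l_minus l_neg)
    qed
  qed (use c in \<open>auto simp: add a_assoc intro!: ext a_comm\<close>)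
  show "r \<odot>\<^bsub>?M\<^esub> f \<in> carrier ?M" if "r \<in> carrier R" "f \<in> carrier ?M" for r f
    using smult[OF that(2,1)] by simp
  show "\<one> \<odot>\<^bsub>?M\<^esub> f = f" if "f \<in> carrier ?M" for f using c[OF that] by simp
  show "(a \<oplus> b) \<odot>\<^bsub>?M\<^esub> f = a \<odot>\<^bsub>?M\<^esub> f \<oplus>\<^bsub>?M\<^esub> b \<odot>\<^bsub>?M\<^esub> f"
    if "a \<in> carrier R" "b \<in> carrier R" "f \<in> carrier ?M" for a b f
    using that c[OF that(3)] by (simp add: l_distr)
  show "a \<odot>\<^bsub>?M\<^esub> (f \<oplus>\<^bsub>?M\<^esub> g) = a \<odot>\<^bsub>?M\<^esub> f \<oplus>\<^bsub>?M\<^esub> a \<odot>\<^bsub>?M\<^esub> g"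
    if "a \<in> carrier R" "f \<in> carrier ?M" "g \<in> carrier ?M" for a f g
    using that c[OF that(2)] c[OF that(3)] by (simp add: r_distr)
  show "(a \<otimes> b) \<odot>\<^bsub>?M\<^esub> f = a \<odot>\<^bsub>?M\<^esub> (b \<odot>\<^bsub>?M\<^esub> f)"
    if "a \<in> carrier R" "b \<in> carrier R" "f \<in> carrier ?M" for a b f
    using that c[OF that(3)] by (simp add: m_assoc)
qed

lemma module_free: "module R (free_module R U)"
  by (rule module_ideal_dsum) (rule oneideal)

lemma module_ideal:
  assumes "ideal I R"
  shows "module R (ideal_module R I)"
proof (rule moduleI)
  show "abelian_group (ideal_module R I)"
  proof (rule abelian_groupI)
    fix x assume "x \<in> carrier (ideal_module R I)"
    then have "x \<in> I" by simp
    then have "\<ominus> x \<in> I" "\<ominus> x \<oplus> x = \<zero>"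
      using ideal_closed(3)[OF assms, of x "\<ominus> \<one>"] ideal_closed(5)[OF assms, of x] by (auto simp: l_minus l_neg)
    then show "\<exists>y\<in>carrier (ideal_module R I). y \<oplus>\<^bsub>ideal_module R I\<^esub> x = \<zero>\<^bsub>ideal_module R I\<^esub>" by auto
  qed (use ideal_closed[OF assms] in \<open>auto simp: a_ac\<close>)
qed (use ideal_closed[OF assms] in \<open>auto simp: is_cring l_distr r_distr m_assoc\<close>)

section \<open>Vectors, linear forms and linear maps of free modules\<close>

abbreviation "vec U \<equiv> carrier (free_module R U)"
abbreviation "End U \<equiv> module_hom R (free_module R U) (free_module R U)"
abbreviation "scalars \<equiv> ideal_module R (carrier R)"
abbreviation "dual U \<equiv> module_hom R (free_module R U) scalars"

lemma module_scalars: "module R scalars"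
  by (rule module_ideal) (rule oneideal)

lemma vecD:
  assumes "x \<in> vec U"
  shows "x i \<in> carrier R" "i \<notin> U \<Longrightarrow> x i = \<zero>"
proof -
  show "x i \<in> carrier R" using assms by (cases "i \<in> U") (auto simp: ideal_dsum_carrier)
  show "i \<notin> U \<Longrightarrow> x i = \<zero>" using assms by (auto simp: ideal_dsum_carrier)
qed

lemma vec_iff: "finite U \<Longrightarrow> x \<in> vec U \<longleftrightarrow> (\<forall>i. x i \<in> carrier R) \<and> (\<forall>i. i \<notin> U \<longrightarrow> x i = \<zero>)"
  by (auto simp: finite_ideal_dsum_carrier vecD)

lemma vec_closed:
  shows "(\<lambda>_. \<zero>) \<in> vec U"
    and "x \<in> vec U \<Longrightarrow> y \<in> vec U \<Longrightarrow> (\<lambda>i. x i \<oplus> y i) \<in> vec U"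
    and "x \<in> vec U \<Longrightarrow> r \<in> carrier R \<Longrightarrow> (\<lambda>i. r \<otimes> x i) \<in> vec U"
    and "x \<in> vec U \<Longrightarrow> y \<in> vec U \<Longrightarrow> (\<lambda>i. x i \<ominus> y i) \<in> vec U"
proof -
  interpret module R "free_module R U" by (rule module_free)
  show z: "(\<lambda>_. \<zero>) \<in> vec U" using M.zero_closed by simp
  show a: "(\<lambda>i. x i \<oplus> y i) \<in> vec U" if "x \<in> vec U" "y \<in> vec U" for x y
    using M.add.m_closed[OF that] by simp
  show s: "(\<lambda>i. r \<otimes> x i) \<in> vec U" if "x \<in> vec U" "r \<in> carrier R" for x r
    using smult_closed[OF that(2,1)] by simp
  show "(\<lambda>i. x i \<ominus> y i) \<in> vec U" if "x \<in> vec U" "y \<in> vec U"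
  proof -
    have "(\<lambda>i. x i \<oplus> (\<ominus> \<one>) \<otimes> y i) \<in> vec U" using that by (intro a s) auto
    then show ?thesis using vecD[OF that(2)] by (simp add: l_minus a_minus_def)
  qed
qed

lemma unit_vec_closed: "u \<in> U \<Longrightarrow> a \<in> carrier R \<Longrightarrow> (\<lambda>v. if v = u then a else \<zero>) \<in> vec U"
  by (auto simp: ideal_dsum_carrier)

lemma submodule_vecI:
  assumes "H \<subseteq> vec U" "(\<lambda>_. \<zero>) \<in> H" "\<And>x y. x \<in> H \<Longrightarrow> y \<in> H \<Longrightarrow> (\<lambda>i. x i \<oplus> y i) \<in> H"
    "\<And>x r. x \<in> H \<Longrightarrow> r \<in> carrier R \<Longrightarrow> (\<lambda>i. r \<otimes> x i) \<in> H"
  shows "submodule H R (free_module R U)"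
proof -
  interpret module R "free_module R U" by (rule module_free)
  show ?thesis
  proof (rule submoduleI)
    fix a assume a: "a \<in> H"
    then have "\<ominus>\<^bsub>free_module R U\<^esub> a = (\<ominus> \<one>) \<odot>\<^bsub>free_module R U\<^esub> a"
      using assms(1) smult_l_minus[of \<one> a] smult_one[of a] by (auto simp del: ideal_dsum_simps)
    then show "\<ominus>\<^bsub>free_module R U\<^esub> a \<in> H" using assms(4)[OF a, of "\<ominus> \<one>"] by simp
  qed (use assms in auto)
qed

lemma submodule_vecD:
  assumes "submodule H R (free_module R U)"
  shows "x \<in> H \<Longrightarrow> x \<in> vec U" "(\<lambda>_. \<zero>) \<in> H" "x \<in> H \<Longrightarrow> y \<in> H \<Longrightarrow> (\<lambda>i. x i \<oplus> y i) \<in> H"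
    "x \<in> H \<Longrightarrow> r \<in> carrier R \<Longrightarrow> (\<lambda>i. r \<otimes> x i) \<in> H" "x \<in> H \<Longrightarrow> y \<in> H \<Longrightarrow> (\<lambda>i. x i \<ominus> y i) \<in> H"
proof -
  interpret module R "free_module R U" by (rule module_free)
  note E = submoduleE[OF assms]
  show s: "x \<in> H \<Longrightarrow> x \<in> vec U" for x using E(1) by auto
  show m: "(\<lambda>i. r \<otimes> x i) \<in> H" if "x \<in> H" "r \<in> carrier R" for x r using E(4)[OF that(2,1)] by simp
  show a: "(\<lambda>i. x i \<oplus> y i) \<in> H" if "x \<in> H" "y \<in> H" for x y using E(5)[OF that] by simp
  obtain z where z: "z \<in> H" using E(2) by auto
  have "(\<lambda>i. \<zero> \<otimes> z i) \<in> H" by (rule m[OF z]) simp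
  then show "(\<lambda>_. \<zero>) \<in> H" using vecD(1)[OF s[OF z]] by simp
  show "(\<lambda>i. x i \<ominus> y i) \<in> H" if "x \<in> H" "y \<in> H"
  proof -
    have "(\<lambda>i. x i \<oplus> (\<ominus> \<one>) \<otimes> y i) \<in> H" using that by (intro a m) auto
    then show ?thesis using vecD[OF s[OF that(2)]] by (simp add: l_minus a_minus_def)
  qed
qed

lemma submodule_vec: "submodule (vec U) R (free_module R U)"
  by (rule submodule_vecI) (auto simp: vec_closed)

lemma module_span_vec:
  assumes "B \<subseteq> vec U"
  shows "submodule (module_span R (free_module R U) B) R (free_module R U)"
    "B \<subseteq> module_span R (free_module R U) B"
proof -
  have "module_span R (free_module R U) B \<subseteq> vec U"
    unfolding module_span_def using assms submodule_vec[of U] by blast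
  then show "submodule (module_span R (free_module R U) B) R (free_module R U)"
    by (rule submodule_vecI) (auto simp: module_span_def submodule_vecD)
  show "B \<subseteq> module_span R (free_module R U) B" unfolding module_span_def by auto
qed

lemma module_span_minimal:
  "submodule K R M \<Longrightarrow> B \<subseteq> K \<Longrightarrow> module_span R M B \<subseteq> K"
  unfolding module_span_def by auto

text \<open>The last premise concerns the coordinate parts of the given \<open>x\<close> alone. In
  \<open>dual_mem_ideal\<close> and \<open>dual_ideal_dual\<close> the set \<open>K\<close> contains
  multiples of unit vectors by elements of an ideal, but not necessarily the unit vectors
  themselves.\<close>

lemma vec_induct_coordinates:
  assumes "finite U" "x \<in> vec U" "(\<lambda>_. \<zero>) \<in> K" "\<And>x y. x \<in> K \<Longrightarrow> y \<in> K \<Longrightarrow> (\<lambda>i. x i \<oplus> y i) \<in> K"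
    "\<And>u. u \<in> U \<Longrightarrow> (\<lambda>v. if v = u then x u else \<zero>) \<in> K"
  shows "x \<in> K"
proof -
  have "(\<lambda>v. if v \<in> S then x v else \<zero>) \<in> K" if "finite S" "S \<subseteq> U" for S
    using that
  proof (induction S rule: finite_induct)
    case empty then show ?case using assms(3) by simp
  next
    case (insert u S)
    have "(\<lambda>i. (\<lambda>v. if v = u then x u else \<zero>) i \<oplus> (\<lambda>v. if v \<in> S then x v else \<zero>) i) \<in> K"
      using insert assms(5)[of u] by (intro assms(4)) auto
    moreover have "(\<lambda>i. (\<lambda>v. if v = u then x u else \<zero>) i \<oplus> (\<lambda>v. if v \<in> S then x v else \<zero>) i)
        = (\<lambda>v. if v \<in> insert u S then x v else \<zero>)"
      using insert vecD(1)[OF assms(2)] by auto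
    ultimately show ?case by simp
  qed
  from this[OF assms(1)] have "(\<lambda>v. if v \<in> U then x v else \<zero>) \<in> K" by simp
  moreover have "(\<lambda>v. if v \<in> U then x v else \<zero>) = x" using vecD(2)[OF assms(2)] by auto
  ultimately show ?thesis by simp
qed

lemma dualD:
  assumes "g \<in> dual U"
  shows "x \<in> vec U \<Longrightarrow> g x \<in> carrier R"
    "x \<in> vec U \<Longrightarrow> y \<in> vec U \<Longrightarrow> g (\<lambda>i. x i \<oplus> y i) = g x \<oplus> g y"
    "x \<in> vec U \<Longrightarrow> r \<in> carrier R \<Longrightarrow> g (\<lambda>i. r \<otimes> x i) = r \<otimes> g x"
    "g (\<lambda>_. \<zero>) = \<zero>"
    "x \<in> vec U \<Longrightarrow> y \<in> vec U \<Longrightarrow> g (\<lambda>i. x i \<ominus> y i) = g x \<ominus> g y"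
proof -
  show c: "x \<in> vec U \<Longrightarrow> g x \<in> carrier R" for x using module_hom_closed[OF assms] by simp
  show a: "x \<in> vec U \<Longrightarrow> y \<in> vec U \<Longrightarrow> g (\<lambda>i. x i \<oplus> y i) = g x \<oplus> g y" for x y
    using module_hom_add[OF assms, of x y] by simp
  show s: "x \<in> vec U \<Longrightarrow> r \<in> carrier R \<Longrightarrow> g (\<lambda>i. r \<otimes> x i) = r \<otimes> g x" for x r
    using module_hom_smult[OF assms, of r x] by simp
  show "g (\<lambda>_. \<zero>) = \<zero>" using module_hom_zero[OF module_free module_scalars assms] by simp
  show "g (\<lambda>i. x i \<ominus> y i) = g x \<ominus> g y" if "x \<in> vec U" "y \<in> vec U"
  proof -
    have "g (\<lambda>i. x i \<oplus> (\<ominus> \<one>) \<otimes> y i) = g x \<oplus> (\<ominus> \<one>) \<otimes> g y"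
      using that by (subst a) (auto simp: s vec_closed)
    then show ?thesis using that vecD[OF that(2)] by (simp add: l_minus a_minus_def c)
  qed
qed

lemma dualI:
  assumes "\<And>x. x \<in> vec U \<Longrightarrow> g x \<in> carrier R"
    "\<And>x y. x \<in> vec U \<Longrightarrow> y \<in> vec U \<Longrightarrow> g (\<lambda>i. x i \<oplus> y i) = g x \<oplus> g y"
    "\<And>x r. x \<in> vec U \<Longrightarrow> r \<in> carrier R \<Longrightarrow> g (\<lambda>i. r \<otimes> x i) = r \<otimes> g x"
  shows "g \<in> dual U"
  using assms by (intro module_homI) auto

lemma vec_homD:
  assumes "T \<in> module_hom R (free_module R U) (free_module R U')"
  shows "x \<in> vec U \<Longrightarrow> T x \<in> vec U'"
    "x \<in> vec U \<Longrightarrow> y \<in> vec U \<Longrightarrow> T (\<lambda>i. x i \<oplus> y i) = (\<lambda>i. T x i \<oplus> T y i)"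
    "x \<in> vec U \<Longrightarrow> r \<in> carrier R \<Longrightarrow> T (\<lambda>i. r \<otimes> x i) = (\<lambda>i. r \<otimes> T x i)"
    "T (\<lambda>_. \<zero>) = (\<lambda>_. \<zero>)"
    "x \<in> vec U \<Longrightarrow> y \<in> vec U \<Longrightarrow> T (\<lambda>i. x i \<ominus> y i) = (\<lambda>i. T x i \<ominus> T y i)"
proof -
  show c: "x \<in> vec U \<Longrightarrow> T x \<in> vec U'" for x using module_hom_closed[OF assms] by simp
  show a: "x \<in> vec U \<Longrightarrow> y \<in> vec U \<Longrightarrow> T (\<lambda>i. x i \<oplus> y i) = (\<lambda>i. T x i \<oplus> T y i)" for x y
    using module_hom_add[OF assms, of x y] by simp
  show s: "x \<in> vec U \<Longrightarrow> r \<in> carrier R \<Longrightarrow> T (\<lambda>i. r \<otimes> x i) = (\<lambda>i. r \<otimes> T x i)" for x r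
    using module_hom_smult[OF assms, of r x] by simp
  show "T (\<lambda>_. \<zero>) = (\<lambda>_. \<zero>)" using module_hom_zero[OF module_free module_free assms] by simp
  show "T (\<lambda>i. x i \<ominus> y i) = (\<lambda>i. T x i \<ominus> T y i)" if "x \<in> vec U" "y \<in> vec U"
  proof -
    have "T (\<lambda>i. x i \<oplus> (\<ominus> \<one>) \<otimes> y i) = (\<lambda>i. T x i \<oplus> (\<ominus> \<one>) \<otimes> T y i)"
      using that by (subst a) (auto simp: s vec_closed)
    then show ?thesis using that vecD[OF that(2)] vecD[OF c[OF that(2)]] by (simp add: l_minus a_minus_def c)
  qed
qed

lemma vec_homI:
  assumes "\<And>x. x \<in> vec U \<Longrightarrow> T x \<in> vec U'"
    "\<And>x y. x \<in> vec U \<Longrightarrow> y \<in> vec U \<Longrightarrow> T (\<lambda>i. x i \<oplus> y i) = (\<lambda>i. T x i \<oplus> T y i)"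
    "\<And>x r. x \<in> vec U \<Longrightarrow> r \<in> carrier R \<Longrightarrow> T (\<lambda>i. r \<otimes> x i) = (\<lambda>i. r \<otimes> T x i)"
  shows "T \<in> module_hom R (free_module R U) (free_module R U')"
  using assms by (intro module_homI) auto

lemma vec_hom_sum:
  assumes "T \<in> module_hom R (free_module R U) (free_module R U')" "S \<in> module_hom R (free_module R U) (free_module R U')"
  shows "(\<lambda>x i. T x i \<oplus> S x i) \<in> module_hom R (free_module R U) (free_module R U')"
proof (rule vec_homI)
  note T = vec_homD[OF assms(1)] and S = vec_homD[OF assms(2)]
  have c: "T x i \<in> carrier R" "S x i \<in> carrier R" if "x \<in> vec U" for x i
    using vecD(1)[OF T(1)[OF that]] vecD(1)[OF S(1)[OF that]] by auto
  show "(\<lambda>i. T x i \<oplus> S x i) \<in> vec U'" if "x \<in> vec U" for x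
    using T(1)[OF that] S(1)[OF that] by (rule vec_closed(2))
  show "(\<lambda>i. T (\<lambda>i. x i \<oplus> y i) i \<oplus> S (\<lambda>i. x i \<oplus> y i) i) = (\<lambda>i. (T x i \<oplus> S x i) \<oplus> (T y i \<oplus> S y i))"
    if "x \<in> vec U" "y \<in> vec U" for x y
    unfolding T(2)[OF that] S(2)[OF that] using c[OF that(1)] c[OF that(2)] by (simp add: a_ac)
  show "(\<lambda>i. T (\<lambda>i. r \<otimes> x i) i \<oplus> S (\<lambda>i. r \<otimes> x i) i) = (\<lambda>i. r \<otimes> (T x i \<oplus> S x i))"
    if "x \<in> vec U" "r \<in> carrier R" for x r
    unfolding T(3)[OF that] S(3)[OF that] using c[OF that(1)] that(2) by (simp add: r_distr)
qed

lemma smult_hom: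
  assumes "r \<in> carrier R"
  shows "(\<lambda>x i. r \<otimes> x i) \<in> End U"
  by (rule vec_homI) (use assms vecD(1)[of _ U] in \<open>auto simp: vec_closed r_distr m_lcomm\<close>)

lemma vec_hom_diff:
  assumes "T \<in> module_hom R (free_module R U) (free_module R U')" "S \<in> module_hom R (free_module R U) (free_module R U')"
  shows "(\<lambda>x i. T x i \<ominus> S x i) \<in> module_hom R (free_module R U) (free_module R U')"
proof -
  have c: "S x i \<in> carrier R" if "x \<in> vec U" for x i using vecD(1)[OF vec_homD(1)[OF assms(2) that]] .
  have "(\<lambda>x i. T x i \<oplus> (\<ominus> \<one>) \<otimes> S x i) \<in> module_hom R (free_module R U) (free_module R U')"
    by (rule vec_hom_sum[OF assms(1) module_hom_comp[OF assms(2) smult_hom]]) simp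
  then show ?thesis
    by (rule module_hom_cong) (simp add: c l_minus a_minus_def vec_closed)+
qed

lemma dual_times_vec_hom:
  assumes "g \<in> dual U" "v \<in> vec U'"
  shows "(\<lambda>x i. g x \<otimes> v i) \<in> module_hom R (free_module R U) (free_module R U')"
  by (rule vec_homI) (use dualD[OF assms(1)] assms(2) vecD(1)[OF assms(2)] in \<open>auto simp: vec_closed l_distr m_assoc\<close>)

text \<open>Serves two purposes: solution sets of linear equations are submodules, and two
  homomorphisms agree once they agree at the unit vectors.\<close>

lemma submodule_equalizer:
  assumes "module R M" "f \<in> module_hom R (free_module R U) M" "g \<in> module_hom R (free_module R U) M"
  shows "submodule {x \<in> vec U. f x = g x} R (free_module R U)"
proof (rule submodule_vecI)
  let ?E = "{x \<in> vec U. f x = g x}"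
  show "(\<lambda>_. \<zero>) \<in> ?E"
    using module_hom_zero[OF module_free assms(1,2)] module_hom_zero[OF module_free assms(1,3)] by (simp add: vec_closed)
  show "(\<lambda>i. x i \<oplus> y i) \<in> ?E" if "x \<in> ?E" "y \<in> ?E" for x y
    using module_hom_add[OF assms(2), of x y] module_hom_add[OF assms(3), of x y] that by (simp add: vec_closed)
  show "(\<lambda>i. r \<otimes> x i) \<in> ?E" if "x \<in> ?E" "r \<in> carrier R" for x r
    using module_hom_smult[OF assms(2), of r x] module_hom_smult[OF assms(3), of r x] that by (simp add: vec_closed)
qed auto

text \<open>Appends a column \<open>v\<close> to a map. The input is truncated because a vector of
  length \<open>Suc n\<close> with nonzero last entry is outside the carrier of the free module of
  rank \<open>n\<close>. Both the universal property of free modules and the rank argument, where a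
  vector joins a family, rest on this.\<close>

lemma free_hom_extend:
  fixes n :: nat
  assumes "module R M" "T \<in> module_hom R (free_module R {..<n}) M" "v \<in> carrier M"
  shows "(\<lambda>x. T (\<lambda>i. if i < n then x i else \<zero>) \<oplus>\<^bsub>M\<^esub> x n \<odot>\<^bsub>M\<^esub> v) \<in> module_hom R (free_module R {..<Suc n}) M"
proof -
  interpret M: module R M by fact
  define \<tau> where "\<tau> c i = (if i < n then c i else \<zero>)" for c :: "nat \<Rightarrow> 'a" and i
  have \<tau>v: "\<tau> c \<in> vec {..<n}" if "c \<in> vec {..<Suc n}" for c
    unfolding \<tau>_def vec_iff[OF finite_lessThan] using vecD(1)[OF that] by auto
  note Tc = module_hom_closed[OF assms(2)]
  have "(\<lambda>x. T (\<tau> x) \<oplus>\<^bsub>M\<^esub> x n \<odot>\<^bsub>M\<^esub> v) \<in> module_hom R (free_module R {..<Suc n}) M" (is "?S \<in> _")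
  proof (rule module_homI)
    show "?S x \<in> carrier M" if "x \<in> vec {..<Suc n}" for x
      using Tc[OF \<tau>v[OF that]] vecD(1)[OF that] assms(3) by simp
    show "?S (x \<oplus>\<^bsub>free_module R {..<Suc n}\<^esub> y) = ?S x \<oplus>\<^bsub>M\<^esub> ?S y" if xy: "x \<in> vec {..<Suc n}" "y \<in> vec {..<Suc n}" for x y
    proof -
      have "\<tau> (\<lambda>i. x i \<oplus> y i) = (\<lambda>i. \<tau> x i \<oplus> \<tau> y i)" unfolding \<tau>_def by auto
      then have "T (\<tau> (\<lambda>i. x i \<oplus> y i)) = T (\<tau> x) \<oplus>\<^bsub>M\<^esub> T (\<tau> y)"
        using module_hom_add[OF assms(2) \<tau>v[OF xy(1)] \<tau>v[OF xy(2)]] by simp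
      then show ?thesis
        using Tc[OF \<tau>v[OF xy(1)]] Tc[OF \<tau>v[OF xy(2)]] vecD(1)[OF xy(1)] vecD(1)[OF xy(2)] assms(3)
        by (simp add: M.smult_l_distr M.M.a_ac)
    qed
    show "?S (r \<odot>\<^bsub>free_module R {..<Suc n}\<^esub> x) = r \<odot>\<^bsub>M\<^esub> ?S x" if r: "r \<in> carrier R" and x: "x \<in> vec {..<Suc n}" for r x
    proof -
      have "\<tau> (\<lambda>i. r \<otimes> x i) = (\<lambda>i. r \<otimes> \<tau> x i)" unfolding \<tau>_def using r by auto
      then have "T (\<tau> (\<lambda>i. r \<otimes> x i)) = r \<odot>\<^bsub>M\<^esub> T (\<tau> x)"
        using module_hom_smult[OF assms(2) r \<tau>v[OF x]] by simp
      then show ?thesis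
        using Tc[OF \<tau>v[OF x]] vecD(1)[OF x] assms(3) r by (simp add: M.smult_r_distr M.smult_assoc1)
    qed
  qed
  then show ?thesis unfolding \<tau>_def .
qed

lemma coordinate_dual: "(\<lambda>x. x i) \<in> dual U"
  by (rule dualI) (auto simp: vecD)

lemma submodule_vimage:
  assumes "T \<in> module_hom R (free_module R U) (free_module R U')" "submodule K R (free_module R U')"
  shows "submodule {x \<in> vec U. T x \<in> K} R (free_module R U)"
  by (rule submodule_vecI)
    (auto simp: vec_closed vec_homD[OF assms(1)] submodule_vecD[OF assms(2)])

text \<open>The value is a combination of the coordinates of \<open>x\<close>, with the values of
  \<open>g\<close> at the unit vectors as coefficients.\<close>

lemma dual_mem_ideal:
  assumes "finite U" "ideal I R" "g \<in> dual U" "x \<in> vec U" "\<And>i. i \<in> U \<Longrightarrow> x i \<in> I"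
  shows "g x \<in> I"
proof -
  have "x \<in> {y \<in> vec U. g y \<in> I}"
  proof (rule vec_induct_coordinates[OF assms(1,4)])
    fix u assume u: "u \<in> U"
    have "g (\<lambda>v. x u \<otimes> (if v = u then \<one> else \<zero>)) = x u \<otimes> g (\<lambda>v. if v = u then \<one> else \<zero>)"
      using u by (intro dualD(3)[OF assms(3)]) (auto simp: unit_vec_closed vecD[OF assms(4)])
    moreover have "(\<lambda>v. x u \<otimes> (if v = u then \<one> else \<zero>)) = (\<lambda>v. if v = u then x u else \<zero>)"
      using vecD[OF assms(4)] by auto
    ultimately show "(\<lambda>v. if v = u then x u else \<zero>) \<in> {y \<in> vec U. g y \<in> I}"
      using u assms(5)[OF u] ideal_closed[OF assms(2)]
      by (auto simp: unit_vec_closed vecD[OF assms(4)] dualD(1)[OF assms(3)])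
  qed (use assms(2) in \<open>auto simp: dualD[OF assms(3)] vec_closed ideal_closed\<close>)
  then show ?thesis by simp
qed

lemma vec_spanned_by_unit_vecs:
  assumes "finite U" "submodule K R (free_module R U)"
    "\<And>u. u \<in> U \<Longrightarrow> (\<lambda>v. if v = u then \<one> else \<zero>) \<in> K" "x \<in> vec U"
  shows "x \<in> K"
proof (rule vec_induct_coordinates[OF assms(1,4)])
  fix u assume u: "u \<in> U"
  have "(\<lambda>v. x u \<otimes> (if v = u then \<one> else \<zero>)) = (\<lambda>v. if v = u then x u else \<zero>)"
    using vecD[OF assms(4)] by auto
  then show "(\<lambda>v. if v = u then x u else \<zero>) \<in> K"
    using submodule_vecD(4)[OF assms(2) assms(3)[OF u] vecD(1)[OF assms(4)], of u] by simp
qed (use submodule_vecD[OF assms(2)] in auto)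

end

section \<open>Supports in semihereditary rings\<close>

context cring
begin

section \<open>Homomorphisms from an ideal to the ring, and dual bases\<close>

abbreviation "ideal_dual I \<equiv> module_hom R (ideal_module R I) scalars"

lemma ideal_dualD:
  assumes "f \<in> ideal_dual I"
  shows "a \<in> I \<Longrightarrow> f a \<in> carrier R"
    "a \<in> I \<Longrightarrow> b \<in> I \<Longrightarrow> f (a \<oplus> b) = f a \<oplus> f b"
    "a \<in> I \<Longrightarrow> r \<in> carrier R \<Longrightarrow> f (r \<otimes> a) = r \<otimes> f a"
    "ideal I R \<Longrightarrow> f \<zero> = \<zero>"
  using module_hom_closed[OF assms, of a] module_hom_add[OF assms, of a b]
    module_hom_smult[OF assms, of r a] module_hom_zero[OF _ module_scalars assms]
  by (auto simp: module_ideal)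

lemma finsum_mem_ideal:
  assumes "ideal I R" "finite S" "\<And>s. s \<in> S \<Longrightarrow> f s \<in> I"
  shows "(\<Oplus>s\<in>S. f s) \<in> I"
  using assms(2,3)
proof (induction S rule: finite_induct)
  case empty then show ?case using ideal_closed(1)[OF assms(1)] by simp
next
  case (insert s S)
  then have "(\<Oplus>s\<in>insert s S. f s) = f s \<oplus> (\<Oplus>s\<in>S. f s)"
    using ideal_closed(5)[OF assms(1)] by (intro finsum_insert) auto
  then show ?case using insert ideal_closed[OF assms(1)] by auto
qed

text \<open>The element \<open>u\<close> is the sum of the \<open>f\<^sub>v (a\<^sub>v)\<close> over a dual basis of the ideal. The dual basis is later
  only used in the following way: an ideal containing every \<open>f a\<close> contains \<open>u\<close>.\<close>

lemma projective_ideal_trace: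
  assumes proj: "projective_module R (ideal_module R (Idl B))" and B: "finite B" "B \<subseteq> carrier R"
  obtains u where "u \<in> Idl {f a | f a. f \<in> ideal_dual (Idl B) \<and> a \<in> Idl B}"
    "\<And>x. x \<in> Idl B \<Longrightarrow> u \<otimes> x = x"
proof -
  define I where "I = Idl B"
  have I: "ideal I R" unfolding I_def by (rule genideal_ideal) fact
  note Ic = ideal_closed[OF I]
  obtain U :: "'a set" and A C \<theta> where A: "submodule A R (free_module R U)"
    and C: "submodule C R (free_module R U)" and AC: "A \<inter> C = {\<lambda>_. \<zero>}"
    and sum: "A <+>\<^bsub>free_module R U\<^esub> C = vec U"
    and iso: "\<theta> \<in> module_iso R (ideal_module R I) (free_module R U\<lparr>carrier := A\<rparr>)"
    using proj unfolding projective_module_def I_def[symmetric] by auto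
  note Am = submodule_vecD[OF A] and Cm = submodule_vecD[OF C]
  have hom: "\<theta> \<in> module_hom R (ideal_module R I) (free_module R U\<lparr>carrier := A\<rparr>)"
    and bij: "bij_betw \<theta> I A"
    using iso unfolding module_iso_def by auto
  have \<theta>A: "\<theta> x \<in> A" if "x \<in> I" for x using bij that by (auto dest: bij_betwE)
  have \<theta>add: "\<theta> (x \<oplus> y) = (\<lambda>v. \<theta> x v \<oplus> \<theta> y v)" if "x \<in> I" "y \<in> I" for x y
    using module_hom_add[OF hom, of x y] that by simp
  have \<theta>smult: "\<theta> (r \<otimes> x) = (\<lambda>v. r \<otimes> \<theta> x v)" if "x \<in> I" "r \<in> carrier R" for x r
    using module_hom_smult[OF hom, of r x] that by simp
  note \<theta>c = vecD[OF Am(1)[OF \<theta>A]]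
  \<comment> \<open>The retraction of the free module onto the ideal: it inverts
    \<open>\<theta>\<close> on \<open>A\<close> and kills \<open>C\<close>.\<close>
  define \<sigma> where "\<sigma> w = (THE x. x \<in> I \<and> (\<exists>c\<in>C. w = (\<lambda>v. \<theta> x v \<oplus> c v)))" for w
  have uniq: "x = y" if "x \<in> I" "y \<in> I" "c \<in> C" "d \<in> C" "(\<lambda>v. \<theta> x v \<oplus> c v) = (\<lambda>v. \<theta> y v \<oplus> d v)" for x y c d
  proof -
    have "\<theta> x v \<ominus> \<theta> y v = d v \<ominus> c v" for v
    proof -
      have m: "\<theta> x v \<in> carrier R" "\<theta> y v \<in> carrier R" "c v \<in> carrier R" "d v \<in> carrier R"
        using \<theta>c that vecD[OF Cm(1)] by auto
      have "\<theta> x v \<oplus> c v = \<theta> y v \<oplus> d v" using that(5) by (rule fun_cong)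
      moreover have "\<theta> x v \<ominus> \<theta> y v = (\<theta> x v \<oplus> c v) \<ominus> (\<theta> y v \<oplus> c v)" using m by algebra
      moreover have "(\<theta> y v \<oplus> d v) \<ominus> (\<theta> y v \<oplus> c v) = d v \<ominus> c v" using m by algebra
      ultimately show ?thesis by simp
    qed
    then have "(\<lambda>v. \<theta> x v \<ominus> \<theta> y v) = (\<lambda>v. d v \<ominus> c v)" by (rule ext)
    moreover have "(\<lambda>v. \<theta> x v \<ominus> \<theta> y v) \<in> A" using that \<theta>A by (intro Am(5)) auto
    moreover have "(\<lambda>v. d v \<ominus> c v) \<in> C" using that by (intro Cm(5)) auto
    ultimately have "(\<lambda>v. \<theta> x v \<ominus> \<theta> y v) = (\<lambda>_. \<zero>)" using AC by auto
    then have "\<theta> x v \<ominus> \<theta> y v = \<zero>" for v by (rule fun_cong)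
    then have "\<theta> x v = \<theta> y v" for v using \<theta>c(1)[OF that(1)] \<theta>c(1)[OF that(2)] by simp
    then have "\<theta> x = \<theta> y" by (rule ext)
    then show "x = y" using bij that by (auto simp: bij_betw_def inj_on_def)
  qed
  have \<sigma>I: "\<sigma> (\<lambda>v. \<theta> x v \<oplus> c v) = x" if "x \<in> I" "c \<in> C" for x c
    unfolding \<sigma>_def
  proof (rule the_equality)
    fix y assume "y \<in> I \<and> (\<exists>ca\<in>C. (\<lambda>v. \<theta> x v \<oplus> c v) = (\<lambda>v. \<theta> y v \<oplus> ca v))"
    then show "y = x" using uniq[of y x _ c] that by metis
  qed (use that in blast)
  have split: "\<exists>x c. x \<in> I \<and> c \<in> C \<and> w = (\<lambda>v. \<theta> x v \<oplus> c v)" if "w \<in> vec U" for w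
  proof -
    have "w \<in> A <+>\<^bsub>free_module R U\<^esub> C" using that sum by simp
    then obtain a c where ac: "a \<in> A" "c \<in> C" "w = (\<lambda>v. a v \<oplus> c v)"
      unfolding set_add_def set_mult_def by auto
    then obtain x where "x \<in> I" "a = \<theta> x" using bij by (auto simp: bij_betw_def)
    then show ?thesis using ac by auto
  qed
  have \<sigma>add: "\<sigma> (\<lambda>v. w v \<oplus> z v) = \<sigma> w \<oplus> \<sigma> z" if w: "w \<in> vec U" "z \<in> vec U" for w z
  proof -
    obtain x c y d where *: "x \<in> I" "c \<in> C" "w = (\<lambda>v. \<theta> x v \<oplus> c v)" "y \<in> I" "d \<in> C" "z = (\<lambda>v. \<theta> y v \<oplus> d v)"
      using split[OF w(1)] split[OF w(2)] by auto
    have "w v \<oplus> z v = \<theta> (x \<oplus> y) v \<oplus> (c v \<oplus> d v)" for v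
    proof -
      have m: "\<theta> x v \<in> carrier R" "\<theta> y v \<in> carrier R" "c v \<in> carrier R" "d v \<in> carrier R"
        using \<theta>c * vecD[OF Cm(1)] by auto
      then show ?thesis unfolding *(3,6) \<theta>add[OF *(1,4)] by algebra
    qed
    then have "\<sigma> (\<lambda>v. w v \<oplus> z v) = x \<oplus> y"
      using \<sigma>I[of "x \<oplus> y" "\<lambda>v. c v \<oplus> d v"] * Ic Cm by simp
    then show ?thesis using * \<sigma>I by simp
  qed
  have \<sigma>smult: "\<sigma> (\<lambda>v. r \<otimes> w v) = r \<otimes> \<sigma> w" if w: "w \<in> vec U" and r: "r \<in> carrier R" for w r
  proof -
    obtain x c where *: "x \<in> I" "c \<in> C" "w = (\<lambda>v. \<theta> x v \<oplus> c v)"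
      using split[OF w(1)] by auto
    have "r \<otimes> w v = \<theta> (r \<otimes> x) v \<oplus> (r \<otimes> c v)" for v
      unfolding *(3) \<theta>smult[OF *(1) r] using \<theta>c * vecD[OF Cm(1)] r by (simp add: r_distr)
    then have "\<sigma> (\<lambda>v. r \<otimes> w v) = r \<otimes> x"
      using \<sigma>I[of "r \<otimes> x" "\<lambda>v. r \<otimes> c v"] * Ic Cm r by simp
    then show ?thesis using * \<sigma>I by simp
  qed
  have \<sigma>c: "\<sigma> w \<in> I" if "w \<in> vec U" for w using split[OF that] \<sigma>I by auto
  have \<sigma>\<theta>: "\<sigma> (\<theta> x) = x" if "x \<in> I" for x
    using \<sigma>I[OF that Cm(2)] \<theta>c[OF that] by simp
  define \<delta> where "\<delta> v = (\<lambda>w. if w = v then \<one> else \<zero>)" for v :: 'a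
  have \<delta>: "\<delta> v \<in> vec U" if "v \<in> U" for v unfolding \<delta>_def by (rule unit_vec_closed[OF that]) simp
  \<comment> \<open>The forms sending \<open>x\<close> to \<open>\<theta> x v\<close>, together with
    the elements \<open>\<sigma> (\<delta> v)\<close>, are the dual basis. The expansion is over
    finite sets because \<open>U\<close> may be infinite.\<close>
  have expand: "\<sigma> (\<lambda>v. if v \<in> S then w v else \<zero>) = (\<Oplus>v\<in>S. w v \<otimes> \<sigma> (\<delta> v))" if "finite S" "S \<subseteq> U" "w \<in> vec U" for S w
    using that
  proof (induction S rule: finite_induct)
    case empty
    have "\<sigma> (\<lambda>v. \<zero>) = \<sigma> (\<lambda>v. \<zero> \<otimes> \<zero>)" by simp
    also have "\<dots> = \<zero> \<otimes> \<sigma> (\<lambda>v. \<zero>)" by (rule \<sigma>smult) (auto simp: vec_closed)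
    also have "\<dots> = \<zero>" using \<sigma>c[of "\<lambda>v. \<zero>"] Ic by (auto simp: vec_closed)
    finally show ?case by simp
  next
    case (insert s S)
    have wc: "w v \<in> carrier R" for v using vecD insert by auto
    have eq: "(\<lambda>v. if v \<in> insert s S then w v else \<zero>) = (\<lambda>v. (w s \<otimes> \<delta> s v) \<oplus> (if v \<in> S then w v else \<zero>))"
      using insert wc by (auto simp: \<delta>_def)
    have "\<sigma> (\<lambda>v. if v \<in> insert s S then w v else \<zero>) = \<sigma> (\<lambda>v. w s \<otimes> \<delta> s v) \<oplus> \<sigma> (\<lambda>v. if v \<in> S then w v else \<zero>)"
      unfolding eq
    proof (rule \<sigma>add)
      show "(\<lambda>v. w s \<otimes> \<delta> s v) \<in> vec U" using insert wc by (intro vec_closed \<delta>) auto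
      show "(\<lambda>v. if v \<in> S then w v else \<zero>) \<in> vec U" using insert wc by (auto simp: ideal_dsum_carrier)
    qed
    also have "\<sigma> (\<lambda>v. w s \<otimes> \<delta> s v) = w s \<otimes> \<sigma> (\<delta> s)" using insert wc by (intro \<sigma>smult \<delta>) auto
    also have "\<sigma> (\<lambda>v. if v \<in> S then w v else \<zero>) = (\<Oplus>v\<in>S. w v \<otimes> \<sigma> (\<delta> v))" using insert by auto
    also have "w s \<otimes> \<sigma> (\<delta> s) \<oplus> (\<Oplus>v\<in>S. w v \<otimes> \<sigma> (\<delta> v)) = (\<Oplus>v\<in>insert s S. w v \<otimes> \<sigma> (\<delta> v))"
      using insert wc \<sigma>c[OF \<delta>] Ic(5) by (intro finsum_insert[symmetric]) (auto simp: subset_iff)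
    finally show ?case .
  qed
  \<comment> \<open>Finitely many coordinates suffice on all of \<open>I\<close>: a coordinate that
    vanishes at the generators \<open>B\<close> vanishes on the ideal that they generate.\<close>
  define V where "V = (\<Union>b\<in>B. {v. \<theta> b v \<noteq> \<zero>})"
  have BI: "B \<subseteq> I" unfolding I_def by (rule genideal_self) fact
  have finV: "finite V" unfolding V_def
    using B(1) Am(1)[OF \<theta>A] BI by (auto simp: ideal_dsum_carrier)
  have VU: "V \<subseteq> U" unfolding V_def using \<theta>c BI by blast
  have V: "\<theta> x v = \<zero>" if "x \<in> I" "v \<notin> V" for x v
  proof -
    have "ideal {x \<in> I. \<forall>v. v \<notin> V \<longrightarrow> \<theta> x v = \<zero>} R"
    proof (rule idealI')
      have "\<theta> (\<zero> \<otimes> \<zero>) = (\<lambda>v. \<zero> \<otimes> \<theta> \<zero> v)" by (rule \<theta>smult) (auto simp: Ic)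
      then show "\<zero> \<in> {x \<in> I. \<forall>v. v \<notin> V \<longrightarrow> \<theta> x v = \<zero>}" using Ic(1) \<theta>c by simp
    qed (use Ic \<theta>add \<theta>smult in auto)
    moreover have "B \<subseteq> {x \<in> I. \<forall>v. v \<notin> V \<longrightarrow> \<theta> x v = \<zero>}" using BI unfolding V_def by auto
    ultimately have "I \<subseteq> {x \<in> I. \<forall>v. v \<notin> V \<longrightarrow> \<theta> x v = \<zero>}" unfolding I_def by (rule Idl_subsetI)
    then show ?thesis using that by auto
  qed
  define u where "u = (\<Oplus>v\<in>V. \<theta> (\<sigma> (\<delta> v)) v)"
  have \<sigma>\<delta>: "\<sigma> (\<delta> v) \<in> I" if "v \<in> V" for v using \<sigma>c \<delta> VU that by auto
  let ?T = "{f a | f a. f \<in> ideal_dual I \<and> a \<in> I}"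
  have T: "?T \<subseteq> carrier R" using ideal_dualD(1) by auto
  have "(\<lambda>x. \<theta> x v) \<in> ideal_dual I" for v
    by (rule module_homI) (use \<theta>c \<theta>add \<theta>smult in auto)
  then have "u \<in> Idl ?T" unfolding u_def using finV \<sigma>\<delta>
    by (intro finsum_mem_ideal genideal_ideal T) (use genideal_self[OF T] in blast)+
  moreover have "u \<otimes> x = x" if x: "x \<in> I" for x
  proof -
    have xc: "x \<in> carrier R" using Ic x by auto
    have "u \<otimes> x = (\<Oplus>v\<in>V. \<theta> (\<sigma> (\<delta> v)) v \<otimes> x)"
      unfolding u_def using finV xc \<theta>c[OF \<sigma>\<delta>] by (intro finsum_ldistr) auto
    \<comment> \<open>Both factors \<open>x\<close> and \<open>\<sigma> (\<delta> v)\<close> lie in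
      \<open>I\<close>, so either can be pulled out of \<open>\<theta>\<close> applied to their
      product. This exchange turns the trace \<open>u\<close> times \<open>x\<close> into the dual
      basis expansion of \<open>x\<close>.\<close>
    also have "\<dots> = (\<Oplus>v\<in>V. \<theta> x v \<otimes> \<sigma> (\<delta> v))"
    proof (rule finsum_cong')
      fix v assume v: "v \<in> V"
      have a: "\<sigma> (\<delta> v) \<in> carrier R" using Ic \<sigma>\<delta>[OF v] by auto
      have "\<theta> (\<sigma> (\<delta> v) \<otimes> x) v = \<sigma> (\<delta> v) \<otimes> \<theta> x v" using \<theta>smult[OF x a] by simp
      moreover have "\<theta> (x \<otimes> \<sigma> (\<delta> v)) v = x \<otimes> \<theta> (\<sigma> (\<delta> v)) v" using \<theta>smult[OF \<sigma>\<delta>[OF v] xc] by simp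
      ultimately show "\<theta> (\<sigma> (\<delta> v)) v \<otimes> x = \<theta> x v \<otimes> \<sigma> (\<delta> v)"
        using m_comm[OF xc a] m_comm[OF xc \<theta>c(1)[OF \<sigma>\<delta>[OF v]]] m_comm[OF a \<theta>c(1)[OF x]] by simp
    qed (use \<theta>c[OF x] Ic(5)[OF \<sigma>\<delta>] in auto)
    also have "\<dots> = \<sigma> (\<lambda>v. if v \<in> V then \<theta> x v else \<zero>)"
      using expand[OF finV VU Am(1)[OF \<theta>A[OF x]]] by simp
    also have "(\<lambda>v. if v \<in> V then \<theta> x v else \<zero>) = \<theta> x" using V[OF x] by auto
    finally show ?thesis using \<sigma>\<theta>[OF x] by simp
  qed
  ultimately show ?thesis using that unfolding I_def by blast
qed

text \<open>The idempotent \<open>u\<close> generates the annihilator of the annihilator of \<open>A\<close>.\<close>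

definition support :: "'a \<Rightarrow> 'a set \<Rightarrow> bool"
  where "support u A \<longleftrightarrow> u \<in> carrier R \<and> (\<forall>x\<in>A. u \<otimes> x = x) \<and>
    (\<forall>r\<in>carrier R. (\<forall>x\<in>A. r \<otimes> x = \<zero>) \<longrightarrow> r \<otimes> u = \<zero>)"

lemma supportD:
  assumes "support u A"
  shows "u \<in> carrier R" "x \<in> A \<Longrightarrow> u \<otimes> x = x"
    "r \<in> carrier R \<Longrightarrow> (\<And>x. x \<in> A \<Longrightarrow> r \<otimes> x = \<zero>) \<Longrightarrow> r \<otimes> u = \<zero>"
  using assms unfolding support_def by auto

lemma supportI:
  assumes "u \<in> carrier R" "\<And>x. x \<in> A \<Longrightarrow> u \<otimes> x = x"
    "\<And>r. r \<in> carrier R \<Longrightarrow> (\<And>x. x \<in> A \<Longrightarrow> r \<otimes> x = \<zero>) \<Longrightarrow> r \<otimes> u = \<zero>"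
  shows "support u A"
  using assms unfolding support_def by auto

text \<open>Since \<open>\<one> \<ominus> u\<close> annihilates \<open>A\<close>, it annihilates
  \<open>u\<close>.\<close>

lemma support_idem:
  assumes "support u A" "A \<subseteq> carrier R"
  shows "u \<otimes> u = u"
proof -
  note s = supportD[OF assms(1)]
  have "(\<one> \<ominus> u) \<otimes> x = \<zero>" if "x \<in> A" for x
  proof -
    have "x \<in> carrier R" using that assms by auto
    then have "(\<one> \<ominus> u) \<otimes> x = x \<ominus> u \<otimes> x" using s(1) by algebra
    then show ?thesis using s(2)[OF that] \<open>x \<in> carrier R\<close> by (simp add: r_right_minus_eq)
  qed
  then have "(\<one> \<ominus> u) \<otimes> u = \<zero>" using s(1) by (intro s(3)) auto
  moreover have "(\<one> \<ominus> u) \<otimes> u = u \<ominus> u \<otimes> u" using s(1) by algebra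
  ultimately show ?thesis using s(1) by (metis m_closed r_right_minus_eq)
qed

lemma support_kills:
  assumes "support u A" "A \<subseteq> carrier R" "r \<in> carrier R" "x \<in> A" "r \<otimes> u = \<zero>"
  shows "r \<otimes> x = \<zero>"
proof -
  have x: "x \<in> carrier R" using assms by auto
  have "r \<otimes> (u \<otimes> x) = (r \<otimes> u) \<otimes> x" using x assms(3) supportD(1)[OF assms(1)] by (simp add: m_assoc)
  then show ?thesis using assms(5) x supportD(2)[OF assms(1,4)] by simp
qed

text \<open>The argument for idempotence, with \<open>w\<close> in place of the first factor:
  \<open>u\<close> is the smallest multiplier that fixes \<open>A\<close>.\<close>

lemma support_mult:
  assumes "support u A" "A \<subseteq> carrier R" "w \<in> carrier R" "\<And>x. x \<in> A \<Longrightarrow> w \<otimes> x = x"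
  shows "w \<otimes> u = u"
proof -
  note s = supportD[OF assms(1)]
  have "(\<one> \<ominus> w) \<otimes> x = \<zero>" if "x \<in> A" for x
  proof -
    have "x \<in> carrier R" using that assms by auto
    then have "(\<one> \<ominus> w) \<otimes> x = x \<ominus> w \<otimes> x" using assms(3) by algebra
    then show ?thesis using assms(4)[OF that] \<open>x \<in> carrier R\<close> by (simp add: r_right_minus_eq)
  qed
  then have "(\<one> \<ominus> w) \<otimes> u = \<zero>" using assms(3) by (intro s(3)) auto
  moreover have "(\<one> \<ominus> w) \<otimes> u = u \<ominus> w \<otimes> u" using s(1) assms(3) by algebra
  ultimately show ?thesis using s(1) assms(3) by (metis m_closed r_right_minus_eq)
qed

text \<open>The elements fixed by a given multiplier form an ideal, and so do the elements killed by
  it. Hence both conditions can be tested on generators.\<close>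

lemma support_Idl:
  assumes "A \<subseteq> carrier R"
  shows "support u (Idl A) \<longleftrightarrow> support u A"
proof
  note g = genideal_ideal[OF assms] and gs = genideal_self[OF assms]
  have k: "r \<otimes> x = \<zero>" if "r \<in> carrier R" "\<And>x. x \<in> A \<Longrightarrow> r \<otimes> x = \<zero>" "x \<in> Idl A" for r x
  proof -
    have "ideal {x \<in> carrier R. r \<otimes> x = \<zero>} R"
      using that(1) by (intro idealI') (auto simp: r_distr m_lcomm)
    then have "Idl A \<subseteq> {x \<in> carrier R. r \<otimes> x = \<zero>}" using that assms by (intro Idl_subsetI) auto
    then show ?thesis using that by auto
  qed
  show "support u A" if "support u (Idl A)"
    using supportD[OF that] k gs by (intro supportI) auto
  show "support u (Idl A)" if "support u A"
  proof (rule supportI)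
    show u: "u \<in> carrier R" using supportD[OF that] by simp
    have "ideal {x \<in> carrier R. u \<otimes> x = x} R"
      using u by (intro idealI') (auto simp: r_distr m_lcomm)
    then have "Idl A \<subseteq> {x \<in> carrier R. u \<otimes> x = x}"
      using supportD[OF that] assms by (intro Idl_subsetI) auto
    then show "u \<otimes> x = x" if "x \<in> Idl A" for x using that by auto
  qed (use supportD[OF that] gs in blast)
qed

lemma support_unique:
  assumes "support u A" "support w A" "A \<subseteq> carrier R"
  shows "u = w"
  using support_mult[OF assms(1,3), of w] support_mult[OF assms(2,3), of u]
    supportD[OF assms(1)] supportD[OF assms(2)] m_comm by metis

text \<open>The ideals generated by finite subsets are directed, so their union is an ideal. This is
  how the content of a module without a given finite generating set yields the finitely many
  coefficients of a polynomial.\<close>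

lemma Idl_finite_subset:
  assumes "A \<subseteq> carrier R" "a \<in> Idl A"
  obtains Y where "finite Y" "Y \<subseteq> A" "a \<in> Idl Y"
proof -
  let ?K = "{a. \<exists>Y. finite Y \<and> Y \<subseteq> A \<and> a \<in> Idl Y}"
  have id: "ideal (Idl Y) R" if "Y \<subseteq> A" for Y using that assms by (intro genideal_ideal) auto
  have "ideal ?K R"
  proof (rule idealI')
    show "?K \<subseteq> carrier R" using id ideal_closed(5) by blast
    show "\<zero> \<in> ?K" using ideal_closed(1)[OF id[of "{}"]] by auto
    fix a b assume "a \<in> ?K" "b \<in> ?K"
    then obtain Y Z where *: "finite Y" "Y \<subseteq> A" "a \<in> Idl Y" "finite Z" "Z \<subseteq> A" "b \<in> Idl Z" by auto
    have YZ: "Y \<union> Z \<subseteq> carrier R" using * assms by auto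
    have "Idl Y \<subseteq> Idl (Y \<union> Z)" by (rule subset_Idl_subset[OF YZ]) simp
    moreover have "Idl Z \<subseteq> Idl (Y \<union> Z)" by (rule subset_Idl_subset[OF YZ]) simp
    moreover have "ideal (Idl (Y \<union> Z)) R" using * by (intro id) auto
    ultimately have "a \<oplus> b \<in> Idl (Y \<union> Z)" using * by (intro ideal_closed(2)) auto
    then show "a \<oplus> b \<in> ?K" using * by (intro CollectI exI[of _ "Y \<union> Z"]) auto
  next
    fix a r assume "a \<in> ?K" "r \<in> carrier R"
    then show "r \<otimes> a \<in> ?K" using id ideal_closed(3) by blast
  qed
  moreover have "A \<subseteq> ?K"
  proof
    fix x assume "x \<in> A"
    then have "x \<in> Idl {x}" using assms by (intro genideal_self') auto
    then show "x \<in> ?K" using \<open>x \<in> A\<close> by (intro CollectI exI[of _ "{x}"]) auto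
  qed
  ultimately have "Idl A \<subseteq> ?K" by (rule Idl_subsetI)
  then show ?thesis using assms(2) that by auto
qed

text \<open>Identifies the content of \<open>h\<close> with its trace. Linear forms can be added and
  scaled, so their values at \<open>h\<close> already form an ideal; every element of the content is
  the value of a single form.\<close>

lemma dual_values_at_vector:
  assumes "finite U" "h \<in> vec U"
  shows "{\<gamma> h | \<gamma>. \<gamma> \<in> dual U} = Idl (range h)"
proof
  have rc: "range h \<subseteq> carrier R" using vecD[OF assms(2)] by auto
  show "{\<gamma> h | \<gamma>. \<gamma> \<in> dual U} \<subseteq> Idl (range h)"
    using dual_mem_ideal[OF assms(1) genideal_ideal[OF rc] _ assms(2)] genideal_self[OF rc] by blast
  show "Idl (range h) \<subseteq> {\<gamma> h | \<gamma>. \<gamma> \<in> dual U}"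
  proof (rule Idl_subsetI[OF idealI'])
    show "{\<gamma> h | \<gamma>. \<gamma> \<in> dual U} \<subseteq> carrier R" using dualD(1)[OF _ assms(2)] by auto
    have "(\<lambda>_. \<zero>) \<in> dual U" by (rule dualI) auto
    then show "\<zero> \<in> {\<gamma> h | \<gamma>. \<gamma> \<in> dual U}" by (intro CollectI exI[of _ "\<lambda>_. \<zero>"]) simp
  next
    fix a b assume "a \<in> {\<gamma> h | \<gamma>. \<gamma> \<in> dual U}" "b \<in> {\<gamma> h | \<gamma>. \<gamma> \<in> dual U}"
    then obtain \<gamma> \<gamma>' where *: "\<gamma> \<in> dual U" "a = \<gamma> h" "\<gamma>' \<in> dual U" "b = \<gamma>' h" by auto
    have "(\<lambda>x. \<gamma> x \<oplus> \<gamma>' x) \<in> dual U"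
      by (rule dualI) (auto simp: dualD[OF *(1)] dualD[OF *(3)] r_distr a_ac)
    then show "a \<oplus> b \<in> {\<gamma> h | \<gamma>. \<gamma> \<in> dual U}" unfolding * by (intro CollectI exI[of _ "\<lambda>x. \<gamma> x \<oplus> \<gamma>' x"]) simp
  next
    fix a r assume r: "a \<in> {\<gamma> h | \<gamma>. \<gamma> \<in> dual U}" "r \<in> carrier R"
    then obtain \<gamma> where *: "\<gamma> \<in> dual U" "a = \<gamma> h" by auto
    have "(\<lambda>x. r \<otimes> \<gamma> x) \<in> dual U"
      by (rule dualI) (auto simp: dualD[OF *(1)] r_distr m_lcomm r)
    then show "r \<otimes> a \<in> {\<gamma> h | \<gamma>. \<gamma> \<in> dual U}" unfolding * by (intro CollectI exI[of _ "\<lambda>x. r \<otimes> \<gamma> x"]) simp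
  next
    show "range h \<subseteq> {\<gamma> h | \<gamma>. \<gamma> \<in> dual U}"
      using coordinate_dual by (auto intro!: exI[of _ "\<lambda>x. x _"])
  qed
qed

lemma finite_range_vec:
  assumes "finite U" "h \<in> vec U"
  shows "finite (range h)"
proof (rule finite_subset)
  show "range h \<subseteq> insert \<zero> (h ` U)"
  proof
    fix x assume "x \<in> range h"
    then obtain i where "x = h i" by auto
    then show "x \<in> insert \<zero> (h ` U)" using vecD(2)[OF assms(2), of i] by (cases "i \<in> U") auto
  qed
qed (use assms(1) in simp)

lemma range_vec: "h \<in> vec U \<Longrightarrow> range h \<subseteq> carrier R"
  by (auto simp: vecD)

end

locale semihereditary_cring = cring +
  assumes semihereditary: "semihereditary R"
begin

text \<open>The trace of a dual basis is the support. It fixes the ideal, and an \<open>r\<close>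
  that annihilates the ideal annihilates every value \<open>f a\<close>, because
  \<open>r f(a) = f(r a) = 0\<close>, hence also the trace.\<close>

lemma support_exists:
  assumes "finite B" "B \<subseteq> carrier R"
  obtains u where "support u B" "u \<in> Idl {f a | f a. f \<in> ideal_dual (Idl B) \<and> a \<in> Idl B}"
proof -
  let ?T = "{f a | f a. f \<in> ideal_dual (Idl B) \<and> a \<in> Idl B}"
  have "projective_module R (ideal_module R (Idl B))"
    using semihereditary assms unfolding semihereditary_def fg_ideal_def by blast
  then obtain u where u: "u \<in> Idl ?T" "\<And>x. x \<in> Idl B \<Longrightarrow> u \<otimes> x = x"
    using projective_ideal_trace assms by blast
  have I: "ideal (Idl B) R" by (rule genideal_ideal) fact
  have T: "?T \<subseteq> carrier R" using ideal_dualD(1) by auto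
  have uc: "u \<in> carrier R" using ideal_closed(5)[OF genideal_ideal[OF T] u(1)] .
  have "support u (Idl B)"
  proof (rule supportI)
    fix r assume r: "r \<in> carrier R" "\<And>x. x \<in> Idl B \<Longrightarrow> r \<otimes> x = \<zero>"
    have id: "ideal {t \<in> carrier R. r \<otimes> t = \<zero>} R"
      using r by (intro idealI') (auto simp: r_distr m_lcomm)
    have "r \<otimes> f a = \<zero>" if "f \<in> ideal_dual (Idl B)" "a \<in> Idl B" for f a
      using ideal_dualD(3,4)[OF that(1)] that r I by metis
    then have "?T \<subseteq> {t \<in> carrier R. r \<otimes> t = \<zero>}" using T by blast
    then have "Idl ?T \<subseteq> {t \<in> carrier R. r \<otimes> t = \<zero>}" by (rule Idl_subsetI[OF id])
    then show "r \<otimes> u = \<zero>" using u by auto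
  qed (use u uc in auto)
  then show ?thesis using that u support_Idl[OF assms(2)] by auto
qed

text \<open>By uniqueness every support of \<open>B\<close> is the trace of the dual basis. For a
  support equal to \<open>\<one>\<close> this is the partition of unity that makes an ideal
  invertible.\<close>

lemma support_mem_trace:
  assumes "finite B" "support u B" "B \<subseteq> carrier R"
  shows "u \<in> Idl {f a | f a. f \<in> ideal_dual (Idl B) \<and> a \<in> Idl B}"
proof -
  obtain w where "support w B" "w \<in> Idl {f a | f a. f \<in> ideal_dual (Idl B) \<and> a \<in> Idl B}"
    using support_exists[OF assms(1,3)] by blast
  then show ?thesis using support_unique[OF assms(2) _ assms(3), of w] by simp
qed

text \<open>Over a domain one would pick a nonzero element of a nonzero ideal. Here a single element
  must be nonzero wherever some generator is, so elements on complementary idempotents are glued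
  together.\<close>

lemma ideal_max_support:
  assumes "finite B" "B \<subseteq> carrier R" "support u B"
  obtains a where "a \<in> Idl B" "support u {a}"
proof -
  have "\<exists>a u. a \<in> Idl B \<and> support u B \<and> support u {a}" using assms(1,2)
  proof (induction B rule: finite_induct)
    case empty
    have "ideal (Idl {}) R" by (rule genideal_ideal) simp
    then show ?case by (intro exI[of _ \<zero>]) (auto simp: support_def ideal_closed)
  next
    case (insert b B)
    then obtain a w where a: "a \<in> Idl B" "support w B" "support w {a}" by auto
    obtain u where u: "support u (insert b B)" using support_exists[of "insert b B"] insert by auto
    have idB: "ideal (Idl B) R" and idb: "ideal (Idl (insert b B)) R" using insert by (auto intro!: genideal_ideal)
    have car: "a \<in> carrier R" "w \<in> carrier R" "b \<in> carrier R" "u \<in> carrier R"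
      using a insert ideal_closed(5)[OF idB] supportD[OF a(2)] supportD[OF u] by auto
    \<comment> \<open>Equal to \<open>a\<close> on the factor \<open>w\<close> and to
      \<open>b\<close> on the complementary factor, so the two contributions cannot cancel:
      multiplication by \<open>w\<close> gives back \<open>a\<close>.\<close>
    define c where "c = a \<oplus> (\<one> \<ominus> w) \<otimes> b"
    have bB: "b \<in> Idl (insert b B)" using genideal_self[of "insert b B"] insert by auto
    have "Idl B \<subseteq> Idl (insert b B)" using insert by (intro subset_Idl_subset) auto
    then have c: "c \<in> Idl (insert b B)" unfolding c_def using a bB car
      by (intro ideal_closed(2)[OF idb] ideal_closed(3)[OF idb]) auto
    have ww: "w \<otimes> w = w" using support_idem[OF a(2)] insert by auto
    have wa: "w \<otimes> a = a" using supportD(2)[OF a(3)] by auto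
    have "support u {c}"
    proof (rule supportI)
      have "support u (Idl (insert b B))" using u insert by (subst support_Idl) auto
      then show "u \<otimes> x = x" if "x \<in> {c}" for x using that c supportD(2) by auto
      fix r assume r: "r \<in> carrier R" "\<And>x. x \<in> {c} \<Longrightarrow> r \<otimes> x = \<zero>"
      have rc: "r \<otimes> c = \<zero>" using r by auto
      have wc: "w \<otimes> c = a"
      proof -
        have "w \<otimes> c = w \<otimes> a \<oplus> (w \<ominus> w \<otimes> w) \<otimes> b" unfolding c_def using car by algebra
        then show ?thesis using car unfolding ww wa by (simp add: a_minus_def r_neg)
      qed
      have "c \<in> carrier R" unfolding c_def using car by simp
      then have "r \<otimes> a = w \<otimes> (r \<otimes> c)" unfolding wc[symmetric] using car r by (intro m_lcomm)
      then have "r \<otimes> a = \<zero>" using rc car by simp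
      then have rw: "r \<otimes> w = \<zero>" using supportD(3)[OF a(3), of r] r by auto
      have "r \<otimes> c = r \<otimes> a \<oplus> (r \<otimes> b \<ominus> (r \<otimes> w) \<otimes> b)" unfolding c_def using car r by algebra
      then have "r \<otimes> b = \<zero>" using rc \<open>r \<otimes> a = \<zero>\<close> rw r car by (simp add: a_minus_def)
      moreover have "r \<otimes> x = \<zero>" if "x \<in> B" for x
        using support_kills[OF a(2) _ r(1) that rw] insert by auto
      ultimately show "r \<otimes> u = \<zero>" using r by (intro supportD(3)[OF u]) auto
    qed (use car in auto)
    then show ?case using c u by auto
  qed
  then obtain a w where a: "a \<in> Idl B" "support w B" "support w {a}" by blast
  have "w = u" by (rule support_unique[OF a(2) assms(3,2)])
  then show ?thesis using that a by simp
qed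

text \<open>The gluing of \<open>ideal_max_support\<close> done for vectors, where the support is
  that of all coordinates together and the result has to stay in \<open>K\<close>.\<close>

lemma vec_max_support:
  assumes "finite U" "finite B" "B \<subseteq> vec U" "support u (\<Union>b\<in>B. range b)"
    "submodule K R (free_module R U)" "B \<subseteq> K"
  obtains h where "h \<in> K" "support u (range h)"
proof -
  have rng: "(\<Union>b\<in>B. range b) \<subseteq> carrier R" if "B \<subseteq> vec U" for B using that range_vec by blast
  have "\<exists>h u. h \<in> K \<and> support u (\<Union>b\<in>B. range b) \<and> support u (range h)" using assms(2,3,6)
  proof (induction B rule: finite_induct)
    case empty
    show ?case using submodule_vecD(2)[OF assms(5)] by (intro exI[of _ "\<lambda>_. \<zero>"] exI[of _ "\<zero>"]) (auto simp: support_def)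
  next
    case (insert b B)
    then obtain a w where a: "a \<in> K" "support w (\<Union>b\<in>B. range b)" "support w (range a)" by auto
    have bv: "b \<in> vec U" using insert by auto
    have "finite (\<Union>b\<in>insert b B. range b)"
      using insert.hyps(1) insert.prems(1) finite_range_vec[OF assms(1)] by blast
    then obtain u where u: "support u (\<Union>b\<in>insert b B. range b)"
      using support_exists[OF _ rng[OF insert.prems(1)]] by blast
    note av = submodule_vecD(1)[OF assms(5) a(1)]
    have car: "a i \<in> carrier R" "w \<in> carrier R" "b i \<in> carrier R" "u \<in> carrier R" for i
      using vecD[OF av] vecD[OF bv] supportD[OF a(2)] supportD[OF u] by auto
    define c where "c = (\<lambda>i. a i \<oplus> (\<one> \<ominus> w) \<otimes> b i)"
    have c: "c \<in> K" unfolding c_def using a insert car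
      by (intro submodule_vecD[OF assms(5)]) auto
    have ww: "w \<otimes> w = w" using support_idem[OF a(2)] rng insert by auto
    have wa: "w \<otimes> a i = a i" for i using supportD(2)[OF a(3)] by auto
    have wu: "w \<otimes> u = w"
    proof -
      have "u \<otimes> w = w" using insert supportD[OF u] by (intro support_mult[OF a(2)] rng) auto
      then show ?thesis using car m_comm by simp
    qed
    have "support u (range c)"
    proof (rule supportI)
      show "u \<otimes> x = x" if x: "x \<in> range c" for x
      proof -
        obtain i where i: "x = c i" using x by auto
        have ub: "u \<otimes> b i = b i" using supportD(2)[OF u] by auto
        have "u \<otimes> c i = u \<otimes> (w \<otimes> a i) \<oplus> (\<one> \<ominus> w) \<otimes> (u \<otimes> b i)" unfolding c_def wa using car(1)[of i] car(3)[of i] car(2,4) by algebra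
        also have "u \<otimes> (w \<otimes> a i) = (w \<otimes> u) \<otimes> a i" using car(1)[of i] car(3)[of i] car(2,4) by algebra
        finally show ?thesis unfolding i wu wa ub c_def .
      qed
      fix r assume r: "r \<in> carrier R" "\<And>x. x \<in> range c \<Longrightarrow> r \<otimes> x = \<zero>"
      have rc: "r \<otimes> c i = \<zero>" for i using r by auto
      have wc: "w \<otimes> c i = a i" for i
      proof -
        have "w \<otimes> c i = w \<otimes> a i \<oplus> (w \<ominus> w \<otimes> w) \<otimes> b i" unfolding c_def using car by algebra
        then show ?thesis using car unfolding ww wa by (simp add: a_minus_def r_neg)
      qed
      have ra: "r \<otimes> a i = \<zero>" for i
      proof -
        have "c i \<in> carrier R" unfolding c_def using car by simp
        then have "r \<otimes> a i = w \<otimes> (r \<otimes> c i)" unfolding wc[symmetric] using car r by (intro m_lcomm)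
        then show "r \<otimes> a i = \<zero>" using rc car by simp
      qed
      then have rw: "r \<otimes> w = \<zero>" using supportD(3)[OF a(3), of r] r by auto
      have rb: "r \<otimes> b i = \<zero>" for i
      proof -
        have "r \<otimes> c i = r \<otimes> a i \<oplus> (r \<otimes> b i \<ominus> (r \<otimes> w) \<otimes> b i)" unfolding c_def using car r by algebra
        then show ?thesis using rc ra rw r car by (simp add: a_minus_def)
      qed
      have "r \<otimes> x = \<zero>" if "x \<in> (\<Union>b\<in>B. range b)" for x
        using support_kills[OF a(2) _ r(1) that rw] insert rng by auto
      then show "r \<otimes> u = \<zero>" using r rb by (intro supportD(3)[OF u]) auto
    qed (use car in auto)
    then show ?case using c u by auto
  qed
  then obtain h w where h: "h \<in> K" "support w (\<Union>b\<in>B. range b)" "support w (range h)" by blast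
  have "w = u" by (rule support_unique[OF h(2) assms(4) rng[OF assms(3)]])
  then show ?thesis using that h by simp
qed

end

section \<open>Saturation, rank-one projections and linear relations\<close>

context cring
begin

abbreviation "lspan U B \<equiv> module_span R (free_module R U) B"

lemma regular_elementsD:
  assumes "s \<in> regular_elements R"
  shows "s \<in> carrier R" "x \<in> carrier R \<Longrightarrow> s \<otimes> x = \<zero> \<Longrightarrow> x = \<zero>"
  using assms unfolding regular_elements_def by auto

lemma regular_elementsI:
  assumes "s \<in> carrier R" "\<And>x. x \<in> carrier R \<Longrightarrow> s \<otimes> x = \<zero> \<Longrightarrow> x = \<zero>"
  shows "s \<in> regular_elements R"
  using assms unfolding regular_elements_def by auto

lemma regular_elements_mult:
  assumes "s \<in> regular_elements R" "t \<in> regular_elements R"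
  shows "s \<otimes> t \<in> regular_elements R"
proof (rule regular_elementsI)
  show "s \<otimes> t \<in> carrier R" using assms regular_elementsD by auto
  fix x assume x: "x \<in> carrier R" "s \<otimes> t \<otimes> x = \<zero>"
  then have "s \<otimes> (t \<otimes> x) = \<zero>" using assms regular_elementsD(1) by (simp add: m_assoc)
  then show "x = \<zero>" using assms x regular_elementsD by (meson m_closed)
qed

lemma one_regular: "\<one> \<in> regular_elements R"
  by (rule regular_elementsI) auto

text \<open>Off its support \<open>a\<close> is replaced by one. Over a domain this is
  \<open>a\<close> for nonzero \<open>a\<close>, and \<open>\<one>\<close> for \<open>a\<close>
  equal to zero.\<close>

lemma support_regular:
  assumes "support u {a}" "a \<in> carrier R"
  shows "a \<oplus> (\<one> \<ominus> u) \<in> regular_elements R"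
proof (rule regular_elementsI)
  note u = supportD(1)[OF assms(1)]
  show "a \<oplus> (\<one> \<ominus> u) \<in> carrier R" using u assms(2) by simp
  fix y assume y: "y \<in> carrier R" "(a \<oplus> (\<one> \<ominus> u)) \<otimes> y = \<zero>"
  have uu: "u \<otimes> u = u" using support_idem[OF assms(1)] assms(2) by simp
  have ua: "u \<otimes> a = a" using supportD(2)[OF assms(1)] by simp
  have "u \<otimes> ((a \<oplus> (\<one> \<ominus> u)) \<otimes> y) = (u \<otimes> a) \<otimes> y \<oplus> (u \<ominus> u \<otimes> u) \<otimes> y" using u y(1) assms(2) by algebra
  also have "\<dots> = a \<otimes> y" unfolding ua uu using u y(1) assms(2) by (simp add: a_minus_def r_neg)
  finally have ay: "a \<otimes> y = \<zero>" unfolding y(2) using u by simp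
  then have "y \<otimes> u = \<zero>" using y(1) assms(2) m_comm[of a y] by (intro supportD(3)[OF assms(1)]) auto
  moreover have "(a \<oplus> (\<one> \<ominus> u)) \<otimes> y = a \<otimes> y \<oplus> (y \<ominus> y \<otimes> u)" using u y(1) assms(2) by algebra
  ultimately show "y = \<zero>" using y ay by (simp add: a_minus_def)
qed

text \<open>One step of fraction-free Gaussian elimination with pivot \<open>h j\<close>: coordinate
  \<open>j\<close> becomes zero, and \<open>h\<close> itself is mapped to zero.\<close>

lemma elimination_hom:
  assumes "h \<in> vec U"
  shows "(\<lambda>x i. h j \<otimes> x i \<ominus> x j \<otimes> h i) \<in> End U"
  by (rule vec_hom_diff[OF smult_hom[OF vecD(1)[OF assms]] dual_times_vec_hom[OF coordinate_dual assms]])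

lemma lspan_subset:
  assumes "B \<subseteq> lspan U C" "C \<subseteq> vec U"
  shows "lspan U B \<subseteq> lspan U C"
  by (rule module_span_minimal[OF module_span_vec(1)[OF assms(2)] assms(1)])

lemma lspan_image:
  assumes "T \<in> module_hom R (free_module R U) (free_module R U')" "B \<subseteq> vec U" "C \<subseteq> vec U'" "T ` B \<subseteq> lspan U' C" "x \<in> lspan U B"
  shows "T x \<in> lspan U' C"
proof -
  have "lspan U B \<subseteq> {x \<in> vec U. T x \<in> lspan U' C}"
    by (rule module_span_minimal[OF submodule_vimage[OF assms(1) module_span_vec(1)[OF assms(3)]]])
      (use assms in auto)
  then show ?thesis using assms(5) by auto
qed

text \<open>Both sides are \<open>f\<close> of the product of \<open>a\<close> and \<open>b\<close>.
  Thus \<open>f\<close> behaves like multiplication by a fraction, and this is how it is used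
  throughout.\<close>

lemma ideal_dual_comm:
  assumes "ideal I R" "f \<in> ideal_dual I" "a \<in> I" "b \<in> I"
  shows "a \<otimes> f b = f a \<otimes> b"
proof -
  note c = ideal_closed(5)[OF assms(1)] and fd = ideal_dualD[OF assms(2)]
  have "a \<otimes> f b = f (a \<otimes> b)" using fd(3)[OF assms(4) c[OF assms(3)]] by simp
  also have "a \<otimes> b = b \<otimes> a" using c[OF assms(3)] c[OF assms(4)] by (rule m_comm)
  also have "f (b \<otimes> a) = b \<otimes> f a" using fd(3)[OF assms(3) c[OF assms(4)]] by simp
  finally show ?thesis using m_comm[OF c[OF assms(4)] fd(1)[OF assms(3)]] by simp
qed

lemma ideal_dual_vec:
  assumes "finite U" "ideal I R" "f \<in> ideal_dual I" "y \<in> vec U" "\<And>i. y i \<in> I"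
  shows "(\<lambda>i. f (y i)) \<in> vec U"
  unfolding vec_iff[OF assms(1)]
  using ideal_dualD(1)[OF assms(3) assms(5)] ideal_dualD(4)[OF assms(3,2)] vecD(2)[OF assms(4)] by auto

text \<open>If \<open>f\<close> is thought of as multiplication by a fraction, this is linearity of
  \<open>g\<close>. The proof goes by coordinates, where it reduces to moving
  \<open>g \<delta>\<close> through \<open>f\<close>.\<close>

lemma dual_ideal_dual:
  assumes U: "finite U" and I: "ideal I R" and f: "f \<in> ideal_dual I" and g: "g \<in> dual U"
    and y: "y \<in> vec U" "\<And>i. y i \<in> I"
  shows "g (\<lambda>i. f (y i)) = f (g y)"
proof -
  note Ic = ideal_closed[OF I] and fd = ideal_dualD[OF f] and gd = dualD[OF g]
  let ?K = "{y \<in> vec U. (\<forall>i. y i \<in> I) \<and> g (\<lambda>i. f (y i)) = f (g y)}"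
  have fv: "(\<lambda>i. f (y i)) \<in> vec U" if "y \<in> vec U" "\<forall>i. y i \<in> I" for y
    by (rule ideal_dual_vec[OF U I f]) (use that in auto)
  have gI: "g y \<in> I" if "y \<in> vec U" "\<forall>i. y i \<in> I" for y
    by (rule dual_mem_ideal[OF U I g]) (use that in auto)
  have "y \<in> ?K"
  proof (rule vec_induct_coordinates[OF U y(1)])
    show "(\<lambda>_. \<zero>) \<in> ?K" using gd(4) fd(4)[OF I] Ic(1) by (simp add: vec_closed)
    show "(\<lambda>i. x i \<oplus> z i) \<in> ?K" if x: "x \<in> ?K" and z: "z \<in> ?K" for x z
    proof -
      have "(\<lambda>i. f (x i \<oplus> z i)) = (\<lambda>i. f (x i) \<oplus> f (z i))" using fd(2) x z by auto
      then have "g (\<lambda>i. f (x i \<oplus> z i)) = f (g x) \<oplus> f (g z)"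
        using gd(2)[OF fv[of x] fv[of z]] x z by auto
      also have "\<dots> = f (g (\<lambda>i. x i \<oplus> z i))" using fd(2)[OF gI[of x] gI[of z]] gd(2)[of x z] x z by auto
      finally show ?thesis using x z Ic(2) by (simp add: vec_closed)
    qed
    fix u assume u: "u \<in> U"
    define \<delta> where "\<delta> = (\<lambda>v. if v = u then \<one> else \<zero>)"
    have \<delta>: "\<delta> \<in> vec U" unfolding \<delta>_def using u by (rule unit_vec_closed) simp
    have c: "y u \<in> carrier R" "f (y u) \<in> carrier R" using Ic(5)[OF y(2)] fd(1)[OF y(2)] by auto
    have 1: "(\<lambda>v. if v = u then y u else \<zero>) = (\<lambda>v. y u \<otimes> \<delta> v)" unfolding \<delta>_def using c by auto
    have 2: "(\<lambda>v. f (if v = u then y u else \<zero>)) = (\<lambda>v. f (y u) \<otimes> \<delta> v)"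
      unfolding \<delta>_def using c fd(4)[OF I] by auto
    have "f (y u) \<otimes> g \<delta> = f (y u \<otimes> g \<delta>)"
      using fd(3)[OF y(2) gd(1)[OF \<delta>]] m_comm[OF c(1) gd(1)[OF \<delta>]] m_comm[OF c(2) gd(1)[OF \<delta>]] by simp
    then have "g (\<lambda>v. f (if v = u then y u else \<zero>)) = f (g (\<lambda>v. if v = u then y u else \<zero>))"
      unfolding 1 2 gd(3)[OF \<delta> c(1)] gd(3)[OF \<delta> c(2)] .
    then show "(\<lambda>v. if v = u then y u else \<zero>) \<in> ?K"
      using y(2) Ic(1) unit_vec_closed[OF u c(1)] by auto
  qed
  then show ?thesis by simp
qed

lemma vanishing_submodule: "submodule {x \<in> vec U. \<forall>i. i \<notin> S \<longrightarrow> x i = \<zero>} R (free_module R U)"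
  by (rule submodule_vecI) (auto simp: vec_closed)

end

context semihereditary_cring
begin

text \<open>A uniform bound for the torsion of \<open>F/H\<close>, by elimination of one coordinate
  \<open>j\<close> at a time. Where the \<open>j\<close>-th coordinates of the generators have
  support, a pivot row removes them; on the complementary idempotent they are zero already. Both
  parts involve only the coordinates in \<open>S\<close>, and their bound is multiplied by the
  pivot, completed to a regular element.\<close>

lemma saturation_bound:
  fixes U :: "'c set"
  assumes "finite S" "finite B" "B \<subseteq> vec U" "\<And>b i. b \<in> B \<Longrightarrow> i \<notin> S \<Longrightarrow> b i = \<zero>"
  shows "\<exists>d\<in>regular_elements R. \<forall>x\<in>vec U. \<forall>s\<in>regular_elements R.
    (\<lambda>i. s \<otimes> x i) \<in> lspan U B \<longrightarrow> (\<lambda>i. d \<otimes> x i) \<in> lspan U B"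
  using assms
proof (induction S arbitrary: B rule: finite_induct)
  case empty
  have "lspan U B \<subseteq> {x \<in> vec U. \<forall>i. i \<notin> {} \<longrightarrow> x i = \<zero>}"
    by (rule module_span_minimal[OF vanishing_submodule]) (use empty in auto)
  then have z: "y i = \<zero>" if "y \<in> lspan U B" for y i using that by auto
  have "(\<lambda>i. \<one> \<otimes> x i) \<in> lspan U B"
    if x: "x \<in> vec U" "s \<in> regular_elements R" "(\<lambda>i. s \<otimes> x i) \<in> lspan U B" for x s
  proof -
    have "x i = \<zero>" for i using z[OF x(3), of i] regular_elementsD(2)[OF x(2) vecD(1)[OF x(1)]] by simp
    then have "(\<lambda>i. \<one> \<otimes> x i) = (\<lambda>_. \<zero>)" by simp
    then show ?thesis using submodule_vecD(2)[OF module_span_vec(1)[OF empty.prems(2)]] by simp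
  qed
  then show ?case using one_regular by blast
next
  case (insert j S)
  let ?H = "lspan U B"
  note H = module_span_vec(1)[OF insert.prems(2)] and BH = module_span_vec(2)[OF insert.prems(2)]
  note Hm = submodule_vecD[OF H]
  define C where "C = (\<lambda>b. b j) ` B"
  have C: "finite C" "C \<subseteq> carrier R" unfolding C_def using insert.prems(1,2) vecD(1)[of _ U] by (auto simp: subset_iff)
  obtain u where u: "support u C" using support_exists[OF C] by blast
  obtain a where a: "a \<in> Idl C" "support u {a}" using ideal_max_support[OF C u] by blast
  have uc: "u \<in> carrier R" using supportD(1)[OF u] .
  \<comment> \<open>Since these coordinates form an ideal, the element \<open>a\<close> of full
    support is the coordinate of one vector of \<open>H\<close>, which serves as the pivot
    row.\<close>
  have "ideal ((\<lambda>y. y j) ` ?H) R"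
  proof (rule idealI')
    show "(\<lambda>y. y j) ` ?H \<subseteq> carrier R" using Hm(1) vecD(1)[of _ U] by blast
    show "\<zero> \<in> (\<lambda>y. y j) ` ?H" using Hm(2) by (rule image_eqI[rotated]) simp
  next
    fix a b assume "a \<in> (\<lambda>y. y j) ` ?H" "b \<in> (\<lambda>y. y j) ` ?H"
    then obtain y z where y: "y \<in> ?H" "a = y j" "z \<in> ?H" "b = z j" by auto
    show "a \<oplus> b \<in> (\<lambda>y. y j) ` ?H"
      by (rule image_eqI[OF _ Hm(3)[OF y(1,3)]]) (simp add: y)
  next
    fix a r assume "a \<in> (\<lambda>y. y j) ` ?H" and r: "r \<in> carrier R"
    then obtain y where y: "y \<in> ?H" "a = y j" by auto
    show "r \<otimes> a \<in> (\<lambda>y. y j) ` ?H"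
      by (rule image_eqI[OF _ Hm(4)[OF y(1) r]]) (simp add: y)
  qed
  then have "Idl C \<subseteq> (\<lambda>y. y j) ` ?H" by (rule Idl_subsetI) (use BH in \<open>auto simp: C_def\<close>)
  then obtain h where h: "h \<in> ?H" "a = h j" using a by auto
  note hv = Hm(1)[OF h(1)]
  define T where "T = (\<lambda>x i. h j \<otimes> x i \<ominus> x j \<otimes> h i)"
  define E where "E = (\<lambda>(x :: 'c \<Rightarrow> 'a) i. (\<one> \<ominus> u) \<otimes> x i)"
  have T: "T \<in> End U" unfolding T_def by (rule elimination_hom[OF hv])
  have E: "E \<in> End U" unfolding E_def by (rule smult_hom) (use uc in auto)
  have TH: "T y \<in> ?H" if "y \<in> ?H" for y
    unfolding T_def using that h vecD(1)[OF hv] vecD(1)[OF Hm(1)[OF that]] by (intro Hm) auto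
  have EH: "E y \<in> ?H" if "y \<in> ?H" for y unfolding E_def using that uc by (intro Hm) auto
  \<comment> \<open>\<open>T\<close> and \<open>E\<close> map \<open>H\<close> into itself and clear
    coordinate \<open>j\<close> of every generator: \<open>T\<close> by elimination,
    \<open>E\<close> because \<open>u\<close> fixes these coordinates.\<close>
  define B' where "B' = T ` B \<union> E ` B"
  have B'H: "B' \<subseteq> ?H" unfolding B'_def using TH EH BH by auto
  have B'v: "B' \<subseteq> vec U" using B'H Hm(1) by blast
  have "?H \<subseteq> {x \<in> vec U. \<forall>i. i \<notin> insert j S \<longrightarrow> x i = \<zero>}"
    by (rule module_span_minimal[OF vanishing_submodule]) (use insert.prems in auto)
  then have van: "y i = \<zero>" if "y \<in> ?H" "i \<notin> insert j S" for y i using that by auto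
  have "b' i = \<zero>" if b': "b' \<in> B'" and i: "i \<notin> S" for b' i
  proof (cases "i = j")
    case False
    then show ?thesis using van[of b' i] b' B'H i by auto
  next
    case True
    consider b where "b \<in> B" "b' = T b" | b where "b \<in> B" "b' = E b" using b' unfolding B'_def by auto
    then show ?thesis
    proof cases
      case 1
      have "b j \<in> carrier R" using insert.prems(2) 1 vecD(1)[of _ U] by blast
      then show ?thesis unfolding 1 T_def True using vecD(1)[OF hv, of j] m_comm by simp
    next
      case 2
      have bj: "b j \<in> carrier R" using insert.prems(2) 2 vecD(1)[of _ U] by blast
      have "u \<otimes> b j = b j" using supportD(2)[OF u] 2 unfolding C_def by auto
      moreover have "(\<one> \<ominus> u) \<otimes> b j = b j \<ominus> u \<otimes> b j" using bj uc by algebra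
      ultimately show ?thesis unfolding 2 E_def True using bj by simp
    qed
  qed
  moreover have "finite B'" unfolding B'_def using insert.prems by auto
  ultimately obtain d where d: "d \<in> regular_elements R"
    "\<And>x s. x \<in> vec U \<Longrightarrow> s \<in> regular_elements R \<Longrightarrow> (\<lambda>i. s \<otimes> x i) \<in> lspan U B' \<Longrightarrow> (\<lambda>i. d \<otimes> x i) \<in> lspan U B'"
    using insert.IH[of B'] B'v by blast
  have dc: "d \<in> carrier R" using regular_elementsD(1)[OF d(1)] .
  have B'sub: "lspan U B' \<subseteq> ?H" by (rule lspan_subset[OF B'H insert.prems(2)])
  have B'self: "B' \<subseteq> lspan U B'" by (rule module_span_vec(2)[OF B'v])
  have ac: "a \<in> carrier R" using h vecD(1)[OF hv] by simp
  \<comment> \<open>The vector \<open>(a + 1 - u) x\<close> is the sum of \<open>T x\<close>, of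
    \<open>x j\<close> times the pivot row, and of \<open>E x\<close>. The induction hypothesis
    handles the first and the last summand, and the pivot row is in \<open>H\<close>.\<close>
  have "(\<lambda>i. (d \<otimes> (a \<oplus> (\<one> \<ominus> u))) \<otimes> x i) \<in> ?H"
    if x: "x \<in> vec U" "s \<in> regular_elements R" "(\<lambda>i. s \<otimes> x i) \<in> ?H" for x s
  proof -
    note sc = regular_elementsD(1)[OF x(2)]
    have "T (\<lambda>i. s \<otimes> x i) \<in> lspan U B'"
      by (rule lspan_image[OF T insert.prems(2) B'v _ x(3)]) (use B'self in \<open>auto simp: B'_def\<close>)
    then have 1: "(\<lambda>i. d \<otimes> T x i) \<in> ?H"
      using d(2)[OF vec_homD(1)[OF T x(1)] x(2)] B'sub unfolding vec_homD(3)[OF T x(1) sc] by auto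
    have "E (\<lambda>i. s \<otimes> x i) \<in> lspan U B'"
      by (rule lspan_image[OF E insert.prems(2) B'v _ x(3)]) (use B'self in \<open>auto simp: B'_def\<close>)
    then have 2: "(\<lambda>i. d \<otimes> E x i) \<in> ?H"
      using d(2)[OF vec_homD(1)[OF E x(1)] x(2)] B'sub unfolding vec_homD(3)[OF E x(1) sc] by auto
    have "(\<lambda>i. d \<otimes> T x i \<oplus> ((d \<otimes> x j) \<otimes> h i \<oplus> d \<otimes> E x i)) \<in> ?H"
      by (rule Hm(3)[OF 1 Hm(3)[OF Hm(4)[OF h(1)] 2]]) (use dc vecD(1)[OF x(1)] in simp)
    moreover have "d \<otimes> T x i \<oplus> ((d \<otimes> x j) \<otimes> h i \<oplus> d \<otimes> E x i) = (d \<otimes> (a \<oplus> (\<one> \<ominus> u))) \<otimes> x i" for i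
    proof -
      have "x i \<in> carrier R" "x j \<in> carrier R" "h i \<in> carrier R" "h j \<in> carrier R"
        using vecD(1)[OF hv] vecD(1)[OF x(1)] by auto
      then show ?thesis unfolding T_def E_def h(2) using dc uc by algebra
    qed
    ultimately show ?thesis by simp
  qed
  moreover have "d \<otimes> (a \<oplus> (\<one> \<ominus> u)) \<in> regular_elements R"
    using d(1) support_regular[OF a(2) ac] by (rule regular_elements_mult)
  ultimately show ?case by blast
qed

text \<open>The image of \<open>p\<close> is the purification of \<open>R h\<close>; its defining
  equations stand in the statement, so that later only \<open>p\<close> is needed. For a form
  \<open>\<gamma>\<close> and a homomorphism \<open>f\<close> on the content of \<open>h\<close>,
  the map sending \<open>x\<close> to \<open>\<gamma> x\<close> times the vector \<open>f(h)\<close>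
  has values in the purification and acts on it as multiplication by \<open>f(\<gamma> h)\<close>.
  The dual basis of the content combines such maps into one that acts as the identity there. The
  form \<open>g\<close> is chosen with \<open>g h\<close> of full support, so that it detects the
  whole summand.\<close>

lemma rank_one_projection:
  assumes U: "finite U" and h: "h \<in> vec U" and u: "support u (range h)"
  obtains p g where "p \<in> End U" "g \<in> dual U" "p h = h" "support u {g h}"
    "\<And>x \<gamma>. x \<in> vec U \<Longrightarrow> \<gamma> \<in> dual U \<Longrightarrow> (\<lambda>i. \<gamma> h \<otimes> p x i) = (\<lambda>i. \<gamma> (p x) \<otimes> h i)"
    "\<And>x. x \<in> vec U \<Longrightarrow> (\<lambda>i. u \<otimes> p x i) = p x"
    "\<And>y. y \<in> vec U \<Longrightarrow> (\<And>\<gamma>. \<gamma> \<in> dual U \<Longrightarrow> (\<lambda>i. \<gamma> h \<otimes> y i) = (\<lambda>i. \<gamma> y \<otimes> h i)) \<Longrightarrow>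
      (\<lambda>i. u \<otimes> y i) = y \<Longrightarrow> p y = y"
proof -
  \<comment> \<open>The equations with \<open>\<gamma>\<close> say that \<open>y\<close> and
    \<open>h\<close> are proportional: all two-by-two minors vanish. They are void where
    \<open>h\<close> is zero, hence the condition with \<open>u\<close>.\<close>
  define L where "L = {y \<in> vec U. (\<forall>\<gamma>\<in>dual U. (\<lambda>i. \<gamma> h \<otimes> y i) = (\<lambda>i. \<gamma> y \<otimes> h i)) \<and> (\<lambda>i. u \<otimes> y i) = y}"
  note uc = supportD(1)[OF u] and hc = vecD(1)[OF h]
  have rh: "range h \<subseteq> carrier R" "finite (range h)" by (rule range_vec[OF h], rule finite_range_vec[OF U h])
  define c where "c = Idl (range h)"
  have c: "ideal c R" unfolding c_def by (rule genideal_ideal[OF rh(1)])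
  note cc = ideal_closed[OF c]
  have hcc: "h i \<in> c" for i unfolding c_def using genideal_self[OF rh(1)] by auto
  have c_dual: "{\<gamma> h | \<gamma>. \<gamma> \<in> dual U} = c" unfolding c_def by (rule dual_values_at_vector[OF U h])
  have uc': "u \<otimes> a = a" if "a \<in> c" for a
    using u support_Idl[OF rh(1)] supportD(2) that unfolding c_def by blast
  have Lmod: "submodule L R (free_module R U)"
  proof -
    let ?P = "\<lambda>\<gamma>. {y \<in> vec U. (\<lambda>i. \<gamma> h \<otimes> y i) = (\<lambda>i. \<gamma> y \<otimes> h i)}" and ?E = "{y \<in> vec U. (\<lambda>i. u \<otimes> y i) = y}"
    have P: "submodule (?P \<gamma>) R (free_module R U)" if "\<gamma> \<in> dual U" for \<gamma>
      by (rule submodule_equalizer[OF module_free smult_hom[OF dualD(1)[OF that h]] dual_times_vec_hom[OF that h]])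
    have E: "submodule ?E R (free_module R U)"
      by (rule submodule_equalizer[OF module_free smult_hom[OF uc]]) (rule vec_homI, auto)
    have L: "y \<in> L \<longleftrightarrow> y \<in> ?E \<and> (\<forall>\<gamma>\<in>dual U. y \<in> ?P \<gamma>)" for y unfolding L_def by auto
    show ?thesis
    proof (rule submodule_vecI)
      show "L \<subseteq> vec U" unfolding L_def by auto
      show "(\<lambda>_. \<zero>) \<in> L" unfolding L using submodule_vecD(2)[OF E] submodule_vecD(2)[OF P] by blast
      show "(\<lambda>i. x i \<oplus> y i) \<in> L" if "x \<in> L" "y \<in> L" for x y
        using that submodule_vecD(3)[OF E, of x y] submodule_vecD(3)[OF P, of _ x y] unfolding L by blast
      show "(\<lambda>i. r \<otimes> x i) \<in> L" if "x \<in> L" "r \<in> carrier R" for x r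
        using that submodule_vecD(4)[OF E, of x r] submodule_vecD(4)[OF P, of _ x r] unfolding L by blast
    qed
  qed
  note Lm = submodule_vecD[OF Lmod]
  \<comment> \<open>The multipliers whose action on \<open>L\<close> is the restriction of an
    endomorphism with values in \<open>L\<close>. As they form an ideal, it contains
    \<open>u\<close> once it contains all values \<open>f a\<close>; and \<open>u\<close> acts on
    \<open>L\<close> as the identity.\<close>
  define A where "A = {t \<in> carrier R. \<exists>T\<in>End U. (\<forall>x\<in>vec U. T x \<in> L) \<and> (\<forall>y\<in>L. T y = (\<lambda>i. t \<otimes> y i))}"
  have A: "ideal A R"
  proof (rule idealI')
    show "A \<subseteq> carrier R" unfolding A_def by auto
    have "(\<lambda>_ _. \<zero>) \<in> End U" by (rule vec_homI) (auto simp: vec_closed)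
    then show "\<zero> \<in> A" unfolding A_def using Lm(1,2) vecD(1)[of _ U] by (auto intro!: bexI[of _ "\<lambda>_ _. \<zero>"])
  next
    fix s t assume "s \<in> A" "t \<in> A"
    then obtain S T where *: "s \<in> carrier R" "S \<in> End U" "\<forall>x\<in>vec U. S x \<in> L" "\<forall>y\<in>L. S y = (\<lambda>i. s \<otimes> y i)"
      "t \<in> carrier R" "T \<in> End U" "\<forall>x\<in>vec U. T x \<in> L" "\<forall>y\<in>L. T y = (\<lambda>i. t \<otimes> y i)"
      unfolding A_def by auto
    have "(\<lambda>x i. S x i \<oplus> T x i) \<in> End U" by (rule vec_hom_sum[OF *(2,6)])
    moreover have "(\<lambda>i. S x i \<oplus> T x i) \<in> L" if "x \<in> vec U" for x using * that by (intro Lm) auto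
    moreover have "(\<lambda>i. S y i \<oplus> T y i) = (\<lambda>i. (s \<oplus> t) \<otimes> y i)" if "y \<in> L" for y
      using * that vecD(1)[OF Lm(1)[OF that]] by (simp add: l_distr)
    ultimately show "s \<oplus> t \<in> A" unfolding A_def using * by (auto intro!: bexI[of _ "\<lambda>x i. S x i \<oplus> T x i"])
  next
    fix t r assume "t \<in> A" and r: "r \<in> carrier R"
    then obtain T where *: "t \<in> carrier R" "T \<in> End U" "\<forall>x\<in>vec U. T x \<in> L" "\<forall>y\<in>L. T y = (\<lambda>i. t \<otimes> y i)"
      unfolding A_def by auto
    have "(\<lambda>x i. r \<otimes> T x i) \<in> End U" by (rule module_hom_comp[OF *(2) smult_hom[OF r]])
    moreover have "(\<lambda>i. r \<otimes> T x i) \<in> L" if "x \<in> vec U" for x using * that r by (intro Lm) auto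
    moreover have "(\<lambda>i. r \<otimes> T y i) = (\<lambda>i. (r \<otimes> t) \<otimes> y i)" if "y \<in> L" for y
      using * that vecD(1)[OF Lm(1)[OF that]] r by (simp add: m_assoc)
    ultimately show "r \<otimes> t \<in> A" unfolding A_def using * r by (auto intro!: bexI[of _ "\<lambda>x i. r \<otimes> T x i"])
  qed
  have "f a \<in> A" if f: "f \<in> ideal_dual c" and a: "a \<in> c" for f a
  proof -
    note fd = ideal_dualD[OF f]
    obtain \<gamma> where \<gamma>: "\<gamma> \<in> dual U" "a = \<gamma> h" using a c_dual by blast
    note \<gamma>d = dualD[OF \<gamma>(1)]
    define v where "v = (\<lambda>i. f (h i))"
    have v: "v \<in> vec U" unfolding v_def by (rule ideal_dual_vec[OF U c f h hcc])
    have vc: "v i \<in> carrier R" for i using vecD(1)[OF v] .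
    note fcomm = ideal_dual_comm[OF c f]
    have uv: "u \<otimes> v i = v i" for i
      unfolding v_def fd(3)[OF hcc uc, symmetric] uc'[OF hcc] ..
    have \<delta>v: "\<delta> v = f (\<delta> h)" if \<delta>: "\<delta> \<in> dual U" for \<delta>
      unfolding v_def by (rule dual_ideal_dual[OF U c f \<delta> h hcc])
    define T where "T = (\<lambda>x i. \<gamma> x \<otimes> v i)"
    have "T \<in> End U" unfolding T_def by (rule dual_times_vec_hom[OF \<gamma>(1) v])
    moreover have "T x \<in> L" if x: "x \<in> vec U" for x
    proof -
      have \<gamma>x: "\<gamma> x \<in> carrier R" using \<gamma>d(1)[OF x] .
      have Tv: "T x \<in> vec U" unfolding T_def using v \<gamma>x by (rule vec_closed(3))
      moreover have "(\<lambda>i. \<delta> h \<otimes> T x i) = (\<lambda>i. \<delta> (T x) \<otimes> h i)" if \<delta>: "\<delta> \<in> dual U" for \<delta>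
      proof
        fix i
        have \<delta>h: "\<delta> h \<in> c" using c_dual \<delta> by blast
        have k: "\<delta> h \<in> carrier R" "f (\<delta> h) \<in> carrier R" using cc(5)[OF \<delta>h] fd(1)[OF \<delta>h] by auto
        have "\<delta> (T x) = \<gamma> x \<otimes> f (\<delta> h)" unfolding T_def dualD(3)[OF \<delta> v \<gamma>x] \<delta>v[OF \<delta>] ..
        moreover have "\<delta> h \<otimes> v i = f (\<delta> h) \<otimes> h i" unfolding v_def by (rule fcomm[OF \<delta>h hcc])
        moreover have "\<delta> h \<otimes> (\<gamma> x \<otimes> v i) = \<gamma> x \<otimes> (\<delta> h \<otimes> v i)" using k \<gamma>x vc[of i] by algebra
        ultimately show "\<delta> h \<otimes> T x i = \<delta> (T x) \<otimes> h i" unfolding T_def using k \<gamma>x hc by (simp add: m_assoc)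
      qed
      moreover have "(\<lambda>i. u \<otimes> T x i) = T x" unfolding T_def
        using uv m_lcomm[OF uc \<gamma>x vc] by simp
      ultimately show ?thesis unfolding L_def by auto
    qed
    moreover have "T y = (\<lambda>i. f a \<otimes> y i)" if y: "y \<in> L" for y
    proof
      fix i
      have yv: "y \<in> vec U" and e: "\<gamma> h \<otimes> y i = \<gamma> y \<otimes> h i" using y \<gamma>(1) unfolding L_def by (auto dest: fun_cong)
      have yc: "y i \<in> carrier R" "\<gamma> y \<in> carrier R" using vecD(1)[OF yv] \<gamma>d(1)[OF yv] by auto
      have "T y i = f (\<gamma> y \<otimes> h i)" unfolding T_def v_def using fd(3)[OF hcc yc(2)] by simp
      also have "\<dots> = f (y i \<otimes> a)" using e m_comm[OF yc(1) cc(5)[OF a]] \<gamma>(2) by simp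
      also have "\<dots> = y i \<otimes> f a" by (rule fd(3)[OF a yc(1)])
      finally show "T y i = f a \<otimes> y i" using m_comm[OF yc(1) fd(1)[OF a]] by simp
    qed
    ultimately show "f a \<in> A" unfolding A_def using fd(1)[OF a] by auto
  qed
  then have "{f a | f a. f \<in> ideal_dual c \<and> a \<in> c} \<subseteq> A" by blast
  then have "Idl {f a | f a. f \<in> ideal_dual c \<and> a \<in> c} \<subseteq> A" by (rule Idl_subsetI[OF A])
  then have "u \<in> A" using support_mem_trace[OF rh(2) u rh(1)] unfolding c_def by auto
  then obtain p where p: "p \<in> End U" "\<And>x. x \<in> vec U \<Longrightarrow> p x \<in> L" "\<And>y. y \<in> L \<Longrightarrow> p y = (\<lambda>i. u \<otimes> y i)"
    unfolding A_def by auto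
  have hL: "h \<in> L"
    unfolding L_def using h supportD(2)[OF u] by auto
  obtain a where a: "a \<in> c" "support u {a}" using ideal_max_support[OF rh(2,1) u] unfolding c_def by blast
  obtain g where g: "g \<in> dual U" "a = g h" using a c_dual by blast
  show ?thesis
  proof (rule that[OF p(1) g(1)])
    show "p h = h" using p(3)[OF hL] supportD(2)[OF u] by simp
    show "support u {g h}" using a g by simp
    show "(\<lambda>i. \<gamma> h \<otimes> p x i) = (\<lambda>i. \<gamma> (p x) \<otimes> h i)" if "x \<in> vec U" "\<gamma> \<in> dual U" for x \<gamma>
      using p(2)[OF that(1)] that(2) unfolding L_def by blast
    show "(\<lambda>i. u \<otimes> p x i) = p x" if "x \<in> vec U" for x
      using p(2)[OF that] unfolding L_def by blast
    show "p y = y" if "y \<in> vec U" "\<And>\<gamma>. \<gamma> \<in> dual U \<Longrightarrow> (\<lambda>i. \<gamma> h \<otimes> y i) = (\<lambda>i. \<gamma> y \<otimes> h i)"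
      "(\<lambda>i. u \<otimes> y i) = y" for y
    proof -
      have "y \<in> L" unfolding L_def using that by blast
      then show ?thesis using p(3) that(3) by simp
    qed
  qed
qed

text \<open>Elimination again, with \<open>S\<close> as the set of coordinates still in play. A
  relation that is merely nonzero would be too weak, as it may live on an idempotent where nothing
  is claimed; so the relation is required below \<open>\<epsilon>\<close>. Being stated for every
  \<open>\<epsilon>\<close>, the induction hypothesis can be used on the smaller support of the
  pivot.\<close>

lemma linear_relation_exists:
  assumes "finite S" "card S < n" "\<xi> \<in> module_hom R (free_module R {..<n}) (free_module R U)"
    "\<And>c i. c \<in> vec {..<n} \<Longrightarrow> i \<notin> S \<Longrightarrow> \<xi> c i = \<zero>"
    "\<epsilon> \<in> carrier R" "\<epsilon> \<noteq> \<zero>" "\<epsilon> \<otimes> \<epsilon> = \<epsilon>"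
  shows "\<exists>c\<in>vec {..<n}. c \<noteq> (\<lambda>_. \<zero>) \<and> (\<lambda>i. \<epsilon> \<otimes> c i) = c \<and> \<xi> c = (\<lambda>_. \<zero>)"
  using assms
proof (induction n arbitrary: S \<xi> \<epsilon>)
  case 0 then show ?case by simp
next
  case (Suc n)
  note \<xi>d = vec_homD[OF Suc.prems(3)] and \<epsilon>c = Suc.prems(5)
  define \<delta> where "\<delta> = (\<lambda>i. if i = n then \<one> else \<zero>)"
  have \<delta>: "\<delta> \<in> vec {..<Suc n}" unfolding \<delta>_def by (rule unit_vec_closed) auto
  define v where "v = \<xi> \<delta>"
  have v: "v \<in> vec U" unfolding v_def by (rule \<xi>d(1)[OF \<delta>])
  note vc = vecD(1)[OF v]
  show ?case
  proof (cases "\<forall>i. \<epsilon> \<otimes> v i = \<zero>")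
    case True
    have "\<xi> (\<lambda>i. \<epsilon> \<otimes> \<delta> i) = (\<lambda>_. \<zero>)" unfolding \<xi>d(3)[OF \<delta> \<epsilon>c] using True v_def by simp
    moreover have "(\<lambda>i. \<epsilon> \<otimes> \<delta> i) \<noteq> (\<lambda>_. \<zero>)"
    proof
      assume "(\<lambda>i. \<epsilon> \<otimes> \<delta> i) = (\<lambda>_. \<zero>)"
      then have "\<epsilon> \<otimes> \<delta> n = \<zero>" by (rule fun_cong)
      then show False using Suc.prems(6) \<epsilon>c unfolding \<delta>_def by simp
    qed
    moreover have "(\<lambda>i. \<epsilon> \<otimes> (\<epsilon> \<otimes> \<delta> i)) = (\<lambda>i. \<epsilon> \<otimes> \<delta> i)"
      using Suc.prems(7) m_assoc[OF \<epsilon>c \<epsilon>c vecD(1)[OF \<delta>], symmetric] by simp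
    ultimately show ?thesis using vec_closed(3)[OF \<delta> \<epsilon>c] by blast
  next
    case False
    then obtain j where j: "\<epsilon> \<otimes> v j \<noteq> \<zero>" by auto
    have jS: "j \<in> S"
      by (rule ccontr) (use j Suc.prems(4)[OF \<delta>, of j] \<epsilon>c in \<open>auto simp: v_def\<close>)
    define a where "a = \<epsilon> \<otimes> v j"
    have ac: "a \<in> carrier R" unfolding a_def using \<epsilon>c vc by simp
    \<comment> \<open>Below \<open>\<epsilon>'\<close> the pivot \<open>v j\<close> is not a zero
      divisor, so a relation found there stays nonzero after multiplication by \<open>v j\<close>.
      It also lies below \<open>\<epsilon>\<close>.\<close>
    obtain \<epsilon>' where \<epsilon>': "support \<epsilon>' {a}" using support_exists[of "{a}"] ac by auto
    note \<epsilon>'c = supportD(1)[OF \<epsilon>']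
    have "\<epsilon>' \<otimes> a = a" using supportD(2)[OF \<epsilon>'] by simp
    then have \<epsilon>'0: "\<epsilon>' \<noteq> \<zero>" using j ac unfolding a_def by auto
    have \<epsilon>'2: "\<epsilon>' \<otimes> \<epsilon>' = \<epsilon>'" using support_idem[OF \<epsilon>'] ac by simp
    have \<epsilon>\<epsilon>': "\<epsilon> \<otimes> \<epsilon>' = \<epsilon>'"
      by (rule support_mult[OF \<epsilon>']) (use ac \<epsilon>c Suc.prems(7) vc in \<open>auto simp: a_def m_assoc[symmetric]\<close>)
    define T where "T = (\<lambda>x i. v j \<otimes> x i \<ominus> x j \<otimes> v i)"
    have T: "T \<in> End U" unfolding T_def by (rule elimination_hom[OF v])
    have inc: "c \<in> vec {..<Suc n}" if "c \<in> vec {..<n}" for c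
      using that by (auto simp: vec_iff)
    have \<xi>': "(\<lambda>c. T (\<xi> c)) \<in> module_hom R (free_module R {..<n}) (free_module R U)"
    proof (rule vec_homI)
      show "T (\<xi> c) \<in> vec U" if "c \<in> vec {..<n}" for c using vec_homD(1)[OF T \<xi>d(1)[OF inc[OF that]]] .
      show "T (\<xi> (\<lambda>i. x i \<oplus> y i)) = (\<lambda>i. T (\<xi> x) i \<oplus> T (\<xi> y) i)" if "x \<in> vec {..<n}" "y \<in> vec {..<n}" for x y
        using \<xi>d(2)[OF inc[OF that(1)] inc[OF that(2)]] vec_homD(2)[OF T \<xi>d(1)[OF inc[OF that(1)]] \<xi>d(1)[OF inc[OF that(2)]]]
        by simp
      show "T (\<xi> (\<lambda>i. r \<otimes> x i)) = (\<lambda>i. r \<otimes> T (\<xi> x) i)" if "x \<in> vec {..<n}" "r \<in> carrier R" for x r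
        using \<xi>d(3)[OF inc[OF that(1)] that(2)] vec_homD(3)[OF T \<xi>d(1)[OF inc[OF that(1)]] that(2)] by simp
    qed
    have "T (\<xi> c) i = \<zero>" if c: "c \<in> vec {..<n}" and i: "i \<notin> S - {j}" for c i
    proof (cases "i = j")
      case True
      then show ?thesis unfolding T_def using vc[of j] vecD(1)[OF \<xi>d(1)[OF inc[OF c]], of j] m_comm by simp
    next
      case False
      then have "\<xi> c i = \<zero>" "v i = \<zero>" using i Suc.prems(4) inc[OF c] \<delta> unfolding v_def by auto
      then show ?thesis unfolding T_def using vc[of j] vecD(1)[OF \<xi>d(1)[OF inc[OF c]], of j] by simp
    qed
    moreover have "finite (S - {j})" "card (S - {j}) < n"
      using Suc.prems(1,2) jS card_Suc_Diff1[of S j] by auto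
    ultimately obtain c where c: "c \<in> vec {..<n}" "c \<noteq> (\<lambda>_. \<zero>)" "(\<lambda>i. \<epsilon>' \<otimes> c i) = c" "T (\<xi> c) = (\<lambda>_. \<zero>)"
      using Suc.IH[of "S - {j}" "\<lambda>c. T (\<xi> c)" \<epsilon>'] \<xi>' \<epsilon>'c \<epsilon>'0 \<epsilon>'2 by blast
    note cv = inc[OF c(1)]
    note cc = vecD(1)[OF cv] and \<xi>cc = vecD(1)[OF \<xi>d(1)[OF cv]]
    have \<epsilon>'ci: "\<epsilon>' \<otimes> c i = c i" for i using c(3) by (rule fun_cong)
    have \<epsilon>ci: "\<epsilon> \<otimes> c i = c i" for i
      using \<epsilon>\<epsilon>' \<epsilon>'ci m_assoc[OF \<epsilon>c \<epsilon>'c cc] by metis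
    have \<epsilon>\<xi>: "\<epsilon> \<otimes> \<xi> c i = \<xi> c i" for i
      using \<xi>d(3)[OF cv \<epsilon>c] \<epsilon>ci by (metis ext)
    \<comment> \<open>The coefficient of the last vector is solved for: since \<open>\<xi>\<close>
      maps \<open>\<delta>\<close> to \<open>v\<close>, the image of \<open>c'\<close> is
      \<open>T (\<xi> c)\<close>, which is zero.\<close>
    define c' where "c' = (\<lambda>i. v j \<otimes> c i \<ominus> \<xi> c j \<otimes> \<delta> i)"
    have v1: "(\<lambda>i. v j \<otimes> c i) \<in> vec {..<Suc n}" and v2: "(\<lambda>i. \<xi> c j \<otimes> \<delta> i) \<in> vec {..<Suc n}"
      using cv \<delta> vc \<xi>cc by (auto intro: vec_closed(3))
    have "c' \<in> vec {..<Suc n}" unfolding c'_def by (rule vec_closed(4)[OF v1 v2])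
    moreover have "\<xi> c' = (\<lambda>_. \<zero>)"
      using c(4) unfolding c'_def \<xi>d(5)[OF v1 v2] \<xi>d(3)[OF cv vc] \<xi>d(3)[OF \<delta> \<xi>cc] T_def v_def[symmetric] .
    moreover have "(\<lambda>i. \<epsilon> \<otimes> c' i) = c'"
    proof
      fix i
      have \<delta>i: "\<delta> i \<in> carrier R" using vecD(1)[OF \<delta>] .
      have "\<epsilon> \<otimes> c' i = v j \<otimes> (\<epsilon> \<otimes> c i) \<ominus> (\<epsilon> \<otimes> \<xi> c j) \<otimes> \<delta> i"
        unfolding c'_def using \<epsilon>c vc[of j] cc[of i] \<xi>cc[of j] \<delta>i by algebra
      then show "\<epsilon> \<otimes> c' i = c' i" unfolding \<epsilon>ci \<epsilon>\<xi> c'_def .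
    qed
    moreover have "c' \<noteq> (\<lambda>_. \<zero>)"
    proof
      assume c'0: "c' = (\<lambda>_. \<zero>)"
      obtain i where i: "c i \<noteq> \<zero>" using c(2) by auto
      then have "i \<noteq> n" using vecD(2)[OF c(1), of n] by auto
      then have "c' i = v j \<otimes> c i" unfolding c'_def \<delta>_def using vc[of j] cc[of i] \<xi>cc[of j]
        by (simp add: a_minus_def)
      then have "v j \<otimes> c i = \<zero>" using c'0 by simp
      moreover have "c i \<otimes> a = \<epsilon> \<otimes> (v j \<otimes> c i)" unfolding a_def using vc[of j] cc[of i] \<epsilon>c by algebra
      ultimately have "c i \<otimes> a = \<zero>" using \<epsilon>c by simp
      then have "c i \<otimes> \<epsilon>' = \<zero>" using cc[of i] by (intro supportD(3)[OF \<epsilon>']) auto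
      then show False using i \<epsilon>'ci[of i] m_comm[OF cc \<epsilon>'c] by metis
    qed
    ultimately show ?thesis by blast
  qed
qed

end

section \<open>Localization\<close>

text \<open>Instantiated twice: with the regular elements, for invertible ideals, and with the
  complement of a maximal ideal, for the local-global property.\<close>

locale multiplicative_subset = cring +
  fixes S
  assumes subset: "S \<subseteq> carrier R"
    and one_mem: "\<one> \<in> S"
    and mult_mem: "s \<in> S \<Longrightarrow> t \<in> S \<Longrightarrow> s \<otimes> t \<in> S"
begin

abbreviation "Q \<equiv> localization R S"
abbreviation "fr \<equiv> fraction R S"

lemma S_carrier: "s \<in> S \<Longrightarrow> s \<in> carrier R"
  using subset by auto

lemma equiv_frac_rel: "equiv (carrier R \<times> S) (frac_rel R S)"
proof (rule equivI)
  show "frac_rel R S \<subseteq> (carrier R \<times> S) \<times> (carrier R \<times> S)" unfolding frac_rel_def by auto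
  show "refl_on (carrier R \<times> S) (frac_rel R S)"
    unfolding refl_on_def frac_rel_def using one_mem by auto
  show "sym (frac_rel R S)"
  proof (rule symI)
    fix x y assume "(x, y) \<in> frac_rel R S"
    then show "(y, x) \<in> frac_rel R S" unfolding frac_rel_def by (cases x; cases y) (simp, metis)
  qed
  show "trans (frac_rel R S)"
  proof (rule transI)
    fix x y z assume "(x, y) \<in> frac_rel R S" "(y, z) \<in> frac_rel R S"
    then obtain a s b t c w u v where *: "x = (a, s)" "y = (b, t)" "z = (c, w)"
      "a \<in> carrier R" "b \<in> carrier R" "c \<in> carrier R" "s \<in> S" "t \<in> S" "w \<in> S" "u \<in> S" "v \<in> S"
      "u \<otimes> (a \<otimes> t) = u \<otimes> (b \<otimes> s)" "v \<otimes> (b \<otimes> w) = v \<otimes> (c \<otimes> t)"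
      unfolding frac_rel_def by auto
    have c: "s \<in> carrier R" "t \<in> carrier R" "w \<in> carrier R" "u \<in> carrier R" "v \<in> carrier R"
      using * S_carrier by auto
    \<comment> \<open>Besides the two given witnesses the new one contains the middle denominator
      \<open>t\<close>, which cannot be cancelled otherwise.\<close>
    have "(u \<otimes> v \<otimes> t) \<otimes> (a \<otimes> w) = (v \<otimes> w) \<otimes> (u \<otimes> (a \<otimes> t))" using c *(4-6) by algebra
    also have "\<dots> = (u \<otimes> s) \<otimes> (v \<otimes> (b \<otimes> w))" unfolding *(12) using c *(4-6) by algebra
    also have "\<dots> = (u \<otimes> v \<otimes> t) \<otimes> (c \<otimes> s)" unfolding *(13) using c *(4-6) by algebra
    finally show "(x, z) \<in> frac_rel R S" unfolding frac_rel_def * using * mult_mem by blast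
  qed
qed

lemma fraction_eq_iff:
  assumes "a \<in> carrier R" "s \<in> S" "b \<in> carrier R" "t \<in> S"
  shows "fr a s = fr b t \<longleftrightarrow> (\<exists>u\<in>S. u \<otimes> (a \<otimes> t) = u \<otimes> (b \<otimes> s))"
  unfolding fraction_def using eq_equiv_class_iff[OF equiv_frac_rel, of "(a, s)" "(b, t)"] assms
  by (auto simp: frac_rel_def)

lemma fraction_eqI:
  assumes "a \<in> carrier R" "s \<in> S" "b \<in> carrier R" "t \<in> S" "a \<otimes> t = b \<otimes> s"
  shows "fr a s = fr b t"
  using fraction_eq_iff[OF assms(1-4)] assms(5) one_mem by auto

lemma fraction_closed: "a \<in> carrier R \<Longrightarrow> s \<in> S \<Longrightarrow> fr a s \<in> carrier Q"
  unfolding localization_def fraction_def by (auto intro: quotientI)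

lemma localization_cases:
  assumes "x \<in> carrier Q"
  obtains a s where "a \<in> carrier R" "s \<in> S" "x = fr a s"
  using assms unfolding localization_def fraction_def by (auto elim!: quotientE)

lemma fraction_mem:
  assumes "a \<in> carrier R" "s \<in> S"
  shows "(b, t) \<in> fr a s \<longleftrightarrow> b \<in> carrier R \<and> t \<in> S \<and> (\<exists>u\<in>S. u \<otimes> (a \<otimes> t) = u \<otimes> (b \<otimes> s))"
  unfolding fraction_def frac_rel_def using assms by auto

lemma fraction_self: "a \<in> carrier R \<Longrightarrow> s \<in> S \<Longrightarrow> (a, s) \<in> fr a s"
  unfolding fraction_def frac_rel_def using one_mem by auto

text \<open>The ring operations of \<open>localization\<close> are unions over representatives. This
  reduces each of them to well-definedness: if the value is independent of the representatives, the
  union is that value.\<close>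

lemma UN_fractions:
  assumes "a \<in> carrier R" "s \<in> S" "b \<in> carrier R" "t \<in> S"
    "\<And>a' s' b' t'. (a', s') \<in> fr a s \<Longrightarrow> (b', t') \<in> fr b t \<Longrightarrow> F a' s' b' t' = F a s b t"
  shows "(\<Union>(a', s')\<in>fr a s. \<Union>(b', t')\<in>fr b t. F a' s' b' t') = F a s b t"
proof (intro equalityI subsetI)
  fix z assume "z \<in> (\<Union>(a', s')\<in>fr a s. \<Union>(b', t')\<in>fr b t. F a' s' b' t')"
  then obtain a' s' b' t' where "(a', s') \<in> fr a s" "(b', t') \<in> fr b t" "z \<in> F a' s' b' t'" by auto
  then show "z \<in> F a s b t" using assms(5)[of a' s' b' t'] by simp
next
  fix z assume z: "z \<in> F a s b t"
  then have "z \<in> (\<Union>(b', t')\<in>fr b t. F a s b' t')"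
    by (intro UN_I[OF fraction_self[OF assms(3,4)]]) simp
  then show "z \<in> (\<Union>(a', s')\<in>fr a s. \<Union>(b', t')\<in>fr b t. F a' s' b' t')"
    by (intro UN_I[OF fraction_self[OF assms(1,2)]]) simp
qed

lemma fraction_mult:
  assumes "a \<in> carrier R" "s \<in> S" "b \<in> carrier R" "t \<in> S"
  shows "fr a s \<otimes>\<^bsub>Q\<^esub> fr b t = fr (a \<otimes> b) (s \<otimes> t)"
proof -
  have "fr (a' \<otimes> b') (s' \<otimes> t') = fr (a \<otimes> b) (s \<otimes> t)"
    if 1: "(a', s') \<in> fr a s" and 2: "(b', t') \<in> fr b t" for a' s' b' t'
  proof -
    obtain u where u: "a' \<in> carrier R" "s' \<in> S" "u \<in> S" "u \<otimes> (a \<otimes> s') = u \<otimes> (a' \<otimes> s)"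
      using 1 fraction_mem[OF assms(1,2)] by auto
    obtain v where v: "b' \<in> carrier R" "t' \<in> S" "v \<in> S" "v \<otimes> (b \<otimes> t') = v \<otimes> (b' \<otimes> t)"
      using 2 fraction_mem[OF assms(3,4)] by auto
    have c: "a \<in> carrier R" "b \<in> carrier R" "a' \<in> carrier R" "b' \<in> carrier R" "s \<in> carrier R" "t \<in> carrier R" "s' \<in> carrier R" "t' \<in> carrier R" "u \<in> carrier R" "v \<in> carrier R"
      using assms u v S_carrier by auto
    have "(u \<otimes> v) \<otimes> ((a' \<otimes> b') \<otimes> (s \<otimes> t)) = (u \<otimes> (a' \<otimes> s)) \<otimes> (v \<otimes> (b' \<otimes> t))" using c by algebra
    also have "\<dots> = (u \<otimes> v) \<otimes> ((a \<otimes> b) \<otimes> (s' \<otimes> t'))" unfolding u(4)[symmetric] v(4)[symmetric] using c by algebra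
    finally show ?thesis
      using fraction_eq_iff[of "a' \<otimes> b'" "s' \<otimes> t'" "a \<otimes> b" "s \<otimes> t"] assms u v mult_mem by auto
  qed
  then show ?thesis using UN_fractions[OF assms, of "\<lambda>a s b t. fr (a \<otimes> b) (s \<otimes> t)"]
    by (simp add: localization_def)
qed

lemma fraction_add:
  assumes "a \<in> carrier R" "s \<in> S" "b \<in> carrier R" "t \<in> S"
  shows "fr a s \<oplus>\<^bsub>Q\<^esub> fr b t = fr (a \<otimes> t \<oplus> b \<otimes> s) (s \<otimes> t)"
proof -
  have "fr (a' \<otimes> t' \<oplus> b' \<otimes> s') (s' \<otimes> t') = fr (a \<otimes> t \<oplus> b \<otimes> s) (s \<otimes> t)"
    if 1: "(a', s') \<in> fr a s" and 2: "(b', t') \<in> fr b t" for a' s' b' t'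
  proof -
    obtain u where u: "a' \<in> carrier R" "s' \<in> S" "u \<in> S" "u \<otimes> (a \<otimes> s') = u \<otimes> (a' \<otimes> s)"
      using 1 fraction_mem[OF assms(1,2)] by auto
    obtain v where v: "b' \<in> carrier R" "t' \<in> S" "v \<in> S" "v \<otimes> (b \<otimes> t') = v \<otimes> (b' \<otimes> t)"
      using 2 fraction_mem[OF assms(3,4)] by auto
    have c: "a \<in> carrier R" "b \<in> carrier R" "a' \<in> carrier R" "b' \<in> carrier R" "s \<in> carrier R" "t \<in> carrier R" "s' \<in> carrier R" "t' \<in> carrier R" "u \<in> carrier R" "v \<in> carrier R"
      using assms u v S_carrier by auto
    have "(u \<otimes> v) \<otimes> ((a' \<otimes> t' \<oplus> b' \<otimes> s') \<otimes> (s \<otimes> t))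
        = (v \<otimes> (t \<otimes> t')) \<otimes> (u \<otimes> (a' \<otimes> s)) \<oplus> (u \<otimes> (s \<otimes> s')) \<otimes> (v \<otimes> (b' \<otimes> t))" using c by algebra
    also have "\<dots> = (u \<otimes> v) \<otimes> ((a \<otimes> t \<oplus> b \<otimes> s) \<otimes> (s' \<otimes> t'))"
      unfolding u(4)[symmetric] v(4)[symmetric] using c by algebra
    finally show ?thesis
      using fraction_eq_iff[of "a' \<otimes> t' \<oplus> b' \<otimes> s'" "s' \<otimes> t'" "a \<otimes> t \<oplus> b \<otimes> s" "s \<otimes> t"] assms u v c mult_mem by auto
  qed
  then show ?thesis using UN_fractions[OF assms, of "\<lambda>a s b t. fr (a \<otimes> t \<oplus> b \<otimes> s) (s \<otimes> t)"]
    by (simp add: localization_def)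
qed

lemma localization_one: "\<one>\<^bsub>Q\<^esub> = fr \<one> \<one>" and localization_zero: "\<zero>\<^bsub>Q\<^esub> = fr \<zero> \<one>"
  unfolding localization_def by simp_all

lemma localization_cring: "cring Q"
proof (rule cringI)
  show "abelian_group Q"
  proof (rule abelian_groupI)
    fix x y assume "x \<in> carrier Q" "y \<in> carrier Q"
    then obtain a s b t where *: "a \<in> carrier R" "s \<in> S" "x = fr a s" "b \<in> carrier R" "t \<in> S" "y = fr b t"
      by (elim localization_cases)
    have c: "s \<in> carrier R" "t \<in> carrier R" using * S_carrier by auto
    show "x \<oplus>\<^bsub>Q\<^esub> y \<in> carrier Q" using * c by (simp add: fraction_add fraction_closed mult_mem)
    have "a \<otimes> t \<oplus> b \<otimes> s = b \<otimes> s \<oplus> a \<otimes> t" "s \<otimes> t = t \<otimes> s" using * c by algebra+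
    then show "x \<oplus>\<^bsub>Q\<^esub> y = y \<oplus>\<^bsub>Q\<^esub> x" using * by (simp add: fraction_add)
    fix z assume "z \<in> carrier Q"
    then obtain d w where **: "d \<in> carrier R" "w \<in> S" "z = fr d w" by (elim localization_cases)
    have c': "w \<in> carrier R" using ** S_carrier by auto
    have "(a \<otimes> t \<oplus> b \<otimes> s) \<otimes> w \<oplus> d \<otimes> (s \<otimes> t) = a \<otimes> (t \<otimes> w) \<oplus> (b \<otimes> w \<oplus> d \<otimes> t) \<otimes> s" "s \<otimes> t \<otimes> w = s \<otimes> (t \<otimes> w)"
      using * ** c c' by algebra+
    then show "x \<oplus>\<^bsub>Q\<^esub> y \<oplus>\<^bsub>Q\<^esub> z = x \<oplus>\<^bsub>Q\<^esub> (y \<oplus>\<^bsub>Q\<^esub> z)" using * ** c c' by (simp add: fraction_add mult_mem)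
  next
    show "\<zero>\<^bsub>Q\<^esub> \<in> carrier Q" unfolding localization_zero by (rule fraction_closed) (auto simp: one_mem)
    fix x assume "x \<in> carrier Q"
    then obtain a s where *: "a \<in> carrier R" "s \<in> S" "x = fr a s" by (elim localization_cases)
    have c: "s \<in> carrier R" using * S_carrier by auto
    show "\<zero>\<^bsub>Q\<^esub> \<oplus>\<^bsub>Q\<^esub> x = x" unfolding localization_zero using * c one_mem by (simp add: fraction_add)
    have "fr (\<ominus> a) s \<oplus>\<^bsub>Q\<^esub> x = fr (\<ominus> a \<otimes> s \<oplus> a \<otimes> s) (s \<otimes> s)" using * by (simp add: fraction_add)
    also have "\<dots> = \<zero>\<^bsub>Q\<^esub>" unfolding localization_zero
      by (rule fraction_eqI) (use * c one_mem mult_mem in \<open>auto simp: l_minus l_neg\<close>)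
    finally show "\<exists>y\<in>carrier Q. y \<oplus>\<^bsub>Q\<^esub> x = \<zero>\<^bsub>Q\<^esub>" using * fraction_closed[of "\<ominus> a" s] by auto
  qed
  show "comm_monoid Q"
  proof (rule comm_monoidI)
    fix x y assume "x \<in> carrier Q" "y \<in> carrier Q"
    then obtain a s b t where *: "a \<in> carrier R" "s \<in> S" "x = fr a s" "b \<in> carrier R" "t \<in> S" "y = fr b t"
      by (elim localization_cases)
    have c: "s \<in> carrier R" "t \<in> carrier R" using * S_carrier by auto
    show "x \<otimes>\<^bsub>Q\<^esub> y \<in> carrier Q" using * c by (simp add: fraction_mult fraction_closed mult_mem)
    show "x \<otimes>\<^bsub>Q\<^esub> y = y \<otimes>\<^bsub>Q\<^esub> x" using * c by (simp add: fraction_mult m_comm)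
    fix z assume "z \<in> carrier Q"
    then obtain d w where **: "d \<in> carrier R" "w \<in> S" "z = fr d w" by (elim localization_cases)
    have c': "w \<in> carrier R" using ** S_carrier by auto
    show "x \<otimes>\<^bsub>Q\<^esub> y \<otimes>\<^bsub>Q\<^esub> z = x \<otimes>\<^bsub>Q\<^esub> (y \<otimes>\<^bsub>Q\<^esub> z)" using * ** c c' by (simp add: fraction_mult mult_mem m_assoc)
  next
    show "\<one>\<^bsub>Q\<^esub> \<in> carrier Q" unfolding localization_one by (rule fraction_closed) (auto simp: one_mem)
    fix x assume "x \<in> carrier Q"
    then obtain a s where *: "a \<in> carrier R" "s \<in> S" "x = fr a s" by (elim localization_cases)
    have c: "s \<in> carrier R" using * S_carrier by auto
    show "\<one>\<^bsub>Q\<^esub> \<otimes>\<^bsub>Q\<^esub> x = x" unfolding localization_one using * c one_mem by (simp add: fraction_mult)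
  qed
  fix x y z assume "x \<in> carrier Q" "y \<in> carrier Q" "z \<in> carrier Q"
  then obtain a s b t d w where *: "a \<in> carrier R" "s \<in> S" "x = fr a s" "b \<in> carrier R" "t \<in> S" "y = fr b t"
    "d \<in> carrier R" "w \<in> S" "z = fr d w"
    by (elim localization_cases)
  have c: "s \<in> carrier R" "t \<in> carrier R" "w \<in> carrier R" using * S_carrier by auto
  have "(x \<oplus>\<^bsub>Q\<^esub> y) \<otimes>\<^bsub>Q\<^esub> z = fr ((a \<otimes> t \<oplus> b \<otimes> s) \<otimes> d) (s \<otimes> t \<otimes> w)"
    using * c by (simp add: fraction_add fraction_mult mult_mem)
  also have "\<dots> = fr ((a \<otimes> d) \<otimes> (t \<otimes> w) \<oplus> (b \<otimes> d) \<otimes> (s \<otimes> w)) ((s \<otimes> w) \<otimes> (t \<otimes> w))"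
  proof (rule fraction_eqI)
    show "((a \<otimes> t \<oplus> b \<otimes> s) \<otimes> d) \<otimes> ((s \<otimes> w) \<otimes> (t \<otimes> w))
      = ((a \<otimes> d) \<otimes> (t \<otimes> w) \<oplus> (b \<otimes> d) \<otimes> (s \<otimes> w)) \<otimes> (s \<otimes> t \<otimes> w)" using * c by algebra
  qed (use * c mult_mem in auto)
  also have "\<dots> = x \<otimes>\<^bsub>Q\<^esub> z \<oplus>\<^bsub>Q\<^esub> y \<otimes>\<^bsub>Q\<^esub> z"
    using * c by (simp add: fraction_add fraction_mult mult_mem)
  finally show "(x \<oplus>\<^bsub>Q\<^esub> y) \<otimes>\<^bsub>Q\<^esub> z = x \<otimes>\<^bsub>Q\<^esub> z \<oplus>\<^bsub>Q\<^esub> y \<otimes>\<^bsub>Q\<^esub> z" .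
qed

lemma localize_hom: "ring_hom_cring R Q (localize R S)"
proof -
  interpret Q: cring Q by (rule localization_cring)
  have "localize R S \<in> ring_hom R Q"
    unfolding localize_def
    by (rule ring_hom_memI) (auto simp: fraction_closed one_mem fraction_mult fraction_add localization_one)
  then show ?thesis
    by (intro ring_hom_cring.intro ring_hom_cring_axioms.intro is_cring localization_cring)
qed

lemma localize_Units:
  assumes "s \<in> S"
  shows "localize R S s \<in> Units Q"
proof -
  interpret Q: cring Q by (rule localization_cring)
  have sc: "s \<in> carrier R" using assms S_carrier by auto
  have "fr s \<one> \<otimes>\<^bsub>Q\<^esub> fr \<one> s = fr s s" using assms sc one_mem by (simp add: fraction_mult)
  also have "\<dots> = \<one>\<^bsub>Q\<^esub>" unfolding localization_one by (rule fraction_eqI) (use assms sc one_mem in auto)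
  finally have "fr s \<one> \<otimes>\<^bsub>Q\<^esub> fr \<one> s = \<one>\<^bsub>Q\<^esub>" .
  then have "fr s \<one> \<in> Units Q"
    using fraction_closed[OF sc one_mem] fraction_closed[OF one_closed assms] Q.m_comm
    unfolding Units_def by force
  then show ?thesis unfolding localize_def .
qed

end

context semihereditary_cring
begin

section \<open>Invertibility of faithful finitely generated ideals\<close>

lemma multiplicative_regular: "multiplicative_subset R (regular_elements R)"
  by (intro multiplicative_subset.intro is_cring multiplicative_subset_axioms.intro)
    (auto simp: regular_elementsD one_regular regular_elements_mult)

text \<open>A faithful finitely generated ideal contains a regular element \<open>d\<close>. With it
  each homomorphism \<open>f\<close> from the ideal to \<open>R\<close> becomes multiplication by
  the fraction \<open>f d / d\<close>, so the dual basis writes one as an element of the product of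
  the ideal and its inverse.\<close>

lemma faithful_fg_invertible:
  assumes B: "finite B" "B \<subseteq> carrier R" "support \<one> B"
  shows "invertible_ideal R (Idl B)"
proof -
  interpret M: multiplicative_subset R "regular_elements R" by (rule multiplicative_regular)
  interpret Q: cring M.Q by (rule M.localization_cring)
  let ?loc = "localize R (regular_elements R)"
  interpret h: ring_hom_cring R M.Q ?loc by (rule M.localize_hom)
  define I where "I = Idl B"
  have I: "ideal I R" unfolding I_def by (rule genideal_ideal) fact
  note Ic = ideal_closed[OF I]
  obtain d where d: "d \<in> I" "support \<one> {d}" using ideal_max_support[OF B] unfolding I_def by blast
  have dc: "d \<in> carrier R" using Ic d by auto
  have dreg: "d \<in> regular_elements R" using support_regular[OF d(2) dc] dc by (simp add: a_minus_def r_neg)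
  \<comment> \<open>The inverse of \<open>I\<close>, namely all fractions that multiply
    \<open>I\<close> into \<open>R\<close>. They are written with the common denominator
    \<open>d\<close>, which is possible because \<open>d\<close> lies in \<open>I\<close>.\<close>
  define K where "K = {M.fr b d | b. b \<in> carrier R \<and> (\<forall>a\<in>I. \<exists>r\<in>carrier R. a \<otimes> b = r \<otimes> d)}"
  have K0: "M.fr \<zero> d \<in> K"
    unfolding K_def using dc Ic(5) by (auto intro!: exI[of _ "\<zero>"] bexI[of _ "\<zero>"])
  have KQ: "K \<subseteq> carrier M.Q" unfolding K_def using M.fraction_closed dreg by auto
  have loc_mult: "?loc a \<otimes>\<^bsub>M.Q\<^esub> M.fr b d = M.fr (a \<otimes> b) d" if "a \<in> carrier R" "b \<in> carrier R" for a b
    unfolding localize_def using that dreg dc M.one_mem by (simp add: M.fraction_mult)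
  have cancel: "M.fr (r \<otimes> d) d = ?loc r" if "r \<in> carrier R" for r
    unfolding localize_def by (rule M.fraction_eqI) (use that dreg dc M.one_mem in auto)
  have K_smult: "?loc r \<otimes>\<^bsub>M.Q\<^esub> x \<in> K" if r: "r \<in> carrier R" and x: "x \<in> K" for r x
  proof -
    obtain b where b: "b \<in> carrier R" "\<forall>a\<in>I. \<exists>r\<in>carrier R. a \<otimes> b = r \<otimes> d" "x = M.fr b d"
      using x unfolding K_def by auto
    have "\<exists>s\<in>carrier R. a \<otimes> (r \<otimes> b) = s \<otimes> d" if a: "a \<in> I" for a
    proof -
      obtain s where "s \<in> carrier R" "a \<otimes> b = s \<otimes> d" using b a by auto
      then have "a \<otimes> (r \<otimes> b) = (r \<otimes> s) \<otimes> d" using m_lcomm[OF Ic(5)[OF a] r b(1)] r dc by (simp add: m_assoc)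
      then show ?thesis using r \<open>s \<in> carrier R\<close> by auto
    qed
    then show ?thesis unfolding b(3) loc_mult[OF r b(1)] K_def using r b(1) by auto
  qed
  have frac: "fractional_ideal R K" unfolding fractional_ideal_def
  proof (intro conjI ballI)
    show "additive_subgroup K M.Q"
    proof (rule additive_subgroup.intro, rule Q.add.subgroupI)
      show "K \<noteq> {}" using K0 by auto
      fix x assume x: "x \<in> K"
      have "?loc (\<ominus> \<one>) \<otimes>\<^bsub>M.Q\<^esub> x = \<ominus>\<^bsub>M.Q\<^esub> x" using x KQ by (simp add: Q.l_minus subset_iff)
      then show "\<ominus>\<^bsub>M.Q\<^esub> x \<in> K" using K_smult[of "\<ominus> \<one>" x] x by simp
      fix y assume "y \<in> K"
      then obtain b c where b: "b \<in> carrier R" "\<forall>a\<in>I. \<exists>r\<in>carrier R. a \<otimes> b = r \<otimes> d" "x = M.fr b d"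
        and c: "c \<in> carrier R" "\<forall>a\<in>I. \<exists>r\<in>carrier R. a \<otimes> c = r \<otimes> d" "y = M.fr c d"
        using x unfolding K_def by auto
      have "x \<oplus>\<^bsub>M.Q\<^esub> y = M.fr (b \<otimes> d \<oplus> c \<otimes> d) (d \<otimes> d)" unfolding b c using dreg b c by (simp add: M.fraction_add)
      also have "\<dots> = M.fr (b \<oplus> c) d"
        by (rule M.fraction_eqI) (use b c dc dreg M.mult_mem in \<open>auto simp: l_distr m_assoc\<close>)
      also have "\<dots> \<in> K"
      proof -
        have "\<exists>r\<in>carrier R. a \<otimes> (b \<oplus> c) = r \<otimes> d" if a: "a \<in> I" for a
        proof -
          obtain r s where "r \<in> carrier R" "a \<otimes> b = r \<otimes> d" "s \<in> carrier R" "a \<otimes> c = s \<otimes> d" using b(2) c(2) a by meson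
          then show ?thesis using Ic(5)[OF a] b(1) c(1) dc by (intro bexI[of _ "r \<oplus> s"]) (auto simp: r_distr l_distr)
        qed
        then show ?thesis unfolding K_def using b c by auto
      qed
      finally show "x \<oplus>\<^bsub>M.Q\<^esub> y \<in> K" .
    qed (use KQ in auto)
    show "?loc r \<otimes>\<^bsub>M.Q\<^esub> x \<in> K" if "r \<in> carrier R" "x \<in> K" for r x by (rule K_smult[OF that])
    show "\<exists>d\<in>regular_elements R. \<forall>x\<in>K. ?loc d \<otimes>\<^bsub>M.Q\<^esub> x \<in> ?loc ` carrier R"
    proof (intro bexI[OF _ dreg] ballI)
      fix x assume "x \<in> K"
      then obtain b where b: "b \<in> carrier R" "x = M.fr b d" unfolding K_def by auto
      have "?loc d \<otimes>\<^bsub>M.Q\<^esub> x = ?loc b" using loc_mult[OF dc b(1)] cancel[OF b(1)] m_comm[OF dc b(1)] b(2) by simp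
      then show "?loc d \<otimes>\<^bsub>M.Q\<^esub> x \<in> ?loc ` carrier R" using b by auto
    qed
  qed
  let ?P = "(?loc ` I) \<cdot>\<^bsub>M.Q\<^esub> K"
  have "?P \<subseteq> ?loc ` carrier R"
  proof
    fix y assume "y \<in> ?P"
    then show "y \<in> ?loc ` carrier R"
    proof (induction rule: ideal_prod.induct)
      case (prod i j)
      then obtain a b where *: "a \<in> I" "i = ?loc a" "b \<in> carrier R" "j = M.fr b d" "\<exists>r\<in>carrier R. a \<otimes> b = r \<otimes> d"
        unfolding K_def by auto
      then obtain r where r: "r \<in> carrier R" "a \<otimes> b = r \<otimes> d" by auto
      have "i \<otimes>\<^bsub>M.Q\<^esub> j = ?loc r" unfolding * using loc_mult[OF Ic(5)[OF *(1)] *(3)] r cancel by simp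
      then show ?case using r by auto
    next
      case (sum x y)
      then obtain r s where rs: "r \<in> carrier R" "x = ?loc r" "s \<in> carrier R" "y = ?loc s" by auto
      then have "x \<oplus>\<^bsub>M.Q\<^esub> y = ?loc (r \<oplus> s)" by simp
      then show ?case using rs(1,3) by (rule image_eqI[OF _ a_closed])
    qed
  qed
  moreover have "?loc ` carrier R \<subseteq> ?P"
  proof -
    have PQ: "y \<in> carrier M.Q" if "y \<in> ?P" for y
      using that by (induction rule: ideal_prod.induct) (use KQ Ic(5) in auto)
    have P_smult: "?loc r \<otimes>\<^bsub>M.Q\<^esub> y \<in> ?P" if y: "y \<in> ?P" and r: "r \<in> carrier R" for r y
      using y
    proof (induction rule: ideal_prod.induct)
      case (prod i j)
      then obtain a where a: "a \<in> I" "i = ?loc a" by auto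
      have "?loc r \<otimes>\<^bsub>M.Q\<^esub> (i \<otimes>\<^bsub>M.Q\<^esub> j) = ?loc (r \<otimes> a) \<otimes>\<^bsub>M.Q\<^esub> j"
        using a r prod KQ Ic(5)[OF a(1)] by (simp add: Q.m_assoc subset_iff)
      then show ?case using Ic(3)[OF a(1) r] prod by (auto intro: ideal_prod.prod)
    next
      case (sum x y)
      then show ?case using r PQ by (simp add: Q.r_distr ideal_prod.sum)
    qed
    have "ideal {r \<in> carrier R. ?loc r \<in> ?P} R"
    proof (rule idealI')
      have "?loc \<zero> \<otimes>\<^bsub>M.Q\<^esub> M.fr \<zero> d \<in> ?P" by (rule ideal_prod.prod[OF imageI[OF Ic(1)] K0])
      moreover have "?loc \<zero> \<otimes>\<^bsub>M.Q\<^esub> M.fr \<zero> d = ?loc \<zero>" using M.fraction_closed[OF zero_closed dreg] by simp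
      ultimately show "\<zero> \<in> {r \<in> carrier R. ?loc r \<in> ?P}" by simp
      fix a assume a: "a \<in> {r \<in> carrier R. ?loc r \<in> ?P}"
      show "r \<otimes> a \<in> {r \<in> carrier R. ?loc r \<in> ?P}" if "r \<in> carrier R" for r
        using P_smult[of "?loc a" r] a that by simp
      show "a \<oplus> b \<in> {r \<in> carrier R. ?loc r \<in> ?P}" if "b \<in> {r \<in> carrier R. ?loc r \<in> ?P}" for b
        using ideal_prod.sum[of "?loc a" M.Q _ _ "?loc b"] a that by simp
    qed auto
    moreover have "{f a | f a. f \<in> ideal_dual I \<and> a \<in> I} \<subseteq> {r \<in> carrier R. ?loc r \<in> ?P}"
    proof
      fix z assume "z \<in> {f a | f a. f \<in> ideal_dual I \<and> a \<in> I}"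
      then obtain f a where z: "z = f a" "f \<in> ideal_dual I" "a \<in> I" by auto
      note fd = ideal_dualD[OF z(2)]
      have comm: "b \<otimes> f d = f b \<otimes> d" if b: "b \<in> I" for b
      proof -
        have "b \<otimes> f d = f (b \<otimes> d)" using fd(3)[OF d(1) Ic(5)[OF b]] by simp
        also have "\<dots> = f (d \<otimes> b)" using m_comm[OF dc Ic(5)[OF b]] by simp
        also have "\<dots> = d \<otimes> f b" by (rule fd(3)[OF b dc])
        finally show ?thesis using m_comm[OF dc fd(1)[OF b]] by simp
      qed
      \<comment> \<open>This fraction is \<open>f\<close> viewed as a multiplier; its product with
        \<open>a\<close> is \<open>f a\<close>.\<close>
      have "M.fr (f d) d \<in> K" unfolding K_def using fd(1)[OF d(1)] comm fd(1) by auto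
      then have "?loc a \<otimes>\<^bsub>M.Q\<^esub> M.fr (f d) d \<in> ?P" using z by (intro ideal_prod.prod) auto
      moreover have "?loc a \<otimes>\<^bsub>M.Q\<^esub> M.fr (f d) d = ?loc (f a)"
        using loc_mult[OF Ic(5)[OF z(3)] fd(1)[OF d(1)]] comm[OF z(3)] cancel fd(1)[OF z(3)] by simp
      ultimately show "z \<in> {r \<in> carrier R. ?loc r \<in> ?P}" using z fd(1) by auto
    qed
    ultimately have "Idl {f a | f a. f \<in> ideal_dual I \<and> a \<in> I} \<subseteq> {r \<in> carrier R. ?loc r \<in> ?P}"
      by (rule Idl_subsetI)
    then have one: "?loc \<one> \<in> ?P" using support_mem_trace[OF B(1,3,2)] unfolding I_def by auto
    show ?thesis
    proof
      fix y assume "y \<in> ?loc ` carrier R"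
      then obtain r where r: "r \<in> carrier R" "y = ?loc r" by auto
      then show "y \<in> ?P" using P_smult[OF one r(1)] by simp
    qed
  qed
  ultimately have "?P = ?loc ` carrier R" by (rule subset_antisym)
  then show ?thesis using frac I unfolding invertible_ideal_def I_def by blast
qed

end

section \<open>Bilinear polynomials over local-global rings\<close>

context cring
begin

text \<open>Polynomials form an inductively generated set, so a monomial has to be built up by one
  indeterminate at a time before polynomials with prescribed coefficients become available.\<close>

lemma indexed_monomial_mem:
  assumes "c \<in> carrier R" "set_mset m0 \<subseteq> V"
  shows "(\<lambda>m. if m = m0 then c else \<zero>) \<in> indexed_pset V (carrier R)"
  using assms(2)
proof (induction m0)
  case empty
  show ?case using indexed_pset.indexed_const[OF assms(1), of V] unfolding indexed_const_def by simp
next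
  case (add i m0)
  have "indexed_pmult (\<lambda>m. if m = m0 then c else \<zero>) i \<in> indexed_pset V (carrier R)"
    using add by (intro indexed_pset.indexed_pmult) auto
  moreover have "indexed_pmult (\<lambda>m. if m = m0 then c else \<zero>) i = (\<lambda>m. if m = add_mset i m0 then c else \<zero>)"
    unfolding indexed_pmult_def by (auto intro!: ext dest!: multi_member_split)
  ultimately show ?case by simp
qed

lemma indexed_poly_mem:
  assumes "finite W" "\<And>m. m \<in> W \<Longrightarrow> set_mset m \<subseteq> V" "\<And>m. m \<in> W \<Longrightarrow> g m \<in> carrier R"
  shows "(\<lambda>m. if m \<in> W then g m else \<zero>) \<in> indexed_pset V (carrier R)"
  using assms
proof (induction W rule: finite_induct)
  case empty
  show ?case using indexed_pset.indexed_const[OF zero_closed, of V] unfolding indexed_const_def by simp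
next
  case (insert m0 W)
  have "indexed_padd (\<lambda>m. if m = m0 then g m0 else \<zero>) (\<lambda>m. if m \<in> W then g m else \<zero>) \<in> indexed_pset V (carrier R)"
    using insert by (intro indexed_pset.indexed_padd indexed_monomial_mem) auto
  moreover have "indexed_padd (\<lambda>m. if m = m0 then g m0 else \<zero>) (\<lambda>m. if m \<in> W then g m else \<zero>)
      = (\<lambda>m. if m \<in> insert m0 W then g m else \<zero>)"
    unfolding indexed_padd_def using insert by (auto intro!: ext)
  ultimately show ?case by simp
qed

text \<open>The multiset is the monomial of the \<open>i\<close>-th indeterminate of a first block
  and the \<open>j\<close>-th of a second. The shift by \<open>N\<close> keeps the blocks apart, so
  the unordered pair determines the ordered one.\<close>

lemma inj_on_pair_mset:
  fixes N q :: nat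
  shows "inj_on (\<lambda>(i, j). {#i, N + j#}) ({..<N} \<times> {..<q})"
proof (rule inj_onI, clarify)
  fix i j i' j' assume "i < N" "i' < N" "{#i, N + j#} = {#i', N + j'#}"
  then show "i = i' \<and> j = j'" by (auto simp: add_eq_conv_ex)
qed

text \<open>The polynomial is described by its coefficients and not by an explicit term, so that the
  formula also applies to its image in a localization.\<close>

lemma bilinear_peval:
  fixes N q :: nat and f :: "nat multiset \<Rightarrow> 'a"
  defines "D \<equiv> {..<N} \<times> {..<q}" and "\<iota> \<equiv> \<lambda>(i, j). {#i, N + j#}"
  assumes f: "f {#} = e" "\<And>p. p \<in> D \<Longrightarrow> f (\<iota> p) = a p" "\<And>m. m \<notin> insert {#} (\<iota> ` D) \<Longrightarrow> f m = \<zero>"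
    and e: "e \<in> carrier R" and a: "\<And>p. p \<in> D \<Longrightarrow> a p \<in> carrier R" and x: "x \<in> {..<N + q} \<rightarrow> carrier R"
  shows "indexed_peval R f x = e \<oplus> (\<Oplus>p\<in>D. a p \<otimes> (x (fst p) \<otimes> x (N + snd p)))"
proof -
  define t where "t m = f m \<otimes> (\<Otimes>i\<in>set_mset m. x i [^] count m i)" for m
  have inj: "inj_on \<iota> D" unfolding \<iota>_def D_def by (rule inj_on_pair_mset)
  have fin: "finite D" unfolding D_def by simp
  have xc: "x (fst p) \<in> carrier R" "x (N + snd p) \<in> carrier R" if "p \<in> D" for p
    using that x unfolding D_def by auto
  have t\<iota>: "t (\<iota> p) = a p \<otimes> (x (fst p) \<otimes> x (N + snd p))" if p: "p \<in> D" for p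
  proof -
    obtain i j where ij: "p = (i, j)" by (cases p)
    have ne: "i \<noteq> N + j" using p unfolding D_def ij by auto
    have "(\<Otimes>k\<in>{i, N + j}. x k [^] count {#i, N + j#} k) = x i \<otimes> x (N + j)"
      using xc[OF p] ne unfolding ij by simp
    then show ?thesis unfolding t_def f(2)[OF p] unfolding \<iota>_def ij by simp
  qed
  have t0: "t {#} = e" unfolding t_def f(1) using e by simp
  have tc: "t m \<in> carrier R" if "m \<in> insert {#} (\<iota> ` D)" for m
    using that t0 e t\<iota> a xc by auto
  have "indexed_peval R f x = (\<Oplus>m\<in>{m. f m \<noteq> \<zero>}. t m)" unfolding indexed_peval_def t_def ..
  \<comment> \<open>\<open>indexed_peval\<close> sums over the monomials with nonzero coefficient
    only, and some of the prescribed coefficients may be zero, for instance after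
    localization.\<close>
  also have "\<dots> = (\<Oplus>m\<in>insert {#} (\<iota> ` D). t m)"
  proof (rule add.finprod_mono_neutral_cong_left)
    show "{m. f m \<noteq> \<zero>} \<subseteq> insert {#} (\<iota> ` D)" using f(3) by auto
    fix m assume m: "m \<in> insert {#} (\<iota> ` D) - {m. f m \<noteq> \<zero>}"
    have "set_mset m \<subseteq> {..<N + q}" using m unfolding \<iota>_def D_def by auto
    then have "(\<Otimes>i\<in>set_mset m. x i [^] count m i) \<in> carrier R" using x by (intro finprod_closed) auto
    then show "t m = \<zero>" unfolding t_def using m by simp
  qed (use fin tc in auto)
  also have "\<dots> = t {#} \<oplus> (\<Oplus>m\<in>\<iota> ` D. t m)"
    using fin tc by (intro finsum_insert) (auto simp: \<iota>_def)
  also have "(\<Oplus>m\<in>\<iota> ` D. t m) = (\<Oplus>p\<in>D. t (\<iota> p))"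
    using tc inj by (intro finsum_reindex) auto
  also have "\<dots> = (\<Oplus>p\<in>D. a p \<otimes> (x (fst p) \<otimes> x (N + snd p)))"
    using t\<iota> a xc by (intro finsum_cong') auto
  finally show ?thesis unfolding t0 .
qed

lemma finsum_Times:
  fixes N q :: nat
  assumes "\<And>i j. i < N \<Longrightarrow> j < q \<Longrightarrow> g (i, j) \<in> carrier R"
  shows "(\<Oplus>p\<in>{..<N} \<times> {..<q}. g p) = (\<Oplus>i\<in>{..<N}. \<Oplus>j\<in>{..<q}. g (i, j))"
proof -
  have "{..<N} \<times> {..<q} = (\<Union>i\<in>{..<N}. Pair i ` {..<q})" by auto
  then have "(\<Oplus>p\<in>{..<N} \<times> {..<q}. g p) = (\<Oplus>p\<in>(\<Union>i\<in>{..<N}. Pair i ` {..<q}). g p)" by simp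
  also have "\<dots> = (\<Oplus>i\<in>{..<N}. \<Oplus>p\<in>Pair i ` {..<q}. g p)"
    by (rule add.finprod_UN_disjoint) (use assms in \<open>auto simp: pairwise_def disjnt_def\<close>)
  also have "\<dots> = (\<Oplus>i\<in>{..<N}. \<Oplus>j\<in>{..<q}. g (i, j))"
    using assms by (intro finsum_cong' finsum_reindex) (auto simp: inj_on_def intro!: finsum_closed)
  finally show ?thesis .
qed

text \<open>The polynomial is \<open>e\<close> plus the sum of the \<open>a i j\<close> times the
  \<open>i\<close>-th indeterminate of one block and the \<open>j\<close>-th of another. At
  \<open>P\<close> it has a unit value for one of two reasons: if \<open>e\<close> is outside
  \<open>P\<close>, the value at zero is a unit; otherwise some \<open>a i j\<close> is outside
  \<open>P\<close> and can be switched on alone.\<close>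

lemma local_global_bilinear:
  fixes N q :: nat
  assumes lg: "local_global R" and a: "\<And>i j. i < N \<Longrightarrow> j < q \<Longrightarrow> a i j \<in> carrier R" and e: "e \<in> carrier R"
    and loc: "\<And>P. maximalideal P R \<Longrightarrow> e \<in> P \<Longrightarrow> \<exists>i<N. \<exists>j<q. a i j \<notin> P"
  obtains x y where "x \<in> {..<N} \<rightarrow> carrier R" "y \<in> {..<q} \<rightarrow> carrier R"
    "(\<Oplus>i\<in>{..<N}. x i \<otimes> (\<Oplus>j\<in>{..<q}. y j \<otimes> a i j)) \<oplus> e \<in> Units R"
proof -
  define D where "D = {..<N} \<times> {..<q}"
  define \<iota> where "\<iota> = (\<lambda>(i, j). {#i, N + j#})"
  define b where "b p = a (fst p) (snd p)" for p
  have inj: "inj_on \<iota> D" unfolding \<iota>_def D_def by (rule inj_on_pair_mset)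
  define g where "g m = (if m = {#} then e else b (inv_into D \<iota> m))" for m
  define f where "f = (\<lambda>m. if m \<in> insert {#} (\<iota> ` D) then g m else \<zero>)"
  have bc: "b p \<in> carrier R" if "p \<in> D" for p using that a unfolding b_def D_def by auto
  have \<iota>ne: "\<iota> p \<noteq> {#}" for p unfolding \<iota>_def by (cases p) auto
  have f\<iota>: "f (\<iota> p) = b p" if "p \<in> D" for p
    unfolding f_def g_def using that \<iota>ne inj by simp
  have f0: "f {#} = e" unfolding f_def g_def by simp
  have fz: "f m = \<zero>" if "m \<notin> insert {#} (\<iota> ` D)" for m unfolding f_def using that by auto
  have "f \<in> indexed_pset {..<N + q} (carrier R)" unfolding f_def
  proof (rule indexed_poly_mem)
    show "finite (insert {#} (\<iota> ` D))" unfolding D_def by simp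
    show "set_mset m \<subseteq> {..<N + q}" if "m \<in> insert {#} (\<iota> ` D)" for m
      using that unfolding \<iota>_def D_def by auto
    show "g m \<in> carrier R" if "m \<in> insert {#} (\<iota> ` D)" for m
      using that f\<iota> f0 bc e unfolding f_def by (auto split: if_splits)
  qed
  moreover have "admits_unit_values (localization R (carrier R - P)) (N + q) (\<lambda>m. localize R (carrier R - P) (f m))"
    if P: "maximalideal P R" for P
  proof -
    interpret P: maximalideal P R by (rule P)
    interpret P': primeideal P R by (rule maximalideal_prime[OF P])
    interpret M: multiplicative_subset R "carrier R - P"
    proof (intro multiplicative_subset.intro is_cring multiplicative_subset_axioms.intro)
      show "\<one> \<in> carrier R - P" using P.one_imp_carrier P.I_notcarr by auto
      show "s \<otimes> t \<in> carrier R - P" if "s \<in> carrier R - P" "t \<in> carrier R - P" for s t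
        using that P'.I_prime by auto
    qed auto
    interpret Q: cring M.Q by (rule M.localization_cring)
    let ?loc = "localize R (carrier R - P)"
    interpret h: ring_hom_cring R M.Q ?loc by (rule M.localize_hom)
    have ev: "indexed_peval M.Q (\<lambda>m. ?loc (f m)) x
        = ?loc e \<oplus>\<^bsub>M.Q\<^esub> (\<Oplus>\<^bsub>M.Q\<^esub>p\<in>D. ?loc (b p) \<otimes>\<^bsub>M.Q\<^esub> (x (fst p) \<otimes>\<^bsub>M.Q\<^esub> x (N + snd p)))"
      if "x \<in> {..<N + q} \<rightarrow> carrier M.Q" for x
      unfolding D_def
      by (rule Q.bilinear_peval)
        (use f0 f\<iota> fz e bc that in \<open>auto simp: D_def \<iota>_def\<close>)
    show ?thesis
    proof (cases "e \<in> P")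
      case False
      have "?loc e \<in> Units M.Q" using False e by (intro M.localize_Units) auto
      moreover have "indexed_peval M.Q (\<lambda>m. ?loc (f m)) (\<lambda>_. \<zero>\<^bsub>M.Q\<^esub>) = ?loc e"
      proof -
        have "(\<Oplus>\<^bsub>M.Q\<^esub>p\<in>D. ?loc (b p) \<otimes>\<^bsub>M.Q\<^esub> (\<zero>\<^bsub>M.Q\<^esub> \<otimes>\<^bsub>M.Q\<^esub> \<zero>\<^bsub>M.Q\<^esub>)) = \<zero>\<^bsub>M.Q\<^esub>"
          by (rule Q.add.finprod_one_eqI) (use bc in simp)
        then show ?thesis using ev[of "\<lambda>_. \<zero>\<^bsub>M.Q\<^esub>"] e by simp
      qed
      ultimately show ?thesis unfolding admits_unit_values_def by (intro bexI[of _ "\<lambda>_. \<zero>\<^bsub>M.Q\<^esub>"]) auto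
    next
      case True
      then obtain i j where ij: "i < N" "j < q" "a i j \<notin> P" using loc[OF P] by auto
      \<comment> \<open>Only the indeterminates \<open>i\<close> and \<open>N + j\<close> are set to
        one, so a single bilinear term survives. The value \<open>e \<oplus> a i j\<close> is
        outside \<open>P\<close>, because \<open>e\<close> is inside and \<open>a i j\<close> is
        not.\<close>
      define x where "x k = (if k = i \<or> k = N + j then \<one>\<^bsub>M.Q\<^esub> else \<zero>\<^bsub>M.Q\<^esub>)" for k
      have p0: "(i, j) \<in> D" unfolding D_def using ij by simp
      have "(\<Oplus>\<^bsub>M.Q\<^esub>p\<in>D. ?loc (b p) \<otimes>\<^bsub>M.Q\<^esub> (x (fst p) \<otimes>\<^bsub>M.Q\<^esub> x (N + snd p)))
          = (\<Oplus>\<^bsub>M.Q\<^esub>p\<in>D. if (i, j) = p then ?loc (b p) else \<zero>\<^bsub>M.Q\<^esub>)"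
      proof (rule Q.finsum_cong')
        fix p assume p: "p \<in> D"
        then show "?loc (b p) \<otimes>\<^bsub>M.Q\<^esub> (x (fst p) \<otimes>\<^bsub>M.Q\<^esub> x (N + snd p)) = (if (i, j) = p then ?loc (b p) else \<zero>\<^bsub>M.Q\<^esub>)"
          using bc[OF p] ij unfolding x_def D_def by (cases p) auto
      qed (use bc in auto)
      also have "\<dots> = ?loc (b (i, j))"
        by (rule Q.add.finprod_singleton[OF p0]) (use bc in \<open>auto simp: D_def\<close>)
      finally have "indexed_peval M.Q (\<lambda>m. ?loc (f m)) x = ?loc e \<oplus>\<^bsub>M.Q\<^esub> ?loc (b (i, j))"
        using ev[of x] unfolding x_def by simp
      also have "\<dots> = ?loc (e \<oplus> b (i, j))" using e bc[OF p0] by simp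
      finally have val: "indexed_peval M.Q (\<lambda>m. ?loc (f m)) x = ?loc (e \<oplus> b (i, j))" .
      have "e \<oplus> b (i, j) \<notin> P"
      proof
        assume "e \<oplus> b (i, j) \<in> P"
        then have "\<ominus> e \<oplus> (e \<oplus> b (i, j)) \<in> P" using True P.a_closed P.a_inv_closed by blast
        moreover have "\<ominus> e \<oplus> (e \<oplus> b (i, j)) = b (i, j)" using e bc[OF p0] by (simp add: a_assoc[symmetric] l_neg)
        ultimately show False using ij unfolding b_def by simp
      qed
      then have "?loc (e \<oplus> b (i, j)) \<in> Units M.Q" using e bc[OF p0] by (intro M.localize_Units) auto
      then show ?thesis unfolding admits_unit_values_def using val by (intro bexI[of _ x]) (auto simp: x_def)
    qed
  qed
  ultimately have "admits_unit_values R (N + q) f" using lg unfolding local_global_def by blast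
  then obtain z where z: "z \<in> {..<N + q} \<rightarrow> carrier R" "indexed_peval R f z \<in> Units R"
    unfolding admits_unit_values_def by auto
  have zc: "z i \<in> carrier R" if "i < N + q" for i using z that by auto
  have "indexed_peval R f z = e \<oplus> (\<Oplus>p\<in>D. b p \<otimes> (z (fst p) \<otimes> z (N + snd p)))"
    unfolding D_def
    by (rule bilinear_peval) (use f0 f\<iota> fz e bc z in \<open>auto simp: D_def \<iota>_def\<close>)
  also have "(\<Oplus>p\<in>D. b p \<otimes> (z (fst p) \<otimes> z (N + snd p))) = (\<Oplus>i\<in>{..<N}. \<Oplus>j\<in>{..<q}. a i j \<otimes> (z i \<otimes> z (N + j)))"
    unfolding D_def using finsum_Times[of N q "\<lambda>p. b p \<otimes> (z (fst p) \<otimes> z (N + snd p))"] a zc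
    by (simp add: b_def)
  also have "\<dots> = (\<Oplus>i\<in>{..<N}. z i \<otimes> (\<Oplus>j\<in>{..<q}. z (N + j) \<otimes> a i j))"
  proof (rule finsum_cong')
    fix i assume i: "i \<in> {..<N}"
    have "(\<Oplus>j\<in>{..<q}. a i j \<otimes> (z i \<otimes> z (N + j))) = (\<Oplus>j\<in>{..<q}. z i \<otimes> (z (N + j) \<otimes> a i j))"
    proof (rule finsum_cong')
      fix j assume "j \<in> {..<q}"
      then have "a i j \<in> carrier R" "z i \<in> carrier R" "z (N + j) \<in> carrier R" using a zc i by auto
      then show "a i j \<otimes> (z i \<otimes> z (N + j)) = z i \<otimes> (z (N + j) \<otimes> a i j)" by algebra
    qed (use a zc i in auto)
    also have "\<dots> = z i \<otimes> (\<Oplus>j\<in>{..<q}. z (N + j) \<otimes> a i j)"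
      using a zc i by (intro finsum_rdistr[symmetric]) auto
    finally show "(\<Oplus>j\<in>{..<q}. a i j \<otimes> (z i \<otimes> z (N + j))) = z i \<otimes> (\<Oplus>j\<in>{..<q}. z (N + j) \<otimes> a i j)" .
  qed (use a zc in \<open>auto intro!: m_closed finsum_closed\<close>)
  finally have eq: "indexed_peval R f z = e \<oplus> (\<Oplus>i\<in>{..<N}. z i \<otimes> (\<Oplus>j\<in>{..<q}. z (N + j) \<otimes> a i j))" .
  have "(\<Oplus>i\<in>{..<N}. z i \<otimes> (\<Oplus>j\<in>{..<q}. z (N + j) \<otimes> a i j)) \<in> carrier R"
    using a zc by (intro finsum_closed funcsetI m_closed) auto
  then have "(\<Oplus>i\<in>{..<N}. z i \<otimes> (\<Oplus>j\<in>{..<q}. z (N + j) \<otimes> a i j)) \<oplus> e \<in> Units R"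
    using z(2) e a_comm unfolding eq by simp
  then show ?thesis using that[of z "\<lambda>j. z (N + j)"] zc by auto
qed

end

section \<open>Splitting off a rank-one summand\<close>

context cring
begin

lemma ideal_minus:
  assumes "ideal I R" "a \<in> I" "b \<in> I"
  shows "a \<ominus> b \<in> I"
proof -
  note c = ideal_closed[OF assms(1)]
  have "a \<oplus> (\<ominus> \<one>) \<otimes> b \<in> I" using assms by (intro c(2,3)) auto
  then show ?thesis using c(5)[OF assms(3)] by (simp add: l_minus a_minus_def)
qed

lemma submodule_finsum:
  assumes K: "submodule K R (free_module R U)" and "finite J" "\<And>j. j \<in> J \<Longrightarrow> c j \<in> carrier R" "\<And>j. j \<in> J \<Longrightarrow> w j \<in> K"
  shows "(\<lambda>i. \<Oplus>j\<in>J. c j \<otimes> w j i) \<in> K"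
  using assms(2-4)
proof (induction J rule: finite_induct)
  case empty then show ?case using submodule_vecD(2)[OF K] by simp
next
  case (insert j J)
  have wc: "w k i \<in> carrier R" if "k \<in> insert j J" for k i using insert.prems(2)[OF that] submodule_vecD(1)[OF K] vecD(1) by metis
  have "(\<lambda>i. c j \<otimes> w j i \<oplus> (\<Oplus>j\<in>J. c j \<otimes> w j i)) \<in> K"
    using insert by (intro submodule_vecD(3,4)[OF K]) auto
  moreover have "(\<Oplus>j\<in>insert j J. c j \<otimes> w j i) = c j \<otimes> w j i \<oplus> (\<Oplus>j\<in>J. c j \<otimes> w j i)" for i
    using insert wc by (intro finsum_insert) auto
  ultimately show ?case by simp
qed

text \<open>Regularity of \<open>d\<close> makes the ideal generated by \<open>d\<close> faithful,
  so the hypothesis on \<open>R\<close> applies to the quotient by it. The value of the bilinear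
  polynomial there is \<open>\<gamma> h \<oplus> e\<close>, where one block of indeterminates gives
  the coefficients of the form and the other those of the vector. The constant \<open>e\<close>
  allows for a content that is the unit ideal only on a direct factor.\<close>

lemma unimodular_combination:
  fixes N :: nat
  assumes alg: "almost_local_global R" and d: "d \<in> regular_elements R"
    and K: "submodule K R (free_module R {..<N})" and e: "e \<in> carrier R"
    and one: "\<one> \<in> Idl (insert e (\<Union>x\<in>K. range x))"
  obtains h \<gamma> v t where "h \<in> K" "\<gamma> \<in> dual {..<N}" "v \<in> carrier R" "t \<in> carrier R"
    "v \<otimes> (\<gamma> h \<oplus> e) \<oplus> d \<otimes> t = \<one>"
proof -
  note Km = submodule_vecD[OF K]
  have dc: "d \<in> carrier R" using regular_elementsD(1)[OF d] .
  define I where "I = PIdl d"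
  interpret I: ideal I R unfolding I_def by (rule cgenideal_ideal[OF dc])
  interpret S: cring "R Quot I" by (rule I.quotient_is_cring[OF is_cring])
  interpret h: ring_hom_cring R "R Quot I" "(+>) I" by (rule I.rcos_ring_hom_cring[OF is_cring])
  have "annihilator R I = {\<zero>}"
  proof -
    have "r = \<zero>" if "r \<in> annihilator R I" for r
    proof -
      have r: "r \<in> carrier R" "r \<otimes> d = \<zero>"
        using that cgenideal_self[OF dc] unfolding annihilator_def I_def by auto
      then show "r = \<zero>" using regular_elementsD(2)[OF d r(1)] m_comm[OF r(1) dc] by simp
    qed
    moreover have "\<zero> \<in> annihilator R I" unfolding annihilator_def using I.Icarr by auto
    ultimately show ?thesis by (intro subset_antisym) blast+
  qed
  then have "faithful_ideal R I" unfolding faithful_ideal_def using I.is_ideal by simp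
  moreover have "principalideal I R" unfolding I_def by (rule cgenideal_is_principalideal[OF dc])
  ultimately have lg: "local_global (R Quot I)" using alg unfolding almost_local_global_def by simp
  have rng: "insert e (\<Union>x\<in>K. range x) \<subseteq> carrier R" using e range_vec[OF Km(1)] by auto
  \<comment> \<open>No finite generating set of \<open>K\<close> is available, but finitely many
    coordinates of its vectors together with \<open>e\<close> already generate the unit ideal. The
    vectors \<open>w j\<close> are those in which these coordinates occur.\<close>
  obtain Y where Y: "finite Y" "Y \<subseteq> insert e (\<Union>x\<in>K. range x)" "\<one> \<in> Idl Y"
    using Idl_finite_subset[OF rng one] by blast
  have "\<exists>C\<subseteq>K \<times> UNIV. finite C \<and> Y - {e} = (\<lambda>(x, i). x i) ` C"
  proof (rule finite_subset_image)
    show "Y - {e} \<subseteq> (\<lambda>(x, i). x i) ` (K \<times> UNIV)"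
    proof
      fix y assume "y \<in> Y - {e}"
      then obtain x i where "x \<in> K" "y = x i" using Y(2) by blast
      then show "y \<in> (\<lambda>(x, i). x i) ` (K \<times> UNIV)" by (intro image_eqI[of _ _ "(x, i)"]) auto
    qed
  qed (use Y(1) in simp)
  then obtain C where C: "C \<subseteq> K \<times> UNIV" "finite C" "Y - {e} = (\<lambda>(x, i). x i) ` C" by metis
  obtain q and w :: "nat \<Rightarrow> nat \<Rightarrow> 'a" where w: "fst ` C = w ` {..<q}"
    using finite_imp_nat_seg_image_inj_on[of "fst ` C"] C(2) by (auto simp: lessThan_def)
  have wK: "w j \<in> K" if "j < q" for j using w C(1) that by (auto simp: set_eq_iff image_iff) force
  have wc: "w j i \<in> carrier R" if "j < q" for i j using vecD(1)[OF Km(1)[OF wK[OF that]]] .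
  \<comment> \<open>A maximal ideal of the quotient containing \<open>e\<close> and all coordinates
    of the \<open>w j\<close> would have a preimage in \<open>R\<close> that contains
    \<open>Y\<close> and hence \<open>\<one>\<close>.\<close>
  have loc: "\<exists>i<N. \<exists>j<q. I +> w j i \<notin> P" if P: "maximalideal P (R Quot I)" "I +> e \<in> P" for P
  proof (rule ccontr)
    assume "\<not> ?thesis"
    then have all: "I +> w j i \<in> P" if "i < N" "j < q" for i j using that by auto
    interpret P: maximalideal P "R Quot I" by (rule P(1))
    have id: "ideal {r \<in> carrier R. I +> r \<in> P} R" by (rule ring_hom_ring.ideal_vimage[OF I.rcos_ring_hom_ring P.is_ideal])
    have "Y \<subseteq> {r \<in> carrier R. I +> r \<in> P}"
    proof
      fix y assume y: "y \<in> Y"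
      show "y \<in> {r \<in> carrier R. I +> r \<in> P}"
      proof (cases "y = e")
        case True then show ?thesis using P(2) e by simp
      next
        case False
        then obtain x i where xi: "(x, i) \<in> C" "y = x i" using C(3) y by (metis (no_types, lifting) DiffI case_prod_conv imageE old.prod.exhaust singletonD)
        then have "x \<in> w ` {..<q}" unfolding w[symmetric] by force
        then obtain j where j: "j < q" "x = w j" by auto
        show ?thesis
        proof (cases "i < N")
          case True then show ?thesis using all[OF True j(1)] wc[OF j(1)] xi j by simp
        next
          case False
          then have "y = \<zero>" using vecD(2)[OF Km(1)[OF wK[OF j(1)]], of i] xi j by simp
          then show ?thesis using ideal_closed(1)[OF id] by simp
        qed
      qed
    qed
    then have "Idl Y \<subseteq> {r \<in> carrier R. I +> r \<in> P}" by (rule Idl_subsetI[OF id])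
    then have "\<one>\<^bsub>R Quot I\<^esub> \<in> P" using Y(3) h.hom_one by auto
    then show False using P.one_imp_carrier P.I_notcarr by auto
  qed
  obtain x y where x: "x \<in> {..<N} \<rightarrow> carrier (R Quot I)" and y: "y \<in> {..<q} \<rightarrow> carrier (R Quot I)"
    and unit: "(\<Oplus>\<^bsub>R Quot I\<^esub>i\<in>{..<N}. x i \<otimes>\<^bsub>R Quot I\<^esub> (\<Oplus>\<^bsub>R Quot I\<^esub>j\<in>{..<q}. y j \<otimes>\<^bsub>R Quot I\<^esub> (I +> w j i)))
      \<oplus>\<^bsub>R Quot I\<^esub> (I +> e) \<in> Units (R Quot I)"
    using S.local_global_bilinear[OF lg, of N q "\<lambda>i j. I +> w j i" "I +> e"] wc e loc by auto
  have lift: "\<exists>r\<in>carrier R. z = I +> r" if "z \<in> carrier (R Quot I)" for z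
    using that unfolding FactRing_def A_RCOSETS_def' by auto
  have "\<forall>i\<in>{..<N}. \<exists>r\<in>carrier R. x i = I +> r" using x lift by auto
  then obtain x' where x': "\<And>i. i < N \<Longrightarrow> x' i \<in> carrier R" "\<And>i. i < N \<Longrightarrow> x i = I +> x' i" by (metis lessThan_iff)
  have "\<forall>j\<in>{..<q}. \<exists>r\<in>carrier R. y j = I +> r" using y lift by auto
  then obtain y' where y': "\<And>j. j < q \<Longrightarrow> y' j \<in> carrier R" "\<And>j. j < q \<Longrightarrow> y j = I +> y' j" by (metis lessThan_iff)
  \<comment> \<open>Lifts of the two blocks of the solution: the vector \<open>z\<close> combines
    the \<open>w j\<close>, and the form \<open>\<gamma>\<close> combines the coordinates, so that
    \<open>\<gamma> z\<close> is congruent modulo \<open>I\<close> to the bilinear sum.\<close>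
  define z where "z = (\<lambda>i. \<Oplus>j\<in>{..<q}. y' j \<otimes> w j i)"
  define \<gamma> where "\<gamma> = (\<lambda>u. \<Oplus>i\<in>{..<N}. x' i \<otimes> u i)"
  have z: "z \<in> K" unfolding z_def by (rule submodule_finsum[OF K]) (use y' wK in auto)
  have zc: "z i \<in> carrier R" for i using vecD(1)[OF Km(1)[OF z]] .
  have \<gamma>: "\<gamma> \<in> dual {..<N}" unfolding \<gamma>_def
  proof (rule dualI)
    fix u assume u: "u \<in> vec {..<N}"
    note uc = vecD(1)[OF u]
    show "(\<Oplus>i\<in>{..<N}. x' i \<otimes> u i) \<in> carrier R" using uc x' by (intro finsum_closed) auto
    show "(\<Oplus>i\<in>{..<N}. x' i \<otimes> (r \<otimes> u i)) = r \<otimes> (\<Oplus>i\<in>{..<N}. x' i \<otimes> u i)" if r: "r \<in> carrier R" for r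
    proof -
      have "r \<otimes> (\<Oplus>i\<in>{..<N}. x' i \<otimes> u i) = (\<Oplus>i\<in>{..<N}. r \<otimes> (x' i \<otimes> u i))"
        using uc x' r by (intro finsum_rdistr) auto
      also have "\<dots> = (\<Oplus>i\<in>{..<N}. x' i \<otimes> (r \<otimes> u i))"
        using uc x' r by (intro finsum_cong') (auto intro: m_lcomm)
      finally show ?thesis by simp
    qed
    fix v assume v: "v \<in> vec {..<N}"
    note vc = vecD(1)[OF v]
    have "(\<Oplus>i\<in>{..<N}. x' i \<otimes> (u i \<oplus> v i)) = (\<Oplus>i\<in>{..<N}. x' i \<otimes> u i \<oplus> x' i \<otimes> v i)"
      using uc vc x' by (intro finsum_cong') (auto simp: r_distr)
    also have "\<dots> = (\<Oplus>i\<in>{..<N}. x' i \<otimes> u i) \<oplus> (\<Oplus>i\<in>{..<N}. x' i \<otimes> v i)"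
      using uc vc x' by (intro finsum_addf) auto
    finally show "(\<Oplus>i\<in>{..<N}. x' i \<otimes> (u i \<oplus> v i)) = (\<Oplus>i\<in>{..<N}. x' i \<otimes> u i) \<oplus> (\<Oplus>i\<in>{..<N}. x' i \<otimes> v i)" .
  qed
  have \<gamma>z: "\<gamma> z \<in> carrier R" using dualD(1)[OF \<gamma> Km(1)[OF z]] .
  have Iz: "I +> z i = (\<Oplus>\<^bsub>R Quot I\<^esub>j\<in>{..<q}. y j \<otimes>\<^bsub>R Quot I\<^esub> (I +> w j i))" for i
  proof -
    have "I +> z i = (\<Oplus>\<^bsub>R Quot I\<^esub>j\<in>{..<q}. ((+>) I \<circ> (\<lambda>j. y' j \<otimes> w j i)) j)"
      unfolding z_def using y' wc by (intro h.hom_finsum) auto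
    also have "\<dots> = (\<Oplus>\<^bsub>R Quot I\<^esub>j\<in>{..<q}. y j \<otimes>\<^bsub>R Quot I\<^esub> (I +> w j i))"
      using y' wc by (intro S.finsum_cong') auto
    finally show ?thesis .
  qed
  have "I +> \<gamma> z = (\<Oplus>\<^bsub>R Quot I\<^esub>i\<in>{..<N}. ((+>) I \<circ> (\<lambda>i. x' i \<otimes> z i)) i)"
    unfolding \<gamma>_def using x' zc by (intro h.hom_finsum) auto
  also have "\<dots> = (\<Oplus>\<^bsub>R Quot I\<^esub>i\<in>{..<N}. x i \<otimes>\<^bsub>R Quot I\<^esub> (\<Oplus>\<^bsub>R Quot I\<^esub>j\<in>{..<q}. y j \<otimes>\<^bsub>R Quot I\<^esub> (I +> w j i)))"
    using x' zc unfolding Iz[symmetric] by (intro S.finsum_cong') auto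
  finally have "I +> (\<gamma> z \<oplus> e) \<in> Units (R Quot I)" using unit \<gamma>z e by simp
  then obtain v' where v': "v' \<in> carrier (R Quot I)" "v' \<otimes>\<^bsub>R Quot I\<^esub> (I +> (\<gamma> z \<oplus> e)) = \<one>\<^bsub>R Quot I\<^esub>"
    unfolding Units_def by auto
  obtain v where v: "v \<in> carrier R" "v' = I +> v" using lift[OF v'(1)] by auto
  have "I +> (v \<otimes> (\<gamma> z \<oplus> e)) = I +> \<one>" using v' v \<gamma>z e by simp
  then have "v \<otimes> (\<gamma> z \<oplus> e) \<ominus> \<one> \<in> I"
    using quotient_eq_iff_same_a_r_cos[OF I.is_ideal, of "v \<otimes> (\<gamma> z \<oplus> e)" \<one>] v \<gamma>z e by simp
  then obtain r where r: "r \<in> carrier R" "v \<otimes> (\<gamma> z \<oplus> e) \<ominus> \<one> = r \<otimes> d" unfolding I_def cgenideal_def by auto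
  have "v \<otimes> (\<gamma> z \<oplus> e) \<oplus> d \<otimes> (\<ominus> r) = \<one> \<oplus> ((v \<otimes> (\<gamma> z \<oplus> e) \<ominus> \<one>) \<ominus> r \<otimes> d)"
    using v \<gamma>z e r(1) dc by algebra
  also have "\<dots> = \<one>" unfolding r(2) using r(1) dc by (simp add: a_minus_def r_neg)
  finally show ?thesis using that[OF z \<gamma> v(1), of "\<ominus> r"] r(1) by simp
qed

text \<open>This makes the ideals \<open>J\<close> of the decomposition finitely generated, since
  each rank-one summand is identified with the image of a linear form.\<close>

lemma dual_image:
  assumes "finite U" "g \<in> dual U"
  shows "g ` vec U = Idl ((\<lambda>u. g (\<lambda>v. if v = u then \<one> else \<zero>)) ` U)"
proof
  note gd = dualD[OF assms(2)]
  let ?G = "(\<lambda>u. g (\<lambda>v. if v = u then \<one> else \<zero>)) ` U"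
  have G: "?G \<subseteq> carrier R" using gd(1)[OF unit_vec_closed] by auto
  note Gi = genideal_ideal[OF G] and Gs = genideal_self[OF G]
  have "submodule {x \<in> vec U. g x \<in> Idl ?G} R (free_module R U)"
    by (rule submodule_vecI) (use gd ideal_closed[OF Gi] in \<open>auto simp: vec_closed\<close>)
  then have "x \<in> {x \<in> vec U. g x \<in> Idl ?G}" if "x \<in> vec U" for x
    by (rule vec_spanned_by_unit_vecs[OF assms(1) _ _ that]) (use Gs in \<open>auto simp: unit_vec_closed\<close>)
  then show "g ` vec U \<subseteq> Idl ?G" by auto
  show "Idl ?G \<subseteq> g ` vec U"
  proof (rule Idl_subsetI[OF idealI'])
    show "g ` vec U \<subseteq> carrier R" using gd(1) by auto
    show "\<zero> \<in> g ` vec U" using gd(4) by (intro image_eqI[of _ g "\<lambda>_. \<zero>"]) (auto simp: vec_closed)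
    show "a \<oplus> b \<in> g ` vec U" if ab: "a \<in> g ` vec U" "b \<in> g ` vec U" for a b
    proof -
      obtain x y where x: "x \<in> vec U" "a = g x" "y \<in> vec U" "b = g y" using ab by auto
      show ?thesis using gd(2)[OF x(1,3)] x(2,4) by (intro image_eqI[OF _ vec_closed(2)[OF x(1,3)]]) simp
    qed
    show "r \<otimes> a \<in> g ` vec U" if ar: "a \<in> g ` vec U" "r \<in> carrier R" for a r
    proof -
      obtain x where x: "x \<in> vec U" "a = g x" using ar by auto
      show ?thesis using gd(3)[OF x(1) ar(2)] x(2) by (intro image_eqI[OF _ vec_closed(3)[OF x(1) ar(2)]]) simp
    qed
    show "?G \<subseteq> g ` vec U" by (intro image_subsetI imageI unit_vec_closed) auto
  qed
qed

lemma lspan_coordinates_mem: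
  assumes "B \<subseteq> vec U" "T \<in> module_hom R (free_module R U) (free_module R U')" "ideal I R"
    "\<And>b i. b \<in> B \<Longrightarrow> T b i \<in> I" "x \<in> lspan U B"
  shows "T x i \<in> I"
proof -
  have "submodule {x \<in> vec U. \<forall>i. T x i \<in> I} R (free_module R U)"
    by (rule submodule_vecI) (auto simp: vec_closed vec_homD[OF assms(2)] ideal_closed[OF assms(3)])
  then have "lspan U B \<subseteq> {x \<in> vec U. \<forall>i. T x i \<in> I}"
    by (rule module_span_minimal) (use assms in auto)
  then show ?thesis using assms(5) by auto
qed

end

context semihereditary_cring
begin

text \<open>The module \<open>H1\<close> of the proof is \<open>c\<^sup>-\<^sup>1 (H \<inter> \<pi>(R\<^sup>N))\<close>, which
  has unit content on the support of \<open>c\<close>. A vector \<open>h\<close> of \<open>H1\<close> which is unimodular modulo \<open>d\<close> spans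
  a line whose purification lies in \<open>H1\<close>: from \<open>v\<gamma>(h) + dt = u\<close> follows
  \<open>y = v\<gamma>(y)h + t(dy)\<close> for \<open>y\<close> in the purification.\<close>

lemma split_rank_one_summand:
  fixes N :: nat
  defines "U \<equiv> {..<N}"
  assumes alg: "almost_local_global R" and B: "finite B" "B \<subseteq> vec U"
    and d: "d \<in> regular_elements R"
    and sat: "\<And>x s. x \<in> vec U \<Longrightarrow> s \<in> regular_elements R \<Longrightarrow> (\<lambda>i. s \<otimes> x i) \<in> lspan U B \<Longrightarrow> (\<lambda>i. d \<otimes> x i) \<in> lspan U B"
    and \<pi>: "\<pi> \<in> End U" "\<And>x. x \<in> vec U \<Longrightarrow> \<pi> (\<pi> x) = \<pi> x" "\<And>x. x \<in> lspan U B \<Longrightarrow> \<pi> x \<in> lspan U B"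
    and u: "support u (\<Union>b\<in>B. range (\<pi> b))"
  defines "c \<equiv> Idl (\<Union>b\<in>B. range (\<pi> b))"
  obtains p g h where "p \<in> End U" "g \<in> dual U" "h \<in> vec U" "p h = h" "support u (range h)"
    "\<And>x. x \<in> vec U \<Longrightarrow> p (p x) = p x" "\<And>x. x \<in> vec U \<Longrightarrow> \<pi> (p x) = p x"
    "\<And>x. x \<in> vec U \<Longrightarrow> (\<lambda>i. u \<otimes> p x i) = p x"
    "\<And>x. x \<in> vec U \<Longrightarrow> g (p x) = \<zero> \<Longrightarrow> p x = (\<lambda>_. \<zero>)"
    "\<And>x. x \<in> lspan U B \<Longrightarrow> p (\<pi> x) \<in> lspan U B"
    "\<And>x. x \<in> lspan U B \<Longrightarrow> g (p (\<pi> x)) \<in> c \<cdot> ((\<lambda>y. g (p y)) ` vec U)"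
    "\<And>a y. a \<in> c \<Longrightarrow> y \<in> vec U \<Longrightarrow> (\<lambda>i. a \<otimes> p y i) \<in> lspan U B"
proof -
  have U: "finite U" unfolding U_def by simp
  let ?H = "lspan U B"
  note H = module_span_vec(1)[OF B(2)] and BH = module_span_vec(2)[OF B(2)]
  note Hm = submodule_vecD[OF H] and \<pi>d = vec_homD[OF \<pi>(1)]
  let ?C = "\<Union>b\<in>B. range (\<pi> b)"
  have C: "?C \<subseteq> carrier R" using range_vec[OF \<pi>d(1)] B(2) by blast
  have finC: "finite ?C" using finite_range_vec[OF U \<pi>d(1)] B by blast
  have c: "ideal c R" unfolding c_def by (rule genideal_ideal[OF C])
  note cc = ideal_closed[OF c] and uc = supportD(1)[OF u]
  have Cc: "?C \<subseteq> c" unfolding c_def by (rule genideal_self[OF C])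
  have uu: "u \<otimes> u = u" by (rule support_idem[OF u C])
  have ua: "u \<otimes> a = a" if "a \<in> c" for a
    using u support_Idl[OF C] supportD(2) that unfolding c_def by blast
  have \<pi>c: "\<pi> x i \<in> c" if "x \<in> ?H" for x i
    by (rule lspan_coordinates_mem[OF B(2) \<pi>(1) c _ that]) (use Cc in blast)
  \<comment> \<open>Division by \<open>c\<close> is expressed by requiring all multiples
    \<open>a x\<close> to be in \<open>H\<close>. That requirement is void where \<open>c\<close>
    vanishes, hence the condition with \<open>u\<close>.\<close>
  define H1 where "H1 = {x \<in> vec U. \<pi> x = x \<and> (\<lambda>i. u \<otimes> x i) = x \<and> (\<forall>a\<in>c. (\<lambda>i. a \<otimes> x i) \<in> ?H)}"
  have H1D: "x \<in> vec U" "\<pi> x = x" "u \<otimes> x i = x i" "a \<in> c \<Longrightarrow> (\<lambda>i. a \<otimes> x i) \<in> ?H" if "x \<in> H1" for x i a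
    using that unfolding H1_def by (auto dest: fun_cong)
  have H1: "submodule H1 R (free_module R U)"
  proof (rule submodule_vecI)
    show "H1 \<subseteq> vec U" unfolding H1_def by auto
    show "(\<lambda>_. \<zero>) \<in> H1" unfolding H1_def using \<pi>d(4) uc cc(5) Hm(2) by (auto simp: vec_closed)
    show "(\<lambda>i. x i \<oplus> y i) \<in> H1" if xy: "x \<in> H1" "y \<in> H1" for x y
    proof -
      note x = H1D[OF xy(1)] and y = H1D[OF xy(2)]
      have k: "x i \<in> carrier R" "y i \<in> carrier R" for i using vecD(1)[OF x(1)] vecD(1)[OF y(1)] by auto
      have "(\<lambda>i. a \<otimes> (x i \<oplus> y i)) \<in> ?H" if a: "a \<in> c" for a
        using Hm(3)[OF x(4)[OF a] y(4)[OF a]] r_distr[OF k cc(5)[OF a]] by simp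
      then show ?thesis unfolding H1_def
        using \<pi>d(2)[OF x(1) y(1)] x(1-3) y(1-3) r_distr[OF k uc] by (simp add: vec_closed)
    qed
    show "(\<lambda>i. r \<otimes> x i) \<in> H1" if xr: "x \<in> H1" "r \<in> carrier R" for x r
    proof -
      note x = H1D[OF xr(1)]
      have k: "x i \<in> carrier R" for i using vecD(1)[OF x(1)] .
      have "(\<lambda>i. a \<otimes> (r \<otimes> x i)) \<in> ?H" if a: "a \<in> c" for a
        using Hm(4)[OF x(4)[OF a] xr(2)] m_lcomm[OF cc(5)[OF a] xr(2) k] by simp
      then show ?thesis unfolding H1_def
        using \<pi>d(3)[OF x(1) xr(2)] x(1-3) m_lcomm[OF uc xr(2) k] xr(2) by (simp add: vec_closed)
    qed
  qed
  note H1m = submodule_vecD[OF H1]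
  have \<pi>H1: "\<pi> x \<in> H1" if x: "x \<in> ?H" for x
    unfolding H1_def using \<pi>d(1) \<pi>(2) Hm(1)[OF x] ua[OF \<pi>c[OF x]] Hm(4)[OF \<pi>(3)[OF x] cc(5)] by simp
  \<comment> \<open>The concrete elements of \<open>H1\<close>: the multiple by \<open>a\<close> of
    the vector \<open>f(\<pi> x)\<close> equals \<open>f a\<close> times \<open>\<pi> x\<close>,
    which is in \<open>H\<close>.\<close>
  have fH1: "(\<lambda>i. f (\<pi> x i)) \<in> H1" if f: "f \<in> ideal_dual c" and x: "x \<in> ?H" for f x
  proof -
    note fd = ideal_dualD[OF f]
    have \<pi>x: "\<pi> x \<in> vec U" using \<pi>d(1)[OF Hm(1)[OF x]] .
    have v: "(\<lambda>i. f (\<pi> x i)) \<in> vec U" by (rule ideal_dual_vec[OF U c f \<pi>x \<pi>c[OF x]])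
    moreover have "\<pi> (\<lambda>i. f (\<pi> x i)) = (\<lambda>i. f (\<pi> x i))"
    proof
      fix j
      have "(\<lambda>z. \<pi> z j) \<in> dual U" using module_hom_comp[OF \<pi>(1) coordinate_dual[of j U]] by simp
      then have "\<pi> (\<lambda>i. f (\<pi> x i)) j = f (\<pi> (\<pi> x) j)" by (rule dual_ideal_dual[OF U c f _ \<pi>x \<pi>c[OF x]])
      then show "\<pi> (\<lambda>i. f (\<pi> x i)) j = f (\<pi> x j)" using \<pi>(2)[OF Hm(1)[OF x]] by simp
    qed
    moreover have "(\<lambda>i. u \<otimes> f (\<pi> x i)) = (\<lambda>i. f (\<pi> x i))"
      unfolding fd(3)[OF \<pi>c[OF x] uc, symmetric] ua[OF \<pi>c[OF x]] ..
    moreover have "(\<lambda>i. a \<otimes> f (\<pi> x i)) \<in> ?H" if a: "a \<in> c" for a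
      unfolding ideal_dual_comm[OF c f a \<pi>c[OF x]] by (rule Hm(4)[OF \<pi>(3)[OF x] fd(1)[OF a]])
    ultimately show ?thesis unfolding H1_def by simp
  qed
  have trace: "u \<in> Idl {f a | f a. f \<in> ideal_dual c \<and> a \<in> c}"
    unfolding c_def by (rule support_mem_trace[OF finC u C])
  \<comment> \<open>The image of \<open>H\<close> under \<open>\<pi>\<close> is \<open>c\<close>
    times \<open>H1\<close>: as \<open>u\<close> lies in the ideal of all \<open>f a\<close>, the
    vector \<open>\<pi> x\<close> is a combination of the vectors \<open>a f(\<pi> x)\<close>. So it
    is enough to check a submodule on these.\<close>
  have by_trace: "\<pi> x \<in> K" if x: "x \<in> ?H" and K: "submodule K R (free_module R U)"
    and gen: "\<And>f a. f \<in> ideal_dual c \<Longrightarrow> a \<in> c \<Longrightarrow> (\<lambda>i. a \<otimes> f (\<pi> x i)) \<in> K" for x K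
  proof -
    note Km = submodule_vecD[OF K]
    have xc: "\<pi> x i \<in> carrier R" for i using cc(5)[OF \<pi>c[OF x]] .
    let ?A = "{t \<in> carrier R. (\<lambda>i. t \<otimes> \<pi> x i) \<in> K}"
    have A: "ideal ?A R"
      by (rule idealI') (use Km(2) Km(3,4) xc in \<open>auto simp: l_distr m_assoc\<close>)
    have "{f a | f a. f \<in> ideal_dual c \<and> a \<in> c} \<subseteq> ?A"
    proof
      fix z assume "z \<in> {f a | f a. f \<in> ideal_dual c \<and> a \<in> c}"
      then obtain f a where z: "z = f a" "f \<in> ideal_dual c" "a \<in> c" by auto
      show "z \<in> ?A" using gen[OF z(2,3)] ideal_dual_comm[OF c z(2,3) \<pi>c[OF x]] ideal_dualD(1)[OF z(2,3)] z(1) by simp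
    qed
    then have "Idl {f a | f a. f \<in> ideal_dual c \<and> a \<in> c} \<subseteq> ?A" by (rule Idl_subsetI[OF A])
    then have "(\<lambda>i. u \<otimes> \<pi> x i) \<in> K" using trace by auto
    then show ?thesis unfolding ua[OF \<pi>c[OF x]] .
  qed
  \<comment> \<open>The content of \<open>H1\<close> contains \<open>u\<close>: each
    \<open>f (\<pi> b i)\<close> is a coordinate of a vector of \<open>H1\<close>, so the content
    contains all \<open>f a\<close> and with them the trace \<open>u\<close>. The remaining
    \<open>\<one> \<ominus> u\<close> becomes the constant of the polynomial.\<close>
  have oneIdl: "\<one> \<in> Idl (insert (\<one> \<ominus> u) (\<Union>x\<in>H1. range x))"
  proof -
    let ?X = "insert (\<one> \<ominus> u) (\<Union>x\<in>H1. range x)"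
    have X: "?X \<subseteq> carrier R" using uc range_vec[OF H1m(1)] by auto
    note Xi = genideal_ideal[OF X] and Xs = genideal_self[OF X]
    note Xc = ideal_closed[OF Xi]
    have "f a \<in> Idl ?X" if f: "f \<in> ideal_dual c" and a: "a \<in> c" for f a
    proof -
      note fd = ideal_dualD[OF f]
      have A: "ideal {a \<in> c. f a \<in> Idl ?X} R"
        by (rule idealI') (use cc Xc fd c in auto)
      have "f (\<pi> b i) \<in> Idl ?X" if "b \<in> B" for b i
      proof -
        have "(\<lambda>i. f (\<pi> b i)) \<in> H1" using BH that by (intro fH1[OF f]) auto
        then have "f (\<pi> b i) \<in> (\<Union>x\<in>H1. range x)" by (rule UN_I) (rule range_eqI, rule refl)
        then show ?thesis using Xs by auto
      qed
      then have "z \<in> {a \<in> c. f a \<in> Idl ?X}" if "z \<in> ?C" for z using subsetD[OF Cc that] that by auto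
      then have "?C \<subseteq> {a \<in> c. f a \<in> Idl ?X}" by (rule subsetI)
      then have "c \<subseteq> {a \<in> c. f a \<in> Idl ?X}" unfolding c_def by (rule Idl_subsetI[OF A[unfolded c_def]])
      then show ?thesis using a by auto
    qed
    then have "{f a | f a. f \<in> ideal_dual c \<and> a \<in> c} \<subseteq> Idl ?X" by auto
    then have "Idl {f a | f a. f \<in> ideal_dual c \<and> a \<in> c} \<subseteq> Idl ?X" by (rule Idl_subsetI[OF Xi])
    then have "u \<oplus> (\<one> \<ominus> u) \<in> Idl ?X" using trace Xs by (intro Xc(2)) auto
    moreover have "u \<oplus> (\<one> \<ominus> u) = \<one>" using uc by algebra
    ultimately show ?thesis by simp
  qed
  have uc': "\<one> \<ominus> u \<in> carrier R" using uc by simp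
  obtain h0 \<gamma> v t where h0: "h0 \<in> H1" and \<gamma>: "\<gamma> \<in> dual U" and v: "v \<in> carrier R" and t: "t \<in> carrier R"
    and eq: "v \<otimes> (\<gamma> h0 \<oplus> (\<one> \<ominus> u)) \<oplus> d \<otimes> t = \<one>"
    using unimodular_combination[OF alg d H1[unfolded U_def] uc' oneIdl] unfolding U_def by blast
  have "support u (\<Union>b\<in>\<pi> ` B. range b)" using u by simp
  moreover have "finite (\<pi> ` B)" "\<pi> ` B \<subseteq> vec U" "\<pi> ` B \<subseteq> H1" using B \<pi>d(1) \<pi>H1 BH by auto
  ultimately obtain w0 where w0: "w0 \<in> H1" "support u (range w0)"
    using vec_max_support[OF U _ _ _ H1, of "\<pi> ` B" u] by blast
  note h0v = H1m(1)[OF h0] and w0v = H1m(1)[OF w0(1)]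
  obtain w where w: "support w (range h0)"
    using support_exists[OF finite_range_vec[OF U h0v] range_vec[OF h0v]] by blast
  note wc = supportD(1)[OF w] and dc = regular_elementsD(1)[OF d]
  have ww: "w \<otimes> w = w" by (rule support_idem[OF w range_vec[OF h0v]])
  have wh0: "w \<otimes> h0 i = h0 i" for i using supportD(2)[OF w] by auto
  have h0c: "h0 i \<in> carrier R" and w0c: "w0 i \<in> carrier R" for i using vecD(1)[OF h0v] vecD(1)[OF w0v] by auto
  \<comment> \<open>The support \<open>w\<close> of \<open>h0\<close> may be smaller than
    \<open>u\<close>, since unimodularity modulo \<open>d\<close> says nothing about it. A multiple
    of \<open>w0\<close> fills the gap; the factor \<open>\<one> \<ominus> w\<close> prevents
    cancellation, and the factor \<open>d\<close> leaves the value of \<open>\<gamma>\<close>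
    unchanged modulo \<open>d\<close>.\<close>
  define h where "h = (\<lambda>i. h0 i \<oplus> ((\<one> \<ominus> w) \<otimes> d) \<otimes> w0 i)"
  have hH1: "h \<in> H1" unfolding h_def using h0 w0(1) wc dc by (intro H1m) auto
  note hv = H1m(1)[OF hH1]
  note hc = vecD(1)[OF hv]
  have supp: "support u (range h)"
  proof (rule supportI[OF uc])
    show "u \<otimes> x = x" if "x \<in> range h" for x using that H1D(3)[OF hH1] by auto
    fix r assume r: "r \<in> carrier R" "\<And>x. x \<in> range h \<Longrightarrow> r \<otimes> x = \<zero>"
    have rh: "r \<otimes> h i = \<zero>" for i using r(2) by auto
    have wh: "w \<otimes> h i = h0 i" for i
    proof -
      have "w \<otimes> h i = w \<otimes> h0 i \<oplus> (w \<ominus> w \<otimes> w) \<otimes> (d \<otimes> w0 i)"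
        unfolding h_def using wc dc h0c[of i] w0c[of i] by algebra
      then show ?thesis unfolding ww wh0 using wc dc h0c[of i] w0c[of i] by (simp add: a_minus_def r_neg)
    qed
    have rh0: "r \<otimes> h0 i = \<zero>" for i
    proof -
      have "r \<otimes> h0 i = w \<otimes> (r \<otimes> h i)" unfolding wh[symmetric] using r(1) wc hc by (intro m_lcomm)
      then show ?thesis using rh wc by simp
    qed
    then have rw: "r \<otimes> w = \<zero>" using r(1) by (intro supportD(3)[OF w]) auto
    have "r \<otimes> w0 i = \<zero>" for i
    proof -
      have "r \<otimes> h i = r \<otimes> h0 i \<oplus> (d \<otimes> (r \<otimes> w0 i) \<ominus> (r \<otimes> w) \<otimes> (d \<otimes> w0 i))"
        unfolding h_def using wc dc h0c[of i] w0c[of i] r(1) by algebra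
      then have "d \<otimes> (r \<otimes> w0 i) = \<zero>"
        unfolding rh rh0 rw using dc w0c[of i] r(1) by (simp add: a_minus_def)
      then show ?thesis using regular_elementsD(2)[OF d] r(1) w0c by simp
    qed
    then show "r \<otimes> u = \<zero>" using r(1) by (intro supportD(3)[OF w0(2)]) auto
  qed
  \<comment> \<open>The unimodularity equation is multiplied by \<open>u\<close>, which removes the
    constant \<open>\<one> \<ominus> u\<close>. The second term compensates the contribution of
    \<open>w0\<close> to \<open>\<gamma> h\<close>.\<close>
  define t' where "t' = t \<otimes> u \<ominus> v \<otimes> ((\<one> \<ominus> w) \<otimes> \<gamma> w0)"
  have \<gamma>h0: "\<gamma> h0 \<in> carrier R" and \<gamma>w0: "\<gamma> w0 \<in> carrier R" using dualD(1)[OF \<gamma>] h0v w0v by auto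
  have t': "t' \<in> carrier R" unfolding t'_def using t uc v wc \<gamma>w0 by simp
  have key: "v \<otimes> \<gamma> h \<oplus> d \<otimes> t' = u"
  proof -
    have "\<gamma> h = \<gamma> h0 \<oplus> ((\<one> \<ominus> w) \<otimes> d) \<otimes> \<gamma> w0"
      unfolding h_def using dualD(2,3)[OF \<gamma>] h0v w0v wc dc by (simp add: vec_closed)
    then have "v \<otimes> \<gamma> h \<oplus> d \<otimes> t' = v \<otimes> \<gamma> h0 \<oplus> d \<otimes> (t \<otimes> u)"
      unfolding t'_def using v \<gamma>h0 \<gamma>w0 wc dc t uc by algebra
    moreover have "u \<otimes> \<gamma> h0 = \<gamma> h0"
      unfolding dualD(3)[OF \<gamma> h0v uc, symmetric] H1D(3)[OF h0] ..
    moreover have "u \<otimes> (v \<otimes> (\<gamma> h0 \<oplus> (\<one> \<ominus> u)) \<oplus> d \<otimes> t) = v \<otimes> (u \<otimes> \<gamma> h0) \<oplus> (v \<otimes> (u \<ominus> u \<otimes> u) \<oplus> d \<otimes> (t \<otimes> u))"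
      using v \<gamma>h0 dc t uc by algebra
    ultimately show ?thesis unfolding eq uu using uc v \<gamma>h0 dc t by (simp add: a_minus_def r_neg)
  qed
  obtain p g where p: "p \<in> End U" and g: "g \<in> dual U" and ph: "p h = h" and gh: "support u {g h}"
    and pL: "\<And>x \<gamma>. x \<in> vec U \<Longrightarrow> \<gamma> \<in> dual U \<Longrightarrow> (\<lambda>i. \<gamma> h \<otimes> p x i) = (\<lambda>i. \<gamma> (p x) \<otimes> h i)"
    and up: "\<And>x. x \<in> vec U \<Longrightarrow> (\<lambda>i. u \<otimes> p x i) = p x"
    and Lp: "\<And>y. y \<in> vec U \<Longrightarrow> (\<And>\<gamma>. \<gamma> \<in> dual U \<Longrightarrow> (\<lambda>i. \<gamma> h \<otimes> y i) = (\<lambda>i. \<gamma> y \<otimes> h i)) \<Longrightarrow>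
      (\<lambda>i. u \<otimes> y i) = y \<Longrightarrow> p y = y"
    using rank_one_projection[OF U hv supp] by blast
  note pd = vec_homD[OF p]
  have pp: "p (p x) = p x" if "x \<in> vec U" for x
    by (rule Lp) (use pd(1)[OF that] pL[OF that] up[OF that] in auto)
  have ghc: "g h \<in> carrier R" using dualD(1)[OF g hv] .
  have upi: "u \<otimes> p x i = p x i" if "x \<in> vec U" for x i using up[OF that] by (rule fun_cong)
  have pLi: "\<delta> h \<otimes> p x i = \<delta> (p x) \<otimes> h i" if "x \<in> vec U" "\<delta> \<in> dual U" for x i \<delta>
    using pL[OF that] by (rule fun_cong)
  \<comment> \<open>On the factor \<open>u\<close> the element \<open>g h\<close> is not a zero
    divisor. Equations for \<open>p x\<close> may thus be checked after multiplication by
    \<open>g h\<close>, where \<open>p x\<close> turns into a multiple of \<open>h\<close>.\<close>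
  have kill: "a = \<zero>" if "a \<in> carrier R" "u \<otimes> a = a" "g h \<otimes> a = \<zero>" for a
  proof -
    have "a \<otimes> u = \<zero>" by (rule supportD(3)[OF gh]) (use that m_comm[OF ghc that(1)] in auto)
    then show ?thesis using that m_comm[OF that(1) uc] by simp
  qed
  have \<pi>p: "\<pi> (p x) = p x" if x: "x \<in> vec U" for x
  proof
    fix i
    note px = pd(1)[OF x]
    have gpx: "g (p x) \<in> carrier R" using dualD(1)[OF g px] .
    have k: "\<pi> (p x) i \<in> carrier R" "p x i \<in> carrier R" using vecD(1)[OF \<pi>d(1)[OF px]] vecD(1)[OF px] by auto
    have "(\<lambda>i. g h \<otimes> \<pi> (p x) i) = \<pi> (\<lambda>i. g h \<otimes> p x i)" using \<pi>d(3)[OF px ghc] by simp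
    also have "\<dots> = \<pi> (\<lambda>i. g (p x) \<otimes> h i)" unfolding pL[OF x g] ..
    also have "\<dots> = (\<lambda>i. g h \<otimes> p x i)" unfolding \<pi>d(3)[OF hv gpx] H1D(2)[OF hH1] pL[OF x g] ..
    finally have "g h \<otimes> \<pi> (p x) i = g h \<otimes> p x i" by (rule fun_cong)
    moreover have "g h \<otimes> (\<pi> (p x) i \<ominus> p x i) = g h \<otimes> \<pi> (p x) i \<ominus> g h \<otimes> p x i" using k ghc by algebra
    ultimately have 1: "g h \<otimes> (\<pi> (p x) i \<ominus> p x i) = \<zero>" using k ghc by simp
    have "(\<lambda>i. u \<otimes> \<pi> (p x) i) = \<pi> (p x)" using \<pi>d(3)[OF px uc] up[OF x] by simp
    then have "u \<otimes> \<pi> (p x) i = \<pi> (p x) i" by (rule fun_cong)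
    moreover have "u \<otimes> (\<pi> (p x) i \<ominus> p x i) = u \<otimes> \<pi> (p x) i \<ominus> u \<otimes> p x i" using k uc by algebra
    ultimately have "u \<otimes> (\<pi> (p x) i \<ominus> p x i) = \<pi> (p x) i \<ominus> p x i" using upi[OF x] by simp
    then have "\<pi> (p x) i \<ominus> p x i = \<zero>" using kill 1 k by simp
    then show "\<pi> (p x) i = p x i" using k by simp
  qed
  obtain c0 where c0: "c0 \<in> c" "support u {c0}" using ideal_max_support[OF finC C u] unfolding c_def by blast
  have ap: "(\<lambda>i. a \<otimes> p x i) \<in> ?H" if a: "a \<in> c" and x: "x \<in> vec U" for a x
  proof -
    note px = pd(1)[OF x]
    have gpx: "g (p x) \<in> carrier R" and \<gamma>px: "\<gamma> (p x) \<in> carrier R" and \<gamma>h: "\<gamma> h \<in> carrier R"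
      using dualD(1)[OF g px] dualD(1)[OF \<gamma> px] dualD(1)[OF \<gamma> hv] by auto
    have k: "p x i \<in> carrier R" for i using vecD(1)[OF px] .
    have c0c: "c0 \<in> carrier R" and ac: "a \<in> carrier R" using cc(5) c0(1) a by auto
    \<comment> \<open>A regular element that acts on \<open>p x\<close> as \<open>c0\<close> times
      \<open>g h\<close>. By proportionality the result is \<open>g (p x)\<close> times
      \<open>c0 h\<close>, which is in \<open>H\<close> because \<open>h\<close> is in
      \<open>H1\<close>. So \<open>p x\<close> is torsion modulo \<open>H\<close>, and the bound
      \<open>d\<close> applies to it.\<close>
    let ?s = "(c0 \<oplus> (\<one> \<ominus> u)) \<otimes> (g h \<oplus> (\<one> \<ominus> u))"
    have s: "?s \<in> regular_elements R"
      by (intro regular_elements_mult support_regular[OF c0(2) c0c] support_regular[OF gh ghc])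
    have "?s \<otimes> p x i = g (p x) \<otimes> (c0 \<otimes> h i)" for i
    proof -
      have "(\<one> \<ominus> u) \<otimes> p x i = p x i \<ominus> u \<otimes> p x i" using uc k[of i] by algebra
      then have 0: "(\<one> \<ominus> u) \<otimes> p x i = \<zero>" unfolding upi[OF x] using k[of i] by simp
      have "?s \<otimes> p x i = (c0 \<oplus> (\<one> \<ominus> u)) \<otimes> (g h \<otimes> p x i \<oplus> (\<one> \<ominus> u) \<otimes> p x i)"
        using c0c ghc uc' k[of i] by (simp add: m_assoc l_distr)
      also have "\<dots> = c0 \<otimes> (g h \<otimes> p x i) \<oplus> g h \<otimes> ((\<one> \<ominus> u) \<otimes> p x i)"
        unfolding 0 using c0c ghc uc' k[of i] m_lcomm[OF uc' ghc k[of i]] 0 by (simp add: l_distr)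
      also have "\<dots> = c0 \<otimes> (g h \<otimes> p x i)" unfolding 0 using c0c ghc k[of i] by simp
      also have "\<dots> = g (p x) \<otimes> (c0 \<otimes> h i)" unfolding pLi[OF x g] using c0c gpx hc by (intro m_lcomm)
      finally show ?thesis .
    qed
    then have "(\<lambda>i. ?s \<otimes> p x i) \<in> ?H" using Hm(4)[OF H1D(4)[OF hH1 c0(1)] gpx] by simp
    then have dp: "(\<lambda>i. d \<otimes> p x i) \<in> ?H" by (rule sat[OF px s])
    have "(\<lambda>i. (v \<otimes> \<gamma> (p x)) \<otimes> (a \<otimes> h i) \<oplus> (a \<otimes> t') \<otimes> (d \<otimes> p x i)) \<in> ?H"
      by (rule Hm(3)[OF Hm(4)[OF H1D(4)[OF hH1 a]] Hm(4)[OF dp]]) (use v \<gamma>px ac t' in auto)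
    moreover have "(v \<otimes> \<gamma> (p x)) \<otimes> (a \<otimes> h i) \<oplus> (a \<otimes> t') \<otimes> (d \<otimes> p x i) = a \<otimes> p x i" for i
    proof -
      have "(v \<otimes> \<gamma> (p x)) \<otimes> (a \<otimes> h i) \<oplus> (a \<otimes> t') \<otimes> (d \<otimes> p x i)
          = (a \<otimes> v) \<otimes> (\<gamma> (p x) \<otimes> h i) \<oplus> (a \<otimes> t') \<otimes> (d \<otimes> p x i)" using v \<gamma>px ac t' dc k[of i] hc[of i] by algebra
      also have "\<dots> = a \<otimes> ((v \<otimes> \<gamma> h \<oplus> d \<otimes> t') \<otimes> p x i)"
        unfolding pLi[OF x \<gamma>, symmetric] using v \<gamma>h ac t' dc k[of i] by algebra
      finally show ?thesis unfolding key upi[OF x] .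
    qed
    ultimately show ?thesis by simp
  qed
  have J: "ideal ((\<lambda>y. g (p y)) ` vec U) R"
    unfolding dual_image[OF U module_hom_comp[OF p g]]
    by (rule genideal_ideal) (use dualD(1)[OF module_hom_comp[OF p g]] in \<open>auto simp: unit_vec_closed\<close>)
  show ?thesis
  proof (rule that[OF p g hv ph supp pp \<pi>p up _ _ _ ap])
    show "p x = (\<lambda>_. \<zero>)" if x: "x \<in> vec U" and gp: "g (p x) = \<zero>" for x
    proof
      fix i
      show "p x i = \<zero>"
        by (rule kill) (use vecD(1)[OF pd(1)[OF x]] upi[OF x] pLi[OF x g] gp hc in auto)
    qed
    \<comment> \<open>On a generator \<open>a f(\<pi> x)\<close> the map \<open>p\<close> yields
      \<open>a\<close> times a vector of the summand, which \<open>ap\<close> puts into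
      \<open>H\<close>. The same generators give the product of ideals in the next claim.\<close>
    show "p (\<pi> x) \<in> ?H" if x: "x \<in> ?H" for x
    proof -
      have "\<pi> x \<in> {z \<in> vec U. p z \<in> ?H}"
      proof (rule by_trace[OF x submodule_vimage[OF p H]])
        fix f a assume f: "f \<in> ideal_dual c" and a: "a \<in> c"
        have v: "(\<lambda>i. f (\<pi> x i)) \<in> vec U" using H1D(1)[OF fH1[OF f x]] .
        show "(\<lambda>i. a \<otimes> f (\<pi> x i)) \<in> {z \<in> vec U. p z \<in> ?H}"
          using pd(3)[OF v cc(5)[OF a]] ap[OF a v] vec_closed(3)[OF v cc(5)[OF a]] by simp
      qed
      then show ?thesis by simp
    qed
    show "g (p (\<pi> x)) \<in> c \<cdot> ((\<lambda>y. g (p y)) ` vec U)" if x: "x \<in> ?H" for x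
    proof -
      let ?D = "c \<cdot> ((\<lambda>y. g (p y)) ` vec U)"
      note Dc = ideal_closed[OF ideal_prod_is_ideal[OF c J]]
      note gpd = dualD[OF module_hom_comp[OF p g]]
      have "submodule {z \<in> vec U. g (p z) \<in> ?D} R (free_module R U)"
        by (rule submodule_vecI) (use gpd Dc in \<open>auto simp: vec_closed\<close>)
      then have "\<pi> x \<in> {z \<in> vec U. g (p z) \<in> ?D}"
      proof (rule by_trace[OF x])
        fix f a assume f: "f \<in> ideal_dual c" and a: "a \<in> c"
        have v: "(\<lambda>i. f (\<pi> x i)) \<in> vec U" using H1D(1)[OF fH1[OF f x]] .
        have "a \<otimes> g (p (\<lambda>i. f (\<pi> x i))) \<in> ?D" using a v by (intro ideal_prod.prod) auto
        then show "(\<lambda>i. a \<otimes> f (\<pi> x i)) \<in> {z \<in> vec U. g (p z) \<in> ?D}"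
          using gpd(3)[OF v cc(5)[OF a]] vec_closed(3)[OF v cc(5)[OF a]] by simp
      qed
      then show ?thesis by simp
    qed
  qed
qed

end

section \<open>Decomposition of a finitely generated submodule\<close>

lemma all_nat_iff_Suc: "(\<forall>i. P i) \<longleftrightarrow> P 0 \<and> (\<forall>i. P (Suc i))"
  by (metis not0_implies_Suc)

context cring
begin

text \<open>A substitute for rank less than \<open>n\<close>: any \<open>n\<close> vectors in the
  image of \<open>\<pi>\<close>, given as a map \<open>\<xi>\<close>, are dependent on each nonzero
  idempotent piece below \<open>u\<close>. Quantifying over all pieces lets the bound be inherited
  by smaller supports.\<close>

definition rank_bound :: "nat \<Rightarrow> nat \<Rightarrow> ((nat \<Rightarrow> 'a) \<Rightarrow> nat \<Rightarrow> 'a) \<Rightarrow> 'a \<Rightarrow> bool"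
  where "rank_bound N n \<pi> u \<longleftrightarrow>
    (\<forall>\<xi>\<in>module_hom R (free_module R {..<n}) (free_module R {..<N}). \<forall>\<epsilon>\<in>carrier R.
      (\<forall>c\<in>vec {..<n}. \<pi> (\<xi> c) = \<xi> c) \<longrightarrow> \<epsilon> \<noteq> \<zero> \<longrightarrow> \<epsilon> \<otimes> \<epsilon> = \<epsilon> \<longrightarrow> u \<otimes> \<epsilon> = \<epsilon> \<longrightarrow>
      (\<exists>c\<in>vec {..<n}. c \<noteq> (\<lambda>_. \<zero>) \<and> (\<lambda>i. \<epsilon> \<otimes> c i) = c \<and> \<xi> c = (\<lambda>_. \<zero>)))"

text \<open>\<open>(\<phi>, \<rho>)\<close> is an isomorphism from the image of \<open>\<pi>\<close> onto the direct sum of the \<open>J\<^sub>i\<close> and the image of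
  \<open>\<rho>\<close>, and it maps \<open>H\<close> onto the direct sum of the \<open>I\<^sub>iJ\<^sub>i\<close>.\<close>

definition stacked_splitting :: "nat \<Rightarrow> (nat \<Rightarrow> 'a) set \<Rightarrow> ((nat \<Rightarrow> 'a) \<Rightarrow> nat \<Rightarrow> 'a) \<Rightarrow> 'a set \<Rightarrow>
    nat \<Rightarrow> (nat \<Rightarrow> 'a set) \<Rightarrow> (nat \<Rightarrow> 'a set) \<Rightarrow> ((nat \<Rightarrow> 'a) \<Rightarrow> nat \<Rightarrow> 'a) \<Rightarrow> ((nat \<Rightarrow> 'a) \<Rightarrow> nat \<Rightarrow> 'a) \<Rightarrow> bool"
  where "stacked_splitting N H \<pi> I0 m J I \<phi> \<rho> \<longleftrightarrow>
    (\<forall>i<m. fg_ideal R (J i)) \<and> (\<forall>i<m. invertible_ideal R (I i)) \<and>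
    (\<forall>i<m. I i \<subseteq> I0) \<and> (\<forall>i j. i \<le> j \<and> j < m \<longrightarrow> I j \<subseteq> I i) \<and>
    \<rho> \<in> End {..<N} \<and> \<phi> \<in> module_hom R (free_module R {..<N}) (ideal_dsum R {..<m} J) \<and>
    (\<forall>x\<in>vec {..<N}. \<rho> (\<rho> x) = \<rho> x \<and> \<rho> (\<pi> x) = \<rho> x \<and> \<pi> (\<rho> x) = \<rho> x \<and>
      \<phi> (\<pi> x) = \<phi> x \<and> \<phi> (\<rho> x) = (\<lambda>_. \<zero>) \<and>
      (\<phi> x = (\<lambda>_. \<zero>) \<longrightarrow> \<rho> x = (\<lambda>_. \<zero>) \<longrightarrow> \<pi> x = (\<lambda>_. \<zero>))) \<and>
    (\<forall>y\<in>carrier (ideal_dsum R {..<m} J). \<exists>x\<in>vec {..<N}. \<phi> x = y \<and> \<rho> x = (\<lambda>_. \<zero>)) \<and>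
    (\<forall>x\<in>H. \<rho> x = (\<lambda>_. \<zero>)) \<and> \<phi> ` H = carrier (ideal_dsum R {..<m} (\<lambda>i. I i \<cdot> J i))"

lemma stacked_splittingD:
  assumes "stacked_splitting N H \<pi> I0 m J I \<phi> \<rho>"
  shows "i < m \<Longrightarrow> fg_ideal R (J i)" "i < m \<Longrightarrow> invertible_ideal R (I i)" "i < m \<Longrightarrow> I i \<subseteq> I0"
    "i \<le> j \<Longrightarrow> j < m \<Longrightarrow> I j \<subseteq> I i" "\<rho> \<in> End {..<N}"
    "\<phi> \<in> module_hom R (free_module R {..<N}) (ideal_dsum R {..<m} J)"
    "x \<in> vec {..<N} \<Longrightarrow> \<rho> (\<rho> x) = \<rho> x" "x \<in> vec {..<N} \<Longrightarrow> \<rho> (\<pi> x) = \<rho> x"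
    "x \<in> vec {..<N} \<Longrightarrow> \<pi> (\<rho> x) = \<rho> x" "x \<in> vec {..<N} \<Longrightarrow> \<phi> (\<pi> x) = \<phi> x"
    "x \<in> vec {..<N} \<Longrightarrow> \<phi> (\<rho> x) = (\<lambda>_. \<zero>)"
    "x \<in> vec {..<N} \<Longrightarrow> \<phi> x = (\<lambda>_. \<zero>) \<Longrightarrow> \<rho> x = (\<lambda>_. \<zero>) \<Longrightarrow> \<pi> x = (\<lambda>_. \<zero>)"
    "y \<in> carrier (ideal_dsum R {..<m} J) \<Longrightarrow> \<exists>x\<in>vec {..<N}. \<phi> x = y \<and> \<rho> x = (\<lambda>_. \<zero>)"
    "x \<in> H \<Longrightarrow> \<rho> x = (\<lambda>_. \<zero>)" "\<phi> ` H = carrier (ideal_dsum R {..<m} (\<lambda>i. I i \<cdot> J i))"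
  using assms unfolding stacked_splitting_def by auto

lemma fg_ideal_ideal: "fg_ideal R I \<Longrightarrow> ideal I R"
  unfolding fg_ideal_def by (auto intro: genideal_ideal)

lemma dsum_homD:
  assumes "\<phi> \<in> module_hom R (free_module R U) (ideal_dsum R U' J)" "\<And>i. i \<in> U' \<Longrightarrow> ideal (J i) R"
  shows "x \<in> vec U \<Longrightarrow> \<phi> x \<in> carrier (ideal_dsum R U' J)"
    "x \<in> vec U \<Longrightarrow> y \<in> vec U \<Longrightarrow> \<phi> (\<lambda>i. x i \<oplus> y i) = (\<lambda>i. \<phi> x i \<oplus> \<phi> y i)"
    "x \<in> vec U \<Longrightarrow> r \<in> carrier R \<Longrightarrow> \<phi> (\<lambda>i. r \<otimes> x i) = (\<lambda>i. r \<otimes> \<phi> x i)"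
    "\<phi> (\<lambda>_. \<zero>) = (\<lambda>_. \<zero>)" "x \<in> vec U \<Longrightarrow> \<phi> x i \<in> carrier R"
proof -
  show c: "x \<in> vec U \<Longrightarrow> \<phi> x \<in> carrier (ideal_dsum R U' J)" for x using module_hom_closed[OF assms(1)] .
  show "x \<in> vec U \<Longrightarrow> y \<in> vec U \<Longrightarrow> \<phi> (\<lambda>i. x i \<oplus> y i) = (\<lambda>i. \<phi> x i \<oplus> \<phi> y i)"
    using module_hom_add[OF assms(1), of x y] by simp
  show "x \<in> vec U \<Longrightarrow> r \<in> carrier R \<Longrightarrow> \<phi> (\<lambda>i. r \<otimes> x i) = (\<lambda>i. r \<otimes> \<phi> x i)"
    using module_hom_smult[OF assms(1), of r x] by simp
  show "\<phi> (\<lambda>_. \<zero>) = (\<lambda>_. \<zero>)"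
    using module_hom_zero[OF module_free module_ideal_dsum[OF assms(2)] assms(1)] by simp
  show "x \<in> vec U \<Longrightarrow> \<phi> x i \<in> carrier R"
    using c[of x] assms(2)[THEN ideal_closed(5)] by (cases "i \<in> U'") (auto simp: ideal_dsum_carrier)
qed

lemma dsum_Suc_iff:
  "y \<in> carrier (ideal_dsum R {..<Suc m} K) \<longleftrightarrow> y 0 \<in> K 0 \<and> (\<lambda>i. y (Suc i)) \<in> carrier (ideal_dsum R {..<m} (\<lambda>i. K (Suc i)))"
proof -
  have "(\<forall>i\<in>{..<Suc m}. y i \<in> K i) \<longleftrightarrow> y 0 \<in> K 0 \<and> (\<forall>i\<in>{..<m}. y (Suc i) \<in> K (Suc i))"
    by (auto simp: less_Suc_eq_0_disj)
  moreover have "(\<forall>i. i \<notin> {..<Suc m} \<longrightarrow> y i = \<zero>) \<longleftrightarrow> (\<forall>i. i \<notin> {..<m} \<longrightarrow> y (Suc i) = \<zero>)"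
    by (subst all_nat_iff_Suc) simp
  ultimately show ?thesis by (simp add: finite_ideal_dsum_carrier)
qed

lemma ideal_prod_mono:
  assumes "I \<subseteq> I'" "x \<in> I \<cdot> J"
  shows "x \<in> I' \<cdot> J"
  using assms(2) by (induction rule: ideal_prod.induct) (use assms(1) in \<open>auto intro: ideal_prod.intros\<close>)

end

context semihereditary_cring
begin

text \<open>Induction on the rank bound. The set \<open>G\<close> generates the preceding ideal of
  the chain; it is faithful and contains the content of what is left of \<open>H\<close>. The
  element \<open>u\<close> acts as the identity on that content and limits where the rank bound is
  asserted.\<close>

lemma stacked_splitting_exists:
  fixes N :: nat
  assumes alg: "almost_local_global R" and B: "finite B" "B \<subseteq> vec {..<N}"
    and d: "d \<in> regular_elements R"
    and sat: "\<And>x s. x \<in> vec {..<N} \<Longrightarrow> s \<in> regular_elements R \<Longrightarrow> (\<lambda>i. s \<otimes> x i) \<in> lspan {..<N} B \<Longrightarrow>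
      (\<lambda>i. d \<otimes> x i) \<in> lspan {..<N} B"
    and "\<pi> \<in> End {..<N}" "\<And>x. x \<in> vec {..<N} \<Longrightarrow> \<pi> (\<pi> x) = \<pi> x"
      "\<And>x. x \<in> lspan {..<N} B \<Longrightarrow> \<pi> x \<in> lspan {..<N} B"
    and "finite G" "G \<subseteq> carrier R" "support \<one> G" "\<And>b i. b \<in> B \<Longrightarrow> \<pi> b i \<in> Idl G"
    and "u \<in> carrier R" "\<And>b i. b \<in> B \<Longrightarrow> u \<otimes> \<pi> b i = \<pi> b i"
    and "rank_bound N n \<pi> u"
  shows "\<exists>m J I \<phi> \<rho>. stacked_splitting N (lspan {..<N} B) \<pi> (Idl G) m J I \<phi> \<rho>"
  using assms(6-)
proof (induction n arbitrary: \<pi> G u)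
  case (0 \<pi> G u)
  note \<pi>d = vec_homD[OF 0(1)]
  have Bv: "b \<in> vec {..<N}" if "b \<in> B" for b using B(2) that by auto
  let ?C = "\<Union>b\<in>B. range (\<pi> b)"
  have C: "?C \<subseteq> carrier R" using range_vec[OF \<pi>d(1)[OF Bv]] by auto
  have finC: "finite ?C" using B(1) finite_range_vec[OF finite_lessThan \<pi>d(1)[OF Bv]] by auto
  obtain w where w: "support w ?C" using support_exists[OF finC C] by blast
  have ww: "w \<otimes> w = w" by (rule support_idem[OF w C])
  have uw: "u \<otimes> w = w" by (rule support_mult[OF w C 0(8)]) (use 0(9) in auto)
  \<comment> \<open>The only vector of length zero is zero, so a rank bound for \<open>n = 0\<close>
    leaves no nonzero idempotent below \<open>u\<close>. Hence the remaining part of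
    \<open>H\<close> is zero.\<close>
  have "w = \<zero>"
  proof (rule ccontr)
    assume w0: "w \<noteq> \<zero>"
    have hom: "(\<lambda>_ _. \<zero>) \<in> module_hom R (free_module R {..<0 :: nat}) (free_module R {..<N})"
      by (rule vec_homI) (auto simp: vec_closed)
    have "\<exists>c\<in>vec {..<0 :: nat}. c \<noteq> (\<lambda>_. \<zero>) \<and> (\<lambda>i. w \<otimes> c i) = c \<and> (\<lambda>_. \<zero>) = (\<lambda>_ :: nat. \<zero>)"
      by (rule 0(10)[unfolded rank_bound_def, rule_format, OF hom supportD(1)[OF w] \<pi>d(4) w0 ww uw])
    then show False by (auto simp: vec_iff)
  qed
  then have \<pi>0: "\<pi> b = (\<lambda>_. \<zero>)" if b: "b \<in> B" for b
  proof (intro ext)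
    fix i
    have "w \<otimes> \<pi> b i = \<pi> b i" by (rule supportD(2)[OF w]) (use b in auto)
    then show "\<pi> b i = \<zero>" using \<open>w = \<zero>\<close> vecD(1)[OF \<pi>d(1)[OF Bv[OF b]]] by simp
  qed
  have "lspan {..<N} B \<subseteq> {x \<in> vec {..<N}. \<pi> x \<in> {\<lambda>_. \<zero>}}"
    by (rule module_span_minimal[OF submodule_vimage[OF 0(1)]])
      (use \<pi>0 Bv in \<open>auto intro!: submodule_vecI simp: vec_closed\<close>)
  then have "\<pi> x = (\<lambda>_. \<zero>)" if "x \<in> lspan {..<N} B" for x using that by auto
  moreover have "(\<lambda>_. \<zero>) \<in> lspan {..<N} B" using submodule_vecD(2)[OF module_span_vec(1)[OF B(2)]] .
  moreover have "(\<lambda>_ _. \<zero>) \<in> module_hom R (free_module R {..<N}) (ideal_dsum R {..<0 :: nat} J)" for J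
    by (rule module_homI) (auto simp: ideal_dsum_carrier)
  ultimately have "stacked_splitting N (lspan {..<N} B) \<pi> (Idl G) 0 J I (\<lambda>_ _. \<zero>) \<pi>" for J I
    unfolding stacked_splitting_def using 0(1,2) by (auto simp: finite_ideal_dsum_carrier image_constant_conv)
  then show ?case by blast
next
  case (Suc n \<pi> G u)
  let ?U = "{..<N}" and ?H = "lspan {..<N} B"
  note H = module_span_vec(1)[OF B(2)] and BH = module_span_vec(2)[OF B(2)]
  note Hm = submodule_vecD[OF H] and \<pi>d = vec_homD[OF Suc.prems(1)]
  note \<pi>\<pi> = Suc.prems(2) and \<pi>H = Suc.prems(3)
  have Bv: "b \<in> vec ?U" if "b \<in> B" for b using B(2) that by auto
  let ?C = "\<Union>b\<in>B. range (\<pi> b)"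
  have C: "?C \<subseteq> carrier R" using range_vec[OF \<pi>d(1)[OF Bv]] by auto
  have finC: "finite ?C" using B(1) finite_range_vec[OF finite_lessThan \<pi>d(1)[OF Bv]] by auto
  obtain w where w: "support w ?C" using support_exists[OF finC C] by blast
  note wc = supportD(1)[OF w]
  have uw: "u \<otimes> w = w" by (rule support_mult[OF w C Suc.prems(8)]) (use Suc.prems(9) in auto)
  define c where "c = Idl ?C"
  have c: "ideal c R" unfolding c_def by (rule genideal_ideal[OF C])
  note cc = ideal_closed[OF c]
  have Cc: "?C \<subseteq> c" unfolding c_def by (rule genideal_self[OF C])
  obtain p g h where p: "p \<in> End ?U" and g: "g \<in> dual ?U" and h: "h \<in> vec ?U" and ph: "p h = h"
    and hw: "support w (range h)"
    and pp: "\<And>x. x \<in> vec ?U \<Longrightarrow> p (p x) = p x" and \<pi>p: "\<And>x. x \<in> vec ?U \<Longrightarrow> \<pi> (p x) = p x"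
    and wp: "\<And>x. x \<in> vec ?U \<Longrightarrow> (\<lambda>i. w \<otimes> p x i) = p x"
    and gp: "\<And>x. x \<in> vec ?U \<Longrightarrow> g (p x) = \<zero> \<Longrightarrow> p x = (\<lambda>_. \<zero>)"
    and pH: "\<And>x. x \<in> ?H \<Longrightarrow> p (\<pi> x) \<in> ?H"
    and gpH: "\<And>x. x \<in> ?H \<Longrightarrow> g (p (\<pi> x)) \<in> (Idl ?C) \<cdot> ((\<lambda>y. g (p y)) ` vec ?U)"
    and cp: "\<And>a y. a \<in> Idl ?C \<Longrightarrow> y \<in> vec ?U \<Longrightarrow> (\<lambda>i. a \<otimes> p y i) \<in> ?H"
    by (rule split_rank_one_summand[OF alg B d _ Suc.prems(1) _ _ w]) (rule sat \<pi>\<pi> \<pi>H that; assumption)+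
  note gpH = gpH[folded c_def] and cp = cp[folded c_def]
  note pd = vec_homD[OF p] and gd = dualD[OF g]
  \<comment> \<open>The projection onto the complement of the image of \<open>p\<close> within the
    image of \<open>\<pi>\<close>. The map subtracted is \<open>p\<close> after
    \<open>\<pi>\<close>, as \<open>p\<close> need not vanish on the kernel of
    \<open>\<pi>\<close>.\<close>
  define \<pi>' where "\<pi>' = (\<lambda>x i. \<pi> x i \<ominus> p (\<pi> x) i)"
  have \<pi>'v: "\<pi>' x \<in> vec ?U" if "x \<in> vec ?U" for x
    unfolding \<pi>'_def using \<pi>d(1)[OF that] pd(1)[OF \<pi>d(1)[OF that]] by (rule vec_closed(4))
  have k: "\<pi> x i \<in> carrier R" "p (\<pi> x) i \<in> carrier R" if "x \<in> vec ?U" for x i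
    using vecD(1)[OF \<pi>d(1)[OF that]] vecD(1)[OF pd(1)[OF \<pi>d(1)[OF that]]] by auto
  have \<pi>': "\<pi>' \<in> End ?U"
    unfolding \<pi>'_def by (rule vec_hom_diff[OF Suc.prems(1) module_hom_comp[OF Suc.prems(1) p]])
  note \<pi>'d = vec_homD[OF \<pi>']
  have decomp: "\<pi> x = (\<lambda>i. p (\<pi> x) i \<oplus> \<pi>' x i)" if x: "x \<in> vec ?U" for x
  proof
    fix i
    show "\<pi> x i = p (\<pi> x) i \<oplus> \<pi>' x i" unfolding \<pi>'_def using k[OF x, of i] by algebra
  qed
  have p\<pi>': "p (\<pi>' x) = (\<lambda>_. \<zero>)" if x: "x \<in> vec ?U" for x
    unfolding \<pi>'_def pd(5)[OF \<pi>d(1)[OF x] pd(1)[OF \<pi>d(1)[OF x]]] pp[OF \<pi>d(1)[OF x]]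
    using k(2)[OF x] by (simp add: a_minus_def r_neg)
  have \<pi>\<pi>': "\<pi> (\<pi>' x) = \<pi>' x" if x: "x \<in> vec ?U" for x
    unfolding \<pi>'_def \<pi>d(5)[OF \<pi>d(1)[OF x] pd(1)[OF \<pi>d(1)[OF x]]] \<pi>\<pi>[OF x] \<pi>p[OF \<pi>d(1)[OF x]] ..
  have \<pi>'\<pi>: "\<pi>' (\<pi> x) = \<pi>' x" if x: "x \<in> vec ?U" for x
    unfolding \<pi>'_def \<pi>\<pi>[OF x] ..
  have \<pi>'p: "\<pi>' (p x) = (\<lambda>_. \<zero>)" if x: "x \<in> vec ?U" for x
    unfolding \<pi>'_def \<pi>p[OF x] pp[OF x]
    using vecD(1)[OF pd(1)[OF x]] by (simp add: a_minus_def r_neg)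
  have \<pi>'\<pi>': "\<pi>' (\<pi>' x) = \<pi>' x" if x: "x \<in> vec ?U" for x
  proof -
    have "\<pi>' y = (\<lambda>i. \<pi> y i \<ominus> p (\<pi> y) i)" for y unfolding \<pi>'_def ..
    from this[of "\<pi>' x"] have "\<pi>' (\<pi>' x) = (\<lambda>i. \<pi>' x i \<ominus> \<zero>)" unfolding \<pi>\<pi>'[OF x] p\<pi>'[OF x] .
    then show ?thesis using vecD(1)[OF \<pi>'v[OF x]] by (simp add: a_minus_def)
  qed
  have \<pi>'H: "\<pi>' x \<in> ?H" if "x \<in> ?H" for x
    unfolding \<pi>'_def using Hm(5)[OF \<pi>H[OF that] pH[OF that]] .
  \<comment> \<open>The content \<open>c\<close> is faithful only on its support \<open>w\<close>;
    off \<open>w\<close> it is completed by the preceding ideal. This makes the new ideal faithful,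
    hence invertible, and keeps it inside the preceding one. Its product with the new summand ideal
    is that of \<open>c\<close>, because \<open>w\<close> fixes the summand.\<close>
  define G' where "G' = ?C \<union> (\<lambda>a. (\<one> \<ominus> w) \<otimes> a) ` G"
  have G': "finite G'" "G' \<subseteq> carrier R" unfolding G'_def using finC C Suc.prems(4,5) wc by auto
  note G'i = genideal_ideal[OF G'(2)] and G's = genideal_self[OF G'(2)]
  have cG': "c \<subseteq> Idl G'" unfolding c_def by (rule subset_Idl_subset[OF G'(2)]) (simp add: G'_def)
  have G'supp: "support \<one> G'"
  proof (rule supportI)
    fix r assume r: "r \<in> carrier R" "\<And>x. x \<in> G' \<Longrightarrow> r \<otimes> x = \<zero>"
    have rw: "r \<otimes> w = \<zero>" using r by (intro supportD(3)[OF w]) (auto simp: G'_def)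
    have "r \<otimes> a = \<zero>" if "a \<in> G" for a
    proof -
      have a: "a \<in> carrier R" using that Suc.prems(5) by auto
      have "r \<otimes> a = r \<otimes> ((\<one> \<ominus> w) \<otimes> a) \<oplus> (r \<otimes> w) \<otimes> a" using a r(1) wc by algebra
      also have "\<dots> = \<zero>" unfolding rw using r(2)[of "(\<one> \<ominus> w) \<otimes> a"] that a by (auto simp: G'_def)
      finally show ?thesis .
    qed
    then show "r \<otimes> \<one> = \<zero>" using r(1) by (intro supportD(3)[OF Suc.prems(6)])
  qed (use G'(2) in auto)
  have Gi: "ideal (Idl G) R" by (rule genideal_ideal[OF Suc.prems(5)])
  have G'G: "Idl G' \<subseteq> Idl G"
  proof (rule Idl_subsetI[OF Gi])
    show "G' \<subseteq> Idl G"
      unfolding G'_def using Suc.prems(7) genideal_self[OF Suc.prems(5)] wc ideal_closed(3)[OF Gi] by auto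
  qed
  \<comment> \<open>Linear maps do not enlarge contents, so subtracting \<open>p (\<pi> b)\<close>
    stays within \<open>c\<close>. This gives the descending chain.\<close>
  have \<pi>'G': "\<pi>' b i \<in> Idl G'" if b: "b \<in> B" for b i
  proof -
    have \<pi>b: "\<pi> b j \<in> c" for j using Cc b by auto
    have "(\<lambda>z. p z i) \<in> dual ?U" using module_hom_comp[OF p coordinate_dual[of i ?U]] by simp
    then have "p (\<pi> b) i \<in> c" by (rule dual_mem_ideal[OF finite_lessThan c _ \<pi>d(1)[OF Bv[OF b]] \<pi>b])
    then show ?thesis unfolding \<pi>'_def using ideal_minus[OF c \<pi>b] cG' by auto
  qed
  have w\<pi>': "w \<otimes> \<pi>' b i = \<pi>' b i" if b: "b \<in> B" for b i
  proof -
    have 1: "w \<otimes> \<pi> b i = \<pi> b i" using supportD(2)[OF w] b by auto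
    have 2: "w \<otimes> p (\<pi> b) i = p (\<pi> b) i" using wp[OF \<pi>d(1)[OF Bv[OF b]]] by (rule fun_cong)
    have "w \<otimes> \<pi>' b i = w \<otimes> \<pi> b i \<ominus> w \<otimes> p (\<pi> b) i"
      unfolding \<pi>'_def using k[OF Bv[OF b], of i] wc by algebra
    then show ?thesis unfolding 1 2 \<pi>'_def .
  qed
  \<comment> \<open>The vector \<open>h\<close> is appended to \<open>n\<close> vectors of the
    complement, and the old bound gives a relation. Applying \<open>p\<close>, which kills the
    complement and fixes \<open>h\<close>, shows that the coefficient of \<open>h\<close> is
    annihilated by \<open>w\<close>. It lies below \<open>\<epsilon>\<close> and therefore below
    \<open>w\<close>, so it is zero, and the relation is one among the original vectors.\<close>
  have rank: "rank_bound N n \<pi>' w"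
    unfolding rank_bound_def
  proof (intro ballI impI)
    fix \<xi> \<epsilon> assume \<xi>: "\<xi> \<in> module_hom R (free_module R {..<n}) (free_module R ?U)" and \<epsilon>: "\<epsilon> \<in> carrier R"
      and \<xi>\<pi>: "\<forall>c\<in>vec {..<n}. \<pi>' (\<xi> c) = \<xi> c" and \<epsilon>0: "\<epsilon> \<noteq> \<zero>" "\<epsilon> \<otimes> \<epsilon> = \<epsilon>" and w\<epsilon>: "w \<otimes> \<epsilon> = \<epsilon>"
    note \<xi>d = vec_homD[OF \<xi>]
    define \<tau> where "\<tau> c i = (if i < n then c i else \<zero>)" for c :: "nat \<Rightarrow> 'a" and i
    have \<tau>v: "\<tau> c \<in> vec {..<n}" if "c \<in> vec {..<Suc n}" for c
      unfolding \<tau>_def vec_iff[OF finite_lessThan] using vecD(1)[OF that] by auto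
    define \<eta> where "\<eta> c i = \<xi> (\<tau> c) i \<oplus> c n \<otimes> h i" for c i
    have hc: "h i \<in> carrier R" for i using vecD(1)[OF h] .
    have \<eta>: "\<eta> \<in> module_hom R (free_module R {..<Suc n}) (free_module R ?U)"
      using free_hom_extend[OF module_free \<xi> h] unfolding \<eta>_def \<tau>_def by simp
    have \<pi>h: "\<pi> h = h" using \<pi>p[OF h] unfolding ph .
    have \<eta>\<pi>: "\<pi> (\<eta> c) = \<eta> c" if c: "c \<in> vec {..<Suc n}" for c
    proof -
      note \<tau>c = \<tau>v[OF c] and cn = vecD(1)[OF c, of n]
      have "\<pi> (\<xi> (\<tau> c)) = \<xi> (\<tau> c)" using \<pi>\<pi>'[OF \<xi>d(1)[OF \<tau>c]] \<xi>\<pi> \<tau>c by simp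
      then show ?thesis unfolding \<eta>_def
        using \<pi>d(2)[OF \<xi>d(1)[OF \<tau>c] vec_closed(3)[OF h cn]] \<pi>d(3)[OF h cn] \<pi>h by simp
    qed
    have "u \<otimes> \<epsilon> = \<epsilon>" using uw w\<epsilon> m_assoc[OF Suc.prems(8) wc \<epsilon>] by simp
    then obtain e where e: "e \<in> vec {..<Suc n}" "e \<noteq> (\<lambda>_. \<zero>)" "(\<lambda>i. \<epsilon> \<otimes> e i) = e" "\<eta> e = (\<lambda>_. \<zero>)"
      using Suc.prems(10) \<eta> \<epsilon> \<eta>\<pi> \<epsilon>0 unfolding rank_bound_def by blast
    note \<tau>e = \<tau>v[OF e(1)] and en = vecD(1)[OF e(1), of n]
    have p\<xi>: "p (\<xi> (\<tau> e)) = (\<lambda>_. \<zero>)" using p\<pi>'[OF \<xi>d(1)[OF \<tau>e]] \<xi>\<pi> \<tau>e by simp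
    have "p (\<eta> e) = (\<lambda>i. e n \<otimes> h i)"
      unfolding \<eta>_def
      using pd(2)[OF \<xi>d(1)[OF \<tau>e] vec_closed(3)[OF h en]] pd(3)[OF h en] ph p\<xi> hc en by simp
    then have "(\<lambda>i. e n \<otimes> h i) = (\<lambda>_. \<zero>)" using e(4) pd(4) by simp
    then have "e n \<otimes> h i = \<zero>" for i by (rule fun_cong)
    then have enw: "e n \<otimes> w = \<zero>" using en by (intro supportD(3)[OF hw]) auto
    have "\<epsilon> \<otimes> e n = e n" using e(3) by (rule fun_cong)
    then have "e n = (e n \<otimes> w) \<otimes> \<epsilon>" using w\<epsilon> m_comm[OF \<epsilon> en] m_assoc[OF en wc \<epsilon>] by simp
    then have en0: "e n = \<zero>" unfolding enw using \<epsilon> by simp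
    have ev: "e \<in> vec {..<n}"
      unfolding vec_iff[OF finite_lessThan] using vecD[OF e(1)] en0 by (auto simp: less_Suc_eq)
    have "\<tau> e = e" unfolding \<tau>_def using vecD(2)[OF ev] by auto
    then have "\<xi> e = \<eta> e" unfolding \<eta>_def en0 using vecD(1)[OF \<xi>d(1)[OF ev]] hc by simp
    then show "\<exists>c\<in>vec {..<n}. c \<noteq> (\<lambda>_. \<zero>) \<and> (\<lambda>i. \<epsilon> \<otimes> c i) = c \<and> \<xi> c = (\<lambda>_. \<zero>)" using ev e by auto
  qed
  obtain m J I \<phi> \<rho> where split: "stacked_splitting N ?H \<pi>' (Idl G') m J I \<phi> \<rho>"
    using Suc.IH[OF \<pi>' \<pi>'\<pi>' \<pi>'H G' G'supp \<pi>'G' wc w\<pi>' rank] by blast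
  note Jfg = stacked_splittingD(1)[OF split] and Iinv = stacked_splittingD(2)[OF split]
    and IG' = stacked_splittingD(3)[OF split] and Imono = stacked_splittingD(4)[OF split]
    and \<rho> = stacked_splittingD(5)[OF split] and \<phi> = stacked_splittingD(6)[OF split]
    and \<rho>\<rho> = stacked_splittingD(7)[OF split] and \<rho>\<pi>' = stacked_splittingD(8)[OF split]
    and \<pi>'\<rho> = stacked_splittingD(9)[OF split] and \<phi>\<pi>' = stacked_splittingD(10)[OF split]
    and \<phi>\<rho> = stacked_splittingD(11)[OF split] and inj = stacked_splittingD(12)[OF split]
    and surj = stacked_splittingD(13)[OF split] and \<rho>H = stacked_splittingD(14)[OF split]
    and \<phi>H = stacked_splittingD(15)[OF split]
  note \<phi>d = dsum_homD[OF \<phi> fg_ideal_ideal[OF Jfg], simplified] and \<rho>d = vec_homD[OF \<rho>]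
  have gp': "(\<lambda>y. g (p y)) \<in> dual ?U" by (rule module_hom_comp[OF p g])
  note gpd = dualD[OF gp']
  define J0 where "J0 = (\<lambda>y. g (p y)) ` vec ?U"
  have J0fg: "fg_ideal R J0"
    unfolding fg_ideal_def J0_def dual_image[OF finite_lessThan gp']
    by (rule exI, intro conjI) (use gpd(1) in \<open>auto simp: unit_vec_closed\<close>)
  \<comment> \<open>The new summand takes index \<open>0\<close>: the ideals of the complement are
    contained in its ideal, so the order is the descending one.\<close>
  define K where "K = (\<lambda>i. case i of 0 \<Rightarrow> J0 | Suc i \<Rightarrow> J i)"
  define L where "L = (\<lambda>i. case i of 0 \<Rightarrow> Idl G' | Suc i \<Rightarrow> I i)"
  define \<psi> where "\<psi> = (\<lambda>x i. case i of 0 \<Rightarrow> g (p (\<pi> x)) | Suc i \<Rightarrow> \<phi> x i)"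
  have K: "K 0 = J0" "\<And>i. K (Suc i) = J i" and L: "L 0 = Idl G'" "\<And>i. L (Suc i) = I i"
    and \<psi>: "\<And>x. \<psi> x 0 = g (p (\<pi> x))" "\<And>x i. \<psi> x (Suc i) = \<phi> x i"
    unfolding K_def L_def \<psi>_def by auto
  have \<psi>eq: "\<psi> x = y \<longleftrightarrow> g (p (\<pi> x)) = y 0 \<and> \<phi> x = (\<lambda>i. y (Suc i))" for x y
    unfolding fun_eq_iff by (subst all_nat_iff_Suc) (simp add: \<psi>)
  have \<pi>\<rho>: "\<pi> (\<rho> x) = \<rho> x" if x: "x \<in> vec ?U" for x
    using \<pi>\<pi>'[OF \<rho>d(1)[OF x]] unfolding \<pi>'\<rho>[OF x] .
  have p\<rho>: "p (\<rho> x) = (\<lambda>_. \<zero>)" if x: "x \<in> vec ?U" for x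
    using p\<pi>'[OF \<rho>d(1)[OF x]] unfolding \<pi>'\<rho>[OF x] .
  have \<rho>\<pi>: "\<rho> (\<pi> x) = \<rho> x" if x: "x \<in> vec ?U" for x
    using \<rho>\<pi>'[OF \<pi>d(1)[OF x]] \<rho>\<pi>'[OF x] unfolding \<pi>'\<pi>[OF x] by simp
  have \<phi>\<pi>: "\<phi> (\<pi> x) = \<phi> x" if x: "x \<in> vec ?U" for x
    using \<phi>\<pi>'[OF \<pi>d(1)[OF x]] \<phi>\<pi>'[OF x] unfolding \<pi>'\<pi>[OF x] by simp
  have \<phi>p: "\<phi> (p x) = (\<lambda>_. \<zero>)" if x: "x \<in> vec ?U" for x
    using \<phi>\<pi>'[OF pd(1)[OF x]] \<phi>d(4) unfolding \<pi>'p[OF x] by simp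
  have \<rho>p: "\<rho> (p x) = (\<lambda>_. \<zero>)" if x: "x \<in> vec ?U" for x
    using \<rho>\<pi>'[OF pd(1)[OF x]] \<rho>d(4) unfolding \<pi>'p[OF x] by simp
  \<comment> \<open>The components can be prescribed independently: \<open>g\<close> after
    \<open>p\<close> sees only the part \<open>p l\<close>, while \<open>\<phi>\<close> and
    \<open>\<rho>\<close> see only the part \<open>\<pi>' x\<close>.\<close>
  have combine: "g (p (\<pi> (\<lambda>i. p l i \<oplus> \<pi>' x i))) = g (p l)" "\<phi> (\<lambda>i. p l i \<oplus> \<pi>' x i) = \<phi> x"
    "\<rho> (\<lambda>i. p l i \<oplus> \<pi>' x i) = \<rho> x" if l: "l \<in> vec ?U" and x: "x \<in> vec ?U" for l x
  proof -
    note pl = pd(1)[OF l] and \<pi>x = \<pi>'v[OF x]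
    have "\<pi> (\<lambda>i. p l i \<oplus> \<pi>' x i) = (\<lambda>i. p l i \<oplus> \<pi>' x i)"
      unfolding \<pi>d(2)[OF pl \<pi>x] \<pi>p[OF l] \<pi>\<pi>'[OF x] ..
    moreover have "p (\<lambda>i. p l i \<oplus> \<pi>' x i) = p l"
      unfolding pd(2)[OF pl \<pi>x] pp[OF l] p\<pi>'[OF x] using vecD(1)[OF pl] by simp
    ultimately show "g (p (\<pi> (\<lambda>i. p l i \<oplus> \<pi>' x i))) = g (p l)" by simp
    show "\<phi> (\<lambda>i. p l i \<oplus> \<pi>' x i) = \<phi> x"
      unfolding \<phi>d(2)[OF pl \<pi>x] \<phi>p[OF l] \<phi>\<pi>'[OF x] using \<phi>d(5)[OF x] by simp
    show "\<rho> (\<lambda>i. p l i \<oplus> \<pi>' x i) = \<rho> x"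
      unfolding \<rho>d(2)[OF pl \<pi>x] \<rho>p[OF l] \<rho>\<pi>'[OF x] using vecD(1)[OF \<rho>d(1)[OF x]] by simp
  qed
  have "stacked_splitting N ?H \<pi> (Idl G) (Suc m) K L \<psi> \<rho>"
    unfolding stacked_splitting_def
  proof (intro conjI allI impI ballI)
    show "fg_ideal R (K i)" if "i < Suc m" for i using that Jfg J0fg K by (cases i) auto
    show "invertible_ideal R (L i)" if "i < Suc m" for i
      using that Iinv faithful_fg_invertible[OF G' G'supp] L by (cases i) auto
    show "L i \<subseteq> Idl G" if "i < Suc m" for i
      using that IG' G'G L by (cases i) auto
    show "L j \<subseteq> L i" if "i \<le> j \<and> j < Suc m" for i j
      using that Imono IG' L by (cases i; cases j) auto
    show "\<rho> \<in> End ?U" by (rule \<rho>)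
    show "\<psi> \<in> module_hom R (free_module R ?U) (ideal_dsum R {..<Suc m} K)"
    proof (rule module_homI)
      show "\<psi> x \<in> carrier (ideal_dsum R {..<Suc m} K)" if x: "x \<in> vec ?U" for x
        unfolding dsum_Suc_iff K \<psi> using \<phi>d(1)[OF x] \<pi>d(1)[OF x] unfolding J0_def by auto
      show "\<psi> (x \<oplus>\<^bsub>free_module R ?U\<^esub> y) = \<psi> x \<oplus>\<^bsub>ideal_dsum R {..<Suc m} K\<^esub> \<psi> y"
        if xy: "x \<in> vec ?U" "y \<in> vec ?U" for x y
        unfolding \<psi>eq ideal_dsum_simps \<psi>
        unfolding \<pi>d(2)[OF xy] gpd(2)[OF \<pi>d(1)[OF xy(1)] \<pi>d(1)[OF xy(2)]] \<phi>d(2)[OF xy] by simp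
      show "\<psi> (r \<odot>\<^bsub>free_module R ?U\<^esub> x) = r \<odot>\<^bsub>ideal_dsum R {..<Suc m} K\<^esub> \<psi> x"
        if r: "r \<in> carrier R" and x: "x \<in> vec ?U" for r x
        unfolding \<psi>eq ideal_dsum_simps \<psi>
        unfolding \<pi>d(3)[OF x r] gpd(3)[OF \<pi>d(1)[OF x] r] \<phi>d(3)[OF x r] by simp
    qed
    fix x assume x: "x \<in> vec ?U"
    show "\<rho> (\<rho> x) = \<rho> x" "\<rho> (\<pi> x) = \<rho> x" "\<pi> (\<rho> x) = \<rho> x" by (fact \<rho>\<rho>[OF x] \<rho>\<pi>[OF x] \<pi>\<rho>[OF x])+
    show "\<psi> (\<pi> x) = \<psi> x" unfolding \<psi>eq \<psi> \<pi>\<pi>[OF x] \<phi>\<pi>[OF x] by simp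
    show "\<psi> (\<rho> x) = (\<lambda>_. \<zero>)" unfolding \<psi>eq \<pi>\<rho>[OF x] p\<rho>[OF x] gd(4) \<phi>\<rho>[OF x] by simp
    show "\<pi> x = (\<lambda>_. \<zero>)" if a: "\<psi> x = (\<lambda>_. \<zero>)" "\<rho> x = (\<lambda>_. \<zero>)"
    proof -
      have "p (\<pi> x) = (\<lambda>_. \<zero>)" using a(1) gp[OF \<pi>d(1)[OF x]] unfolding \<psi>eq by simp
      moreover have "\<pi>' x = (\<lambda>_. \<zero>)" using a inj[OF x] unfolding \<psi>eq by simp
      ultimately show ?thesis using decomp[OF x] by simp
    qed
  next
    fix y assume "y \<in> carrier (ideal_dsum R {..<Suc m} K)"
    then have y: "y 0 \<in> J0" "(\<lambda>i. y (Suc i)) \<in> carrier (ideal_dsum R {..<m} J)"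
      unfolding dsum_Suc_iff K by auto
    obtain l where l: "l \<in> vec ?U" "y 0 = g (p l)" using y(1) unfolding J0_def by auto
    obtain x where x: "x \<in> vec ?U" "\<phi> x = (\<lambda>i. y (Suc i))" "\<rho> x = (\<lambda>_. \<zero>)" using surj[OF y(2)] by auto
    note cb = combine[OF l(1) x(1)]
    show "\<exists>x\<in>vec ?U. \<psi> x = y \<and> \<rho> x = (\<lambda>_. \<zero>)"
      by (rule bexI[OF _ vec_closed(2)[OF pd(1)[OF l(1)] \<pi>'v[OF x(1)]]])
        (use cb l(2) x(2,3) in \<open>simp add: \<psi>eq\<close>)
  next
    show "\<rho> x = (\<lambda>_. \<zero>)" if "x \<in> ?H" for x by (rule \<rho>H[OF that])
    show "\<psi> ` ?H = carrier (ideal_dsum R {..<Suc m} (\<lambda>i. L i \<cdot> K i))"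
    proof (intro subset_antisym subsetI)
      fix y assume "y \<in> \<psi> ` ?H"
      then obtain x where x: "x \<in> ?H" "y = \<psi> x" by auto
      have "g (p (\<pi> x)) \<in> (Idl G') \<cdot> J0" using ideal_prod_mono[OF cG' gpH[OF x(1)]] unfolding J0_def .
      moreover have "\<phi> x \<in> carrier (ideal_dsum R {..<m} (\<lambda>i. I i \<cdot> J i))" using \<phi>H x by auto
      ultimately show "y \<in> carrier (ideal_dsum R {..<Suc m} (\<lambda>i. L i \<cdot> K i))"
        unfolding dsum_Suc_iff K L x(2) \<psi> by simp
    next
      fix y assume "y \<in> carrier (ideal_dsum R {..<Suc m} (\<lambda>i. L i \<cdot> K i))"
      then have y: "y 0 \<in> (Idl G') \<cdot> J0" "(\<lambda>i. y (Suc i)) \<in> carrier (ideal_dsum R {..<m} (\<lambda>i. I i \<cdot> J i))"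
        unfolding dsum_Suc_iff K L by auto
      \<comment> \<open>Multiplication by \<open>w\<close> removes the part added to
        \<open>c\<close> in \<open>G'\<close>. As \<open>w\<close> fixes the image of
        \<open>p\<close>, a multiple of \<open>p l\<close> by an element of the larger ideal is also
        one by an element of \<open>c\<close>, and hence is in \<open>H\<close>.\<close>
      have wG': "w \<otimes> a \<in> c" if a: "a \<in> Idl G'" for a
      proof -
        have "ideal {a \<in> carrier R. w \<otimes> a \<in> c} R"
          by (rule idealI') (use cc wc in \<open>auto simp: r_distr m_lcomm\<close>)
        moreover have "G' \<subseteq> {a \<in> carrier R. w \<otimes> a \<in> c}"
        proof
          fix z assume z: "z \<in> G'"
          then consider "z \<in> ?C" | a where "a \<in> G" "z = (\<one> \<ominus> w) \<otimes> a" unfolding G'_def by blast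
          then show "z \<in> {a \<in> carrier R. w \<otimes> a \<in> c}"
          proof cases
            case 1
            show ?thesis using subsetD[OF Cc 1] subsetD[OF C 1] cc(3)[OF _ wc] by simp
          next
            case 2
            have a: "a \<in> carrier R" using 2 Suc.prems(5) by auto
            have "w \<otimes> z = (w \<ominus> w \<otimes> w) \<otimes> a" unfolding 2(2) using a wc by algebra
            also have "\<dots> = \<zero>" unfolding support_idem[OF w C] using a wc by (simp add: a_minus_def r_neg)
            finally show ?thesis using z G'(2) cc(1) by auto
          qed
        qed
        ultimately have "Idl G' \<subseteq> {a \<in> carrier R. w \<otimes> a \<in> c}" by (rule Idl_subsetI)
        then show ?thesis using a by auto
      qed
      have "\<exists>l\<in>vec ?U. p l \<in> ?H \<and> y 0 = g (p l)" using y(1)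
      proof (induction rule: ideal_prod.induct)
        case (prod a j)
        then obtain l where l: "l \<in> vec ?U" "j = g (p l)" unfolding J0_def by auto
        have a: "a \<in> carrier R" using ideal_closed(5)[OF G'i prod(1)] .
        have wa: "(\<lambda>i. (w \<otimes> a) \<otimes> p l i) = (\<lambda>i. a \<otimes> p l i)"
        proof
          fix i
          have "w \<otimes> p l i = p l i" using wp[OF l(1)] by (rule fun_cong)
          moreover have "(w \<otimes> a) \<otimes> p l i = a \<otimes> (w \<otimes> p l i)" using vecD(1)[OF pd(1)[OF l(1)], of i] wc a by algebra
          ultimately show "(w \<otimes> a) \<otimes> p l i = a \<otimes> p l i" by simp
        qed
        have "p (\<lambda>i. a \<otimes> l i) \<in> ?H" unfolding pd(3)[OF l(1) a] using cp[OF wG'[OF prod(1)] l(1)] unfolding wa .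
        moreover have "a \<otimes> j = g (p (\<lambda>i. a \<otimes> l i))" using gpd(3)[OF l(1) a] l(2) by simp
        ultimately show ?case using vec_closed(3)[OF l(1) a] by blast
      next
        case (sum s t)
        then obtain l k where l: "l \<in> vec ?U" "p l \<in> ?H" "s = g (p l)" and k: "k \<in> vec ?U" "p k \<in> ?H" "t = g (p k)"
          by auto
        have "p (\<lambda>i. l i \<oplus> k i) \<in> ?H" unfolding pd(2)[OF l(1) k(1)] by (rule Hm(3)[OF l(2) k(2)])
        moreover have "s \<oplus> t = g (p (\<lambda>i. l i \<oplus> k i))" using gpd(2)[OF l(1) k(1)] l(3) k(3) by simp
        ultimately show ?case using vec_closed(2)[OF l(1) k(1)] by blast
      qed
      then obtain l where l: "l \<in> vec ?U" "p l \<in> ?H" "y 0 = g (p l)" by auto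
      obtain x where x: "x \<in> ?H" "\<phi> x = (\<lambda>i. y (Suc i))" using y(2) unfolding \<phi>H[symmetric] by (auto elim!: imageE)
      note xv = Hm(1)[OF x(1)]
      have "\<psi> (\<lambda>i. p l i \<oplus> \<pi>' x i) = y" using combine(1,2)[OF l(1) xv] l(3) x(2) by (simp add: \<psi>eq)
      then show "y \<in> \<psi> ` ?H" using Hm(3)[OF l(2) \<pi>'H[OF x(1)]] by (intro image_eqI[of _ \<psi>]) auto
    qed
  qed
  then show ?case by blast
qed

end

section \<open>Stacked bases\<close>

lemma module_iso_comp:
  assumes "f \<in> module_iso R L M" "g \<in> module_iso R M N"
  shows "(\<lambda>x. g (f x)) \<in> module_iso R L N"
  using assms module_hom_comp[of f R L M g N] bij_betw_trans[of f "carrier L" "carrier M" g "carrier N"]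
  unfolding module_iso_def by (simp add: comp_def)

lemma module_iso_inv:
  assumes "module R M" "f \<in> module_iso R M N"
  shows "inv_into (carrier M) f \<in> module_iso R N M"
proof -
  interpret M: module R M by fact
  have hom: "f \<in> module_hom R M N" and bij: "bij_betw f (carrier M) (carrier N)"
    using assms(2) unfolding module_iso_def by auto
  let ?g = "inv_into (carrier M) f"
  have bij': "bij_betw ?g (carrier N) (carrier M)" by (rule bij_betw_inv_into[OF bij])
  have gc: "?g y \<in> carrier M" if "y \<in> carrier N" for y using bij' that by (auto dest: bij_betwE)
  have fg: "f (?g y) = y" if "y \<in> carrier N" for y using bij_betw_inv_into_right[OF bij that] .
  have gf: "?g (f x) = x" if "x \<in> carrier M" for x using bij_betw_inv_into_left[OF bij that] .
  have "?g \<in> module_hom R N M"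
  proof (rule module_homI[OF gc])
    show "?g (x \<oplus>\<^bsub>N\<^esub> y) = ?g x \<oplus>\<^bsub>M\<^esub> ?g y" if "x \<in> carrier N" "y \<in> carrier N" for x y
      using gf[of "?g x \<oplus>\<^bsub>M\<^esub> ?g y"] module_hom_add[OF hom gc[OF that(1)] gc[OF that(2)]] gc that fg by simp
    show "?g (r \<odot>\<^bsub>N\<^esub> x) = r \<odot>\<^bsub>M\<^esub> ?g x" if "r \<in> carrier R" "x \<in> carrier N" for r x
      using gf[of "r \<odot>\<^bsub>M\<^esub> ?g x"] module_hom_smult[OF hom that(1) gc[OF that(2)]] gc that fg by simp
  qed
  then show ?thesis using bij' unfolding module_iso_def by simp
qed

context cring
begin

section \<open>Finite generation of kernels\<close>

abbreviation unit_vec :: "'x \<Rightarrow> 'x \<Rightarrow> 'a"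
  where "unit_vec u \<equiv> \<lambda>v. if v = u then \<one> else \<zero>"

lemma free_hom_exists:
  fixes n :: nat
  assumes "module R M" "\<And>k. k < n \<Longrightarrow> v k \<in> carrier M"
  shows "\<exists>T\<in>module_hom R (free_module R {..<n}) M. \<forall>k<n. T (unit_vec k) = v k"
  using assms(2)
proof (induction n)
  case 0
  interpret M: module R M by fact
  have "(\<lambda>_. \<zero>\<^bsub>M\<^esub>) \<in> module_hom R (free_module R {..<0 :: nat}) M" by (rule module_homI) auto
  then show ?case by blast
next
  case (Suc n)
  interpret M: module R M by fact
  obtain T where T: "T \<in> module_hom R (free_module R {..<n}) M" "\<And>k. k < n \<Longrightarrow> T (unit_vec k) = v k"
    using Suc by auto
  define \<tau> where "\<tau> c i = (if i < n then c i else \<zero>)" for c :: "nat \<Rightarrow> 'a" and i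
  define S where "S x = T (\<tau> x) \<oplus>\<^bsub>M\<^esub> x n \<odot>\<^bsub>M\<^esub> v n" for x
  have vn: "v n \<in> carrier M" using Suc.prems by simp
  have "S \<in> module_hom R (free_module R {..<Suc n}) M"
    unfolding S_def \<tau>_def by (rule free_hom_extend[OF assms(1) T(1) vn])
  moreover have "S (unit_vec k) = v k" if k: "k < Suc n" for k
  proof (cases "k = n")
    case True
    then have "\<tau> (unit_vec k) = (\<lambda>_. \<zero>)" unfolding \<tau>_def by auto
    then show ?thesis unfolding S_def using True vn module_hom_zero[OF module_free assms(1) T(1)] by simp
  next
    case False
    then have "\<tau> (unit_vec k) = unit_vec k" unfolding \<tau>_def using k by auto
    then show ?thesis unfolding S_def using False k T(2)[of k] vn Suc.prems[of k] by simp
  qed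
  ultimately show ?case by blast
qed

lemma hom_diff_zero:
  assumes "module R M" "p \<in> module_hom R (free_module R U) M" "x \<in> vec U" "y \<in> vec U" "p x = p y"
  shows "p (\<lambda>i. x i \<ominus> y i) = \<zero>\<^bsub>M\<^esub>"
proof -
  interpret M: module R M by fact
  have c: "p y \<in> carrier M" using module_hom_closed[OF assms(2,4)] .
  have v: "(\<lambda>i. (\<ominus> \<one>) \<otimes> y i) \<in> vec U" by (rule vec_closed(3)[OF assms(4)]) simp
  have "(\<lambda>i. x i \<ominus> y i) = (\<lambda>i. x i \<oplus> (\<ominus> \<one>) \<otimes> y i)"
    using vecD(1)[OF assms(4)] by (simp add: l_minus a_minus_def)
  then have "p (\<lambda>i. x i \<ominus> y i) = p x \<oplus>\<^bsub>M\<^esub> (\<ominus> \<one>) \<odot>\<^bsub>M\<^esub> p y"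
    using module_hom_add[OF assms(2,3) v] module_hom_smult[OF assms(2) _ assms(4), of "\<ominus> \<one>"] by simp
  also have "\<dots> = \<zero>\<^bsub>M\<^esub>" unfolding assms(5) using c M.smult_l_minus[OF one_closed c] by (simp add: M.M.r_neg)
  finally show ?thesis .
qed

lemma kernel_submodule:
  assumes "module R M" "p \<in> module_hom R (free_module R U) M"
  shows "submodule {x \<in> vec U. p x = \<zero>\<^bsub>M\<^esub>} R (free_module R U)"
proof -
  interpret M: module R M by fact
  have "(\<lambda>_. \<zero>\<^bsub>M\<^esub>) \<in> module_hom R (free_module R U) M" by (rule module_homI) auto
  then show ?thesis by (rule submodule_equalizer[OF assms])
qed

text \<open>Schanuel: if \<open>\<alpha>\<close>, \<open>\<beta>\<close> lift the identity of \<open>M\<close> to maps between two presentations, the kernel is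
  generated by the \<open>x - \<beta>(\<alpha>(x))\<close> for basis vectors \<open>x\<close> and by the image of the other kernel.\<close>

lemma kernel_finitely_generated:
  fixes N :: nat
  assumes fp: "finitely_presented R M" and p: "p \<in> module_hom R (free_module R {..<N}) M"
    and surj: "p ` vec {..<N} = carrier M"
  obtains B where "finite B" "B \<subseteq> vec {..<N}" "{x \<in> vec {..<N}. p x = \<zero>\<^bsub>M\<^esub>} = lspan {..<N} B"
proof -
  have M: "module R M" using fp unfolding finitely_presented_def by simp
  obtain n :: nat and q where q: "q \<in> module_hom R (free_module R {..<n}) M" "q ` vec {..<n} = carrier M"
    "fg_submodule R (free_module R {..<n}) (a_kernel (free_module R {..<n}) M q)"
    using fp unfolding finitely_presented_def by blast
  then obtain C where C: "finite C" "C \<subseteq> vec {..<n}" "a_kernel (free_module R {..<n}) M q = lspan {..<n} C"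
    unfolding fg_submodule_def module_span_def by auto
  have ker: "x \<in> lspan {..<n} C \<longleftrightarrow> x \<in> vec {..<n} \<and> q x = \<zero>\<^bsub>M\<^esub>" for x
    unfolding C(3)[symmetric] a_kernel_def' by simp
  \<comment> \<open>Projectivity of free modules: preimages of the images of the unit vectors are
    chosen, and the resulting equation is extended from the unit vectors.\<close>
  have lift: "\<exists>T\<in>module_hom R (free_module R {..<k}) (free_module R {..<l}). \<forall>x\<in>vec {..<k}. g (T x) = f x"
    if f: "f \<in> module_hom R (free_module R {..<k}) M" and g: "g \<in> module_hom R (free_module R {..<l}) M"
      and gs: "g ` vec {..<l} = carrier M" for f g and k l :: nat
  proof -
    have "\<exists>w\<in>vec {..<l}. g w = f (unit_vec i)" if "i < k" for i
    proof -
      have "f (unit_vec i) \<in> g ` vec {..<l}"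
        unfolding gs using that by (intro module_hom_closed[OF f] unit_vec_closed) auto
      then show ?thesis by auto
    qed
    then obtain w where w: "\<And>i. i < k \<Longrightarrow> w i \<in> vec {..<l}" "\<And>i. i < k \<Longrightarrow> g (w i) = f (unit_vec i)" by metis
    obtain T where T: "T \<in> module_hom R (free_module R {..<k}) (free_module R {..<l})" "\<And>i. i < k \<Longrightarrow> T (unit_vec i) = w i"
      using free_hom_exists[OF module_free[of "{..<l}"], of k w] w(1) by blast
    note gT = module_hom_comp[OF T(1) g]
    have "submodule {x \<in> vec {..<k}. g (T x) = f x} R (free_module R {..<k})"
      by (rule submodule_equalizer[OF M gT f])
    then have "x \<in> {x \<in> vec {..<k}. g (T x) = f x}" if "x \<in> vec {..<k}" for x
      by (rule vec_spanned_by_unit_vecs[OF finite_lessThan _ _ that]) (use T w in \<open>auto simp: unit_vec_closed\<close>)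
    then show ?thesis using T(1) by blast
  qed
  obtain \<alpha> where \<alpha>: "\<alpha> \<in> module_hom R (free_module R {..<N}) (free_module R {..<n})" "\<And>x. x \<in> vec {..<N} \<Longrightarrow> q (\<alpha> x) = p x"
    using lift[OF p q(1,2)] by blast
  obtain \<beta> where \<beta>: "\<beta> \<in> module_hom R (free_module R {..<n}) (free_module R {..<N})" "\<And>x. x \<in> vec {..<n} \<Longrightarrow> p (\<beta> x) = q x"
    using lift[OF q(1) p surj] by blast
  note \<alpha>d = vec_homD[OF \<alpha>(1)] and \<beta>d = vec_homD[OF \<beta>(1)]
  define T where "T = (\<lambda>x i. x i \<ominus> \<beta> (\<alpha> x) i)"
  have Tv: "T x \<in> vec {..<N}" if x: "x \<in> vec {..<N}" for x
    unfolding T_def using x \<beta>d(1)[OF \<alpha>d(1)[OF x]] by (rule vec_closed(4))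
  have id: "(\<lambda>x. x) \<in> End {..<N}" by (rule vec_homI) auto
  have T: "T \<in> End {..<N}" unfolding T_def by (rule vec_hom_diff[OF id module_hom_comp[OF \<alpha>(1) \<beta>(1)]])
  define B where "B = (\<lambda>k. T (unit_vec k)) ` {..<N} \<union> \<beta> ` C"
  have Bv: "B \<subseteq> vec {..<N}" unfolding B_def using C(2) by (auto intro!: Tv \<beta>d(1) unit_vec_closed)
  note H = module_span_vec(1)[OF Bv] and BH = module_span_vec(2)[OF Bv]
  have "{x \<in> vec {..<N}. p x = \<zero>\<^bsub>M\<^esub>} = lspan {..<N} B"
  proof
    show "lspan {..<N} B \<subseteq> {x \<in> vec {..<N}. p x = \<zero>\<^bsub>M\<^esub>}"
    proof (rule module_span_minimal[OF kernel_submodule[OF M p]])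
      have "p (T x) = \<zero>\<^bsub>M\<^esub>" if x: "x \<in> vec {..<N}" for x
        unfolding T_def
        by (rule hom_diff_zero[OF M p x \<beta>d(1)[OF \<alpha>d(1)[OF x]]]) (simp add: \<beta>(2)[OF \<alpha>d(1)[OF x]] \<alpha>(2)[OF x])
      moreover have "p (\<beta> b) = \<zero>\<^bsub>M\<^esub>" if "b \<in> C" for b
        using \<beta>(2)[of b] ker[of b] module_span_vec(2)[OF C(2)] that C(2) by auto
      ultimately show "B \<subseteq> {x \<in> vec {..<N}. p x = \<zero>\<^bsub>M\<^esub>}"
        using Bv unfolding B_def by (auto simp: unit_vec_closed)
    qed
    show "{x \<in> vec {..<N}. p x = \<zero>\<^bsub>M\<^esub>} \<subseteq> lspan {..<N} B"
    proof
      fix x assume "x \<in> {x \<in> vec {..<N}. p x = \<zero>\<^bsub>M\<^esub>}"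
      then have x: "x \<in> vec {..<N}" "p x = \<zero>\<^bsub>M\<^esub>" by auto
      have "\<alpha> x \<in> lspan {..<n} C" unfolding ker using \<alpha>d(1)[OF x(1)] \<alpha>(2)[OF x(1)] x(2) by simp
      then have 1: "\<beta> (\<alpha> x) \<in> lspan {..<N} B"
        by (rule lspan_image[OF \<beta>(1) C(2) Bv, rotated]) (use BH in \<open>auto simp: B_def\<close>)
      have "x \<in> {x \<in> vec {..<N}. T x \<in> lspan {..<N} B}"
        by (rule vec_spanned_by_unit_vecs[OF finite_lessThan submodule_vimage[OF T H] _ x(1)])
          (use BH in \<open>auto simp: unit_vec_closed B_def\<close>)
      then have 2: "T x \<in> lspan {..<N} B" by simp
      have "x i = T x i \<oplus> \<beta> (\<alpha> x) i" for i
        unfolding T_def using vecD(1)[OF x(1), of i] vecD(1)[OF \<beta>d(1)[OF \<alpha>d(1)[OF x(1)]], of i] by algebra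
      then have "x = (\<lambda>i. T x i \<oplus> \<beta> (\<alpha> x) i)" by (rule ext)
      then show "x \<in> lspan {..<N} B" using submodule_vecD(3)[OF H 2 1] by simp
    qed
  qed
  moreover have "finite B" unfolding B_def using C(1) by simp
  ultimately show ?thesis using that Bv by blast
qed

end

context semihereditary_cring
begin

text \<open>The ambient module alone gives this bound, so it starts the process for every
  \<open>\<pi>\<close>, in particular both for the identity and for the projection left over by the
  first run.\<close>

lemma rank_bound_top: "rank_bound N (Suc N) \<pi> u"
  unfolding rank_bound_def
proof (intro ballI impI)
  fix \<xi> \<epsilon> assume \<xi>: "\<xi> \<in> module_hom R (free_module R {..<Suc N}) (free_module R {..<N})"
    and \<epsilon>: "\<epsilon> \<in> carrier R" "\<epsilon> \<noteq> \<zero>" "\<epsilon> \<otimes> \<epsilon> = \<epsilon>"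
  show "\<exists>c\<in>vec {..<Suc N}. c \<noteq> (\<lambda>_. \<zero>) \<and> (\<lambda>i. \<epsilon> \<otimes> c i) = c \<and> \<xi> c = (\<lambda>_. \<zero>)"
  proof (rule linear_relation_exists[OF _ _ \<xi> _ \<epsilon>])
    show "card {..<N} < Suc N" by (simp only: card_lessThan lessI)
    show "\<xi> c i = \<zero>" if "c \<in> vec {..<Suc N}" "i \<notin> {..<N}" for c i
      using vecD(2)[OF vec_homD(1)[OF \<xi> that(1)] that(2)] .
  qed simp
qed

text \<open>The first run leaves the image of \<open>\<rho>\<close>, whose complement, the kernel of
  \<open>\<rho>\<close>, contains \<open>H\<close>. The second run decomposes that image. Putting
  its ideals after those of the first run makes the indices below \<open>m\<close> exactly those
  that carry \<open>H\<close>. Both runs start with the unit ideal, the support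
  \<open>\<one>\<close> and the rank bound \<open>Suc N\<close>.\<close>

lemma stacked_bases_vec:
  fixes N :: nat
  assumes alg: "almost_local_global R" and B: "finite B" "B \<subseteq> vec {..<N}"
  shows "\<exists>(n::nat) m J I \<phi>. m \<le> n \<and> (\<forall>i<n. fg_ideal R (J i)) \<and> (\<forall>i<m. invertible_ideal R (I i)) \<and>
    (\<forall>i j. i \<le> j \<and> j < m \<longrightarrow> I j \<subseteq> I i) \<and>
    \<phi> \<in> module_iso R (free_module R {..<N}) (ideal_dsum R {..<n} J) \<and>
    \<phi> ` lspan {..<N} B = carrier (ideal_dsum R {..<m} (\<lambda>i. I i \<cdot> J i))"
proof -
  let ?U = "{..<N}" and ?H = "lspan {..<N} B"
  note H = module_span_vec(1)[OF B(2)]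
  have Bi: "b i \<in> carrier R" if "b \<in> B" for b i using vecD(1)[of b ?U] B(2) that by auto
  have one: "support \<one> {\<one>}" by (rule supportI) auto
  have van: "b i = \<zero>" if "b \<in> B" "i \<notin> ?U" for b i using vecD(2)[of b ?U i] B(2) that by auto
  have ex: "\<exists>d\<in>regular_elements R. \<forall>x\<in>vec ?U. \<forall>s\<in>regular_elements R.
      (\<lambda>i. s \<otimes> x i) \<in> ?H \<longrightarrow> (\<lambda>i. d \<otimes> x i) \<in> ?H"
    by (rule saturation_bound[of ?U]) (use B van in auto)
  obtain d where d: "d \<in> regular_elements R" "\<And>x s. x \<in> vec ?U \<Longrightarrow> s \<in> regular_elements R \<Longrightarrow>
      (\<lambda>i. s \<otimes> x i) \<in> ?H \<Longrightarrow> (\<lambda>i. d \<otimes> x i) \<in> ?H"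
    using ex by meson
  have id: "(\<lambda>x. x) \<in> End ?U" by (rule vec_homI) auto
  have "\<exists>m J I \<phi> \<rho>. stacked_splitting N ?H (\<lambda>x. x) (Idl {\<one>}) m J I \<phi> \<rho>"
    by (rule stacked_splitting_exists[OF alg B d(1) _ id _ _ _ _ one _ one_closed _ rank_bound_top])
      (use d(2) Bi genideal_one in auto)
  then obtain m J I \<phi> \<rho> where "stacked_splitting N ?H (\<lambda>x. x) (Idl {\<one>}) m J I \<phi> \<rho>" by blast
  note s1 = stacked_splittingD[OF this]
  note \<rho> = s1(5) and \<phi> = s1(6) and J = s1(1)
  note \<rho>d = vec_homD[OF \<rho>] and \<phi>d = dsum_homD[OF \<phi> fg_ideal_ideal[OF J], simplified]
  define E :: "(nat \<Rightarrow> 'a) set" where "E = unit_vec ` ?U"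
  have E: "finite E" "E \<subseteq> vec ?U" unfolding E_def by (auto simp: unit_vec_closed)
  have EU: "lspan ?U E = vec ?U"
  proof
    show "lspan ?U E \<subseteq> vec ?U" using submodule_vecD(1)[OF module_span_vec(1)[OF E(2)]] by auto
    show "vec ?U \<subseteq> lspan ?U E"
      using vec_spanned_by_unit_vecs[OF finite_lessThan module_span_vec(1)[OF E(2)]] module_span_vec(2)[OF E(2)]
      unfolding E_def by auto
  qed
  have Ei: "\<rho> b i \<in> carrier R" if "b \<in> E" for b i using vecD(1)[OF \<rho>d(1)] E(2) that by auto
  \<comment> \<open>For the full module saturation is trivial, so \<open>\<one>\<close> serves as
    \<open>d\<close>. The projection \<open>\<rho>'\<close> vanishes on that module, which means
    that nothing is left over this time.\<close>
  have "\<exists>m J I \<phi> \<rho>'. stacked_splitting N (lspan ?U E) \<rho> (Idl {\<one>}) m J I \<phi> \<rho>'"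
    by (rule stacked_splitting_exists[OF alg E one_regular _ \<rho> _ _ _ _ one _ one_closed _ rank_bound_top])
      (use s1(7) Ei \<rho>d(1) genideal_one in \<open>auto simp: EU vec_closed\<close>)
  then obtain k K I' \<psi> \<rho>' where "stacked_splitting N (vec ?U) \<rho> (Idl {\<one>}) k K I' \<psi> \<rho>'" unfolding EU by blast
  note s2 = stacked_splittingD[OF this]
  note \<psi> = s2(6) and K = s2(1)
  note \<psi>d = dsum_homD[OF \<psi> fg_ideal_ideal[OF K], simplified]
  \<comment> \<open>Concatenation of the two families, with the second shifted by
    \<open>m\<close>.\<close>
  define L where "L i = (if i < m then J i else K (i - m))" for i
  define \<theta> where "\<theta> x i = (if i < m then \<phi> x i else \<psi> x (i - m))" for x i
  have L: "fg_ideal R (L i)" if "i < m + k" for i unfolding L_def using J K that by auto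
  have carr: "y \<in> carrier (ideal_dsum R {..<m + k} L) \<longleftrightarrow>
      (\<lambda>i. if i < m then y i else \<zero>) \<in> carrier (ideal_dsum R {..<m} J) \<and>
      (\<lambda>i. y (i + m)) \<in> carrier (ideal_dsum R {..<k} K)" for y
  proof -
    have 1: "(\<forall>i<m + k. y i \<in> L i) \<longleftrightarrow> (\<forall>i<m. y i \<in> J i) \<and> (\<forall>i<k. y (i + m) \<in> K i)"
    proof (intro iffI conjI allI impI)
      fix i assume a: "\<forall>i<m + k. y i \<in> L i"
      show "y i \<in> J i" if "i < m" using a[rule_format, of i] that unfolding L_def by simp
      show "y (i + m) \<in> K i" if "i < k" using a[rule_format, of "i + m"] that unfolding L_def by simp
    next
      fix i assume a: "(\<forall>i<m. y i \<in> J i) \<and> (\<forall>i<k. y (i + m) \<in> K i)" and i: "i < m + k"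
      show "y i \<in> L i"
      proof (cases "i < m")
        case False
        then show ?thesis using a[THEN conjunct2, rule_format, of "i - m"] i unfolding L_def by auto
      qed (use a in \<open>simp add: L_def\<close>)
    qed
    have 2: "(\<forall>i. \<not> i < m + k \<longrightarrow> y i = \<zero>) \<longleftrightarrow> (\<forall>i. \<not> i < k \<longrightarrow> y (i + m) = \<zero>)"
    proof (intro iffI allI impI)
      fix i assume "\<forall>i. \<not> i < k \<longrightarrow> y (i + m) = \<zero>" "\<not> i < m + k"
      from this(1)[rule_format, of "i - m"] this(2) show "y i = \<zero>" by auto
    qed auto
    show ?thesis unfolding finite_ideal_dsum_carrier[OF finite_lessThan] using 1 2 by auto
  qed
  have \<theta>\<phi>: "(\<lambda>i. if i < m then \<theta> x i else \<zero>) = \<phi> x" if x: "x \<in> vec ?U" for x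
    using \<phi>d(1)[OF x] unfolding \<theta>_def by (auto simp: finite_ideal_dsum_carrier)
  have \<theta>\<psi>: "(\<lambda>i. \<theta> x (i + m)) = \<psi> x" for x unfolding \<theta>_def by simp
  have \<theta>hom: "\<theta> \<in> module_hom R (free_module R ?U) (ideal_dsum R {..<m + k} L)"
  proof (rule module_homI)
    show "\<theta> x \<in> carrier (ideal_dsum R {..<m + k} L)" if "x \<in> vec ?U" for x
      unfolding carr \<theta>\<phi>[OF that] \<theta>\<psi> using \<phi>d(1)[OF that] \<psi>d(1)[OF that] by simp
    show "\<theta> (x \<oplus>\<^bsub>free_module R ?U\<^esub> y) = \<theta> x \<oplus>\<^bsub>ideal_dsum R {..<m + k} L\<^esub> \<theta> y" if "x \<in> vec ?U" "y \<in> vec ?U" for x y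
      unfolding ideal_dsum_simps \<theta>_def \<phi>d(2)[OF that] \<psi>d(2)[OF that] by auto
    show "\<theta> (r \<odot>\<^bsub>free_module R ?U\<^esub> x) = r \<odot>\<^bsub>ideal_dsum R {..<m + k} L\<^esub> \<theta> x" if "r \<in> carrier R" "x \<in> vec ?U" for r x
      unfolding ideal_dsum_simps \<theta>_def \<phi>d(3)[OF that(2,1)] \<psi>d(3)[OF that(2,1)] by auto
  qed
  note \<theta>d = dsum_homD[OF \<theta>hom fg_ideal_ideal[OF L], simplified]
  \<comment> \<open>Since \<open>\<rho>'\<close> is zero everywhere, \<open>\<psi> x = 0\<close>
    forces \<open>\<rho> x = 0\<close>; together with \<open>\<phi> x = 0\<close> this gives
    \<open>x = 0\<close> by the first run.\<close>
  have inj: "x = (\<lambda>_. \<zero>)" if x: "x \<in> vec ?U" and z: "\<theta> x = (\<lambda>_. \<zero>)" for x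
  proof -
    have "\<psi> x = (\<lambda>_. \<zero>)" "\<phi> x = (\<lambda>_. \<zero>)" using \<theta>\<psi>[of x] \<theta>\<phi>[OF x] unfolding z by auto
    moreover from this have "\<rho> x = (\<lambda>_. \<zero>)" using s2(12)[OF x _ s2(14)[OF x]] by simp
    ultimately show ?thesis using s1(12)[OF x] by simp
  qed
  have "inj_on \<theta> (vec ?U)"
  proof (rule inj_onI)
    fix x y assume x: "x \<in> vec ?U" and y: "y \<in> vec ?U" and e: "\<theta> x = \<theta> y"
    have y': "(\<lambda>i. (\<ominus> \<one>) \<otimes> y i) \<in> vec ?U" by (rule vec_closed(3)[OF y]) simp
    have "\<theta> (\<lambda>i. x i \<oplus> (\<ominus> \<one>) \<otimes> y i) = (\<lambda>i. \<theta> x i \<oplus> (\<ominus> \<one>) \<otimes> \<theta> y i)"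
      using \<theta>d(2)[OF x y'] \<theta>d(3)[OF y, of "\<ominus> \<one>"] by simp
    also have "\<dots> = (\<lambda>_. \<zero>)" unfolding e using \<theta>d(5)[OF y] by (simp add: l_minus r_neg)
    finally have "(\<lambda>i. x i \<oplus> (\<ominus> \<one>) \<otimes> y i) = (\<lambda>_. \<zero>)" by (rule inj[OF vec_closed(2)[OF x y']])
    then have "x i \<oplus> (\<ominus> \<one>) \<otimes> y i = \<zero>" for i by (rule fun_cong)
    then have "x i \<ominus> y i = \<zero>" for i
      using vecD(1)[OF y] by (simp add: l_minus a_minus_def)
    then show "x = y" using vecD(1)[OF x] vecD(1)[OF y] by (intro ext) simp
  qed
  moreover have "\<theta> ` vec ?U = carrier (ideal_dsum R {..<m + k} L)"
  proof
    show "\<theta> ` vec ?U \<subseteq> carrier (ideal_dsum R {..<m + k} L)" using \<theta>d(1) by auto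
    show "carrier (ideal_dsum R {..<m + k} L) \<subseteq> \<theta> ` vec ?U"
    proof
      fix y assume "y \<in> carrier (ideal_dsum R {..<m + k} L)"
      then have y: "(\<lambda>i. if i < m then y i else \<zero>) \<in> carrier (ideal_dsum R {..<m} J)"
        "(\<lambda>i. y (i + m)) \<in> carrier (ideal_dsum R {..<k} K)" unfolding carr by auto
      obtain x where x: "x \<in> vec ?U" "\<phi> x = (\<lambda>i. if i < m then y i else \<zero>)" "\<rho> x = (\<lambda>_. \<zero>)"
        using s1(13)[OF y(1)] by auto
      obtain z where z: "z \<in> vec ?U" "\<psi> z = (\<lambda>i. y (i + m))" using s2(13)[OF y(2)] by auto
      note \<rho>z = \<rho>d(1)[OF z(1)]
      note \<phi>\<rho> = s1(11)[OF z(1)] and \<psi>\<rho> = s2(10)[OF z(1)] s2(10)[OF x(1)]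
      have \<psi>x: "\<psi> x = (\<lambda>_. \<zero>)" using \<psi>\<rho>(2) \<psi>d(4) unfolding x(3) by simp
      \<comment> \<open>Replacing \<open>z\<close> by \<open>\<rho> z\<close> keeps the value of
        \<open>\<psi>\<close> and makes that of \<open>\<phi>\<close> zero. Conversely
        \<open>\<psi>\<close> vanishes at \<open>x\<close>, because it factors through
        \<open>\<rho>\<close> and \<open>\<rho> x\<close> is zero.\<close>
      have "\<theta> (\<lambda>i. x i \<oplus> \<rho> z i) = y"
      proof
        fix i
        have "\<theta> x i \<in> carrier R" "\<theta> (\<rho> z) i \<in> carrier R" using \<theta>d(5)[OF x(1)] \<theta>d(5)[OF \<rho>z] by auto
        moreover have "\<theta> x i = (if i < m then y i else \<zero>)" unfolding \<theta>_def x(2) \<psi>x by simp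
        moreover have "\<theta> (\<rho> z) i = (if i < m then \<zero> else y i)" unfolding \<theta>_def \<phi>\<rho> \<psi>\<rho>(1) z(2) by simp
        ultimately show "\<theta> (\<lambda>i. x i \<oplus> \<rho> z i) i = y i" unfolding \<theta>d(2)[OF x(1) \<rho>z] by (auto split: if_splits)
      qed
      then show "y \<in> \<theta> ` vec ?U" using vec_closed(2)[OF x(1) \<rho>z] by (intro image_eqI[of _ \<theta>]) auto
    qed
  qed
  ultimately have iso: "\<theta> \<in> module_iso R (free_module R ?U) (ideal_dsum R {..<m + k} L)"
    unfolding module_iso_def bij_betw_def using \<theta>hom by simp
  \<comment> \<open>\<open>\<rho>\<close> vanishes on \<open>H\<close> and \<open>\<psi>\<close>
    factors through \<open>\<rho>\<close>, so \<open>H\<close> has no component in the second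
    family.\<close>
  have "\<theta> x = \<phi> x" if x: "x \<in> ?H" for x
  proof -
    have xv: "x \<in> vec ?U" using submodule_vecD(1)[OF H x] .
    have "\<psi> x = (\<lambda>_. \<zero>)" using s2(10)[OF xv] \<psi>d(4) unfolding s1(14)[OF x] by simp
    show ?thesis
    proof
      fix i
      have "\<phi> x i = (if i < m then \<theta> x i else \<zero>)" using fun_cong[OF \<theta>\<phi>[OF xv], of i] by simp
      then show "\<theta> x i = \<phi> x i" unfolding \<theta>_def \<open>\<psi> x = (\<lambda>_. \<zero>)\<close> by (cases "i < m") auto
    qed
  qed
  then have "\<theta> ` ?H = \<phi> ` ?H" by (rule image_cong[OF refl])
  also have "\<dots> = carrier (ideal_dsum R {..<m} (\<lambda>i. I i \<cdot> J i))" by (rule s1(15))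
  also have "\<dots> = carrier (ideal_dsum R {..<m} (\<lambda>i. I i \<cdot> L i))"
    unfolding finite_ideal_dsum_carrier[OF finite_lessThan] L_def by auto
  finally have im: "\<theta> ` ?H = carrier (ideal_dsum R {..<m} (\<lambda>i. I i \<cdot> L i))" .
  have I: "\<forall>i<m. invertible_ideal R (I i)" "\<forall>i j. i \<le> j \<and> j < m \<longrightarrow> I j \<subseteq> I i" using s1(2,4) by auto
  show ?thesis
    by (rule exI[of _ "m + k"], rule exI[of _ m], rule exI[of _ L], rule exI[of _ I], rule exI[of _ \<theta>])
      (use L I iso im in auto)
qed

end

theorem theorem1:
  fixes R :: "('a, 'b) ring_scheme"
  assumes "cring R"
    and "semihereditary R"
    and "almost_local_global R"
  shows "stacked_bases_property TYPE('f) TYPE('m) R"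
proof -
  interpret semihereditary_cring R
    by (intro semihereditary_cring.intro semihereditary_cring_axioms.intro assms)
  show ?thesis
    unfolding stacked_bases_property_def
  proof (intro allI impI, elim conjE)
    fix F :: "('a, 'f) module" and M :: "('a, 'm) module" and H p
    assume M: "finitely_presented R M" and F: "finite_free_module R F"
      and p: "p \<in> module_hom R F M" "p ` carrier F = carrier M" and H: "a_kernel F M p = H"
    obtain N :: nat and \<theta> where \<theta>: "\<theta> \<in> module_iso R (free_module R {..<N}) F"
      using F unfolding finite_free_module_def by blast
    then have \<theta>hom: "\<theta> \<in> module_hom R (free_module R {..<N}) F" and \<theta>bij: "bij_betw \<theta> (vec {..<N}) (carrier F)"
      unfolding module_iso_def by auto
    have \<theta>im: "\<theta> ` vec {..<N} = carrier F" using \<theta>bij by (rule bij_betw_imp_surj_on)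
    have "(\<lambda>x. p (\<theta> x)) ` vec {..<N} = carrier M"
      unfolding p(2)[symmetric] \<theta>im[symmetric] by (simp add: image_image)
    \<comment> \<open>Finite presentation of \<open>M\<close> enters here: it makes the kernel
      finitely generated for the given presentation, and not only for the one that witnesses
      it.\<close>
    then obtain B where B: "finite B" "B \<subseteq> vec {..<N}" "{x \<in> vec {..<N}. p (\<theta> x) = \<zero>\<^bsub>M\<^esub>} = lspan {..<N} B"
      using kernel_finitely_generated[OF M module_hom_comp[OF \<theta>hom p(1)]] by blast
    obtain n m :: nat and J I \<phi> where *: "m \<le> n" "\<forall>i<n. fg_ideal R (J i)" "\<forall>i<m. invertible_ideal R (I i)"
      "\<forall>i j. i \<le> j \<and> j < m \<longrightarrow> I j \<subseteq> I i" "\<phi> \<in> module_iso R (free_module R {..<N}) (ideal_dsum R {..<n} J)"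
      "\<phi> ` lspan {..<N} B = carrier (ideal_dsum R {..<m} (\<lambda>i. I i \<cdot>\<^bsub>R\<^esub> J i))"
      using stacked_bases_vec[OF assms(3) B(1,2)] by (elim exE conjE) (rule that)
    let ?\<eta> = "inv_into (vec {..<N}) \<theta>"
    have iso: "(\<lambda>y. \<phi> (?\<eta> y)) \<in> module_iso R F (ideal_dsum R {..<n} J)"
      by (rule module_iso_comp[OF module_iso_inv[OF module_free \<theta>] *(5)])
    have "?\<eta> ` H = lspan {..<N} B"
    proof -
      have "H = \<theta> ` {x \<in> vec {..<N}. p (\<theta> x) = \<zero>\<^bsub>M\<^esub>}"
        unfolding H[symmetric] a_kernel_def' \<theta>im[symmetric] by auto
      then show ?thesis unfolding B(3)[symmetric]
        using inv_into_image_cancel[OF bij_betw_imp_inj_on[OF \<theta>bij], of "{x \<in> vec {..<N}. p (\<theta> x) = \<zero>\<^bsub>M\<^esub>}"] by auto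
    qed
    then have im: "(\<lambda>y. \<phi> (?\<eta> y)) ` H = carrier (ideal_dsum R {..<m} (\<lambda>i. I i \<cdot>\<^bsub>R\<^esub> J i))"
      unfolding *(6)[symmetric] by (simp add: image_image[symmetric])
    show "\<exists>(n::nat) (m::nat) J I \<phi>. m \<le> n \<and> (\<forall>i<n. fg_ideal R (J i)) \<and>
        (\<forall>i<m. invertible_ideal R (I i)) \<and> (\<forall>i j. i \<le> j \<and> j < m \<longrightarrow> I j \<subseteq> I i) \<and>
        \<phi> \<in> module_iso R F (ideal_dsum R {..<n} J) \<and>
        \<phi> ` H = carrier (ideal_dsum R {..<m} (\<lambda>i. I i \<cdot>\<^bsub>R\<^esub> J i))"
      by (rule exI[of _ n], rule exI[of _ m], rule exI[of _ J], rule exI[of _ I],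
          rule exI[of _ "\<lambda>y. \<phi> (?\<eta> y)"], intro conjI) (fact *(1-4) iso im)+
  qed
qed

end
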